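(* Let $r\ge 4$. Let $\mathcal K=\mathbb C(q^{1/2})$ and let $\mathcal U_q=\mathcal U_q(\mathfrak{sl}_2)$ be the quantised universal enveloping algebra of $\mathfrak{sl}_2$ over $\mathcal K$. Let $V_q$ be the irreducible three-dimensional $\mathcal U_q$-module with highest weight $2$, and let $$\eta_q:BMW_r(\mathcal K)\longrightarrow E_r(2,q):=\mathrm{End}_{\mathcal U_q}(V_q^{\otimes r})$$ be the surjective $\mathcal K$-algebra homomorphism which sends each generator $g_i$ to the $R$-matrix acting on the $i$-th and $(i+1)$-st tensor factors. Then the kernel of $\eta_q$ is the two-sided ideal of $BMW_r(\mathcal K)$ generated by the element $\Phi_q$. In particular, $E_r(2,q)$ has the following presentation as a $\mathcal K$-algebra: it has generators $g_i^{\pm1},e_i$ ($i=1,\dots,r-1$), with the defining relations of $BMW_r(\mathcal K)$ together with the relation $\Phi_q=0$.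
   Context: $q^{1/2}$ is an indeterminate over $\mathbb C$; $[3]_q=q^2+1+q^{-2}$. The algebra $BMW_r(\mathcal K)$ is the associative unital $\mathcal K$-algebra with generators $g_1^{\pm1},\dots,g_{r-1}^{\pm1},e_1,\dots,e_{r-1}$ and relations (for all indices for which they make sense) - $g_ig_j=g_jg_i$ if $|i-j|\ge 2$; - $g_ig_{i+1}g_i=g_{i+1}g_ig_{i+1}$ for $1\le i\le r-2$; - $g_i-g_i^{-1}=(q^2-q^{-2})(1-e_i)$ for all $i$; - $g_ie_i=e_ig_i=q^{-4}e_i$; - $e_ig_{i-1}^{\pm1}e_i=q^{\pm4}e_i$ and $e_ig_{i+1}^{\pm1}e_i=q^{\pm4}e_i$. The $R$-matrix on $V_q\otimes V_q$ is the standard $\mathcal U_q$-linear braiding automorphism (universal $R$-matrix composed with the flip), which acts on the summands of highest weight $4,2,0$ of $V_q\otimes V_q$ as the scalars $q^2,-q^{-2},q^{-4}$ respectively. It is known that $g_i\mapsto$ ($R$-matrix on factors $i,i+1$) defines a surjective homomorphism $\eta_q$; the image of $e_i$ is determined by the third relation. The element $\Phi_q$ is defined as follows. Put $f_i=-g_i-(1-q^{-2})e_i+q^2$, $F_q=f_1f_3$, $e_{14}=g_3^{-1}g_1e_2g_1^{-1}g_3$, $e_{1234}=e_2g_1g_3^{-1}g_2g_1^{-1}g_3$. Then $$\Phi_q=aF_qe_2F_q-bF_q-cF_qe_2e_{14}F_q+dF_qe_{1234}F_q,$$ where $$a=1+(1-q^{-2})^2,\qquad b=1+(1-q^2)^2+(1-q^{-2})^2,$$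 $$c=\frac{1+(2+q^{-2})(1-q^{-2})^2+(1+q^2)(1-q^{-2})^4}{([3]_q-1)^2},\qquad d=(q-q^{-1})^2.$$ This is an element of the subalgebra $BMW_4(\mathcal K)\subseteq BMW_r(\mathcal K)$ generated by the $g_i^{\pm1},e_i$ with $i\le 3$. *)

theory Defs
  imports
    Complex_Main
    "HOL-Library.Poly_Mapping"
    "HOL-Library.FuncSet"
    "HOL-Computational_Algebra.Polynomial"
    "HOL-Computational_Algebra.Fraction_Field"
    "HOL-Algebra.QuotRing"
    "HOL-Algebra.Module"
begin

section \<open>The ground field\<close>

type_synonym qfield = "complex poly fract"

definition qhalf :: qfield
  where "qhalf = Fract [:0, 1:] 1"

definition q :: qfield
  where "q = qhalf ^ 2"

definition qint :: "nat \<Rightarrow> qfield"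
  where "qint n = (q powi int n - q powi (- int n)) / (q - inverse q)"

definition qfact :: "nat \<Rightarrow> qfield"
  where "qfact n = (\<Prod>k = 1..n. qint k)"


section \<open>Free and presented algebras\<close>

text \<open>
  Words form a monoid under concatenation, so finitely supported functions on words, with the
  convolution product of \<^theory>\<open>HOL-Library.Poly_Mapping\<close>, are the noncommutative polynomials.
\<close>

instantiation list :: (type) monoid_add
begin

definition zero_list :: "'a list"
  where "zero_list = []"

definition plus_list :: "'a list \<Rightarrow> 'a list \<Rightarrow> 'a list"
  where "plus_list = (@)"

instance
  by standard (simp_all add: zero_list_def plus_list_def)

end

type_synonym 'x ncpoly = "'x list \<Rightarrow>\<^sub>0 qfield"

abbreviation word :: "'x list \<Rightarrow> 'x ncpoly"
  where "word w \<equiv> Poly_Mapping.single w 1"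

abbreviation letter :: "'x \<Rightarrow> 'x ncpoly"
  where "letter x \<equiv> word [x]"

text \<open>Scalars are the multiples of the empty word; scalar multiplication is multiplication by them.\<close>

abbreviation sc :: "qfield \<Rightarrow> 'x ncpoly"
  where "sc c \<equiv> Poly_Mapping.single [] c"

definition lin :: "('x list \<Rightarrow> 'y ncpoly) \<Rightarrow> 'x ncpoly \<Rightarrow> 'y ncpoly"
  where "lin f p = (\<Sum>w\<in>Poly_Mapping.keys p. sc (Poly_Mapping.lookup p w) * f w)"

definition free_algebra :: "'x set \<Rightarrow> (qfield, 'x ncpoly) module"
  where "free_algebra X =
    \<lparr>carrier = {p. \<forall>w\<in>Poly_Mapping.keys p. set w \<subseteq> X},
     mult = (*), one = 1, zero = 0, add = (+), smult = (\<lambda>c p. sc c * p)\<rparr>"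

text \<open>The quotient ring \<open>A Quot J\<close> with the induced scalar multiplication.\<close>

definition quot_algebra :: "('k, 'a) module \<Rightarrow> 'a set \<Rightarrow> ('k, 'a set) module"
  where "quot_algebra A J =
    \<lparr>carrier = carrier (A Quot J), mult = mult (A Quot J), one = one (A Quot J),
     zero = zero (A Quot J), add = add (A Quot J),
     smult = (\<lambda>c Y. \<Union>y\<in>Y. J +>\<^bsub>A\<^esub> (c \<odot>\<^bsub>A\<^esub> y))\<rparr>"

text \<open>Relations are given as elements of the free algebra that are set to zero.\<close>

definition presented_algebra :: "'x set \<Rightarrow> 'x ncpoly set \<Rightarrow> (qfield, 'x ncpoly set) module"
  where "presented_algebra X S = quot_algebra (free_algebra X) (Idl\<^bsub>free_algebra X\<^esub> S)"

definition pclass :: "'x set \<Rightarrow> 'x ncpoly set \<Rightarrow> 'x ncpoly \<Rightarrow> 'x ncpoly set"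
  where "pclass X S p = (Idl\<^bsub>free_algebra X\<^esub> S) +>\<^bsub>free_algebra X\<^esub> p"

definition algebra_hom :: "('k, 'a) module \<Rightarrow> ('k, 'b) module \<Rightarrow> ('a \<Rightarrow> 'b) set"
  where "algebra_hom A B =
    {h \<in> ring_hom A B. \<forall>c. \<forall>x\<in>carrier A. h (c \<odot>\<^bsub>A\<^esub> x) = c \<odot>\<^bsub>B\<^esub> h x}"


section \<open>The quantised enveloping algebra of \<open>sl\<^sub>2\<close>\<close>

datatype uq_gen = UE | UF | UK | UKinv

definition uq_rels :: "uq_gen ncpoly set"
  where "uq_rels =
    {letter UK * letter UKinv - 1,
     letter UKinv * letter UK - 1,
     letter UK * letter UE * letter UKinv - sc (q powi 2) * letter UE,
     letter UK * letter UF * letter UKinv - sc (q powi -2) * letter UF,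
     letter UE * letter UF - letter UF * letter UE
       - sc (inverse (q - inverse q)) * (letter UK - letter UKinv)}"

definition Uq :: "(qfield, uq_gen ncpoly set) module"
  where "Uq = presented_algebra UNIV uq_rels"


section \<open>Tensor powers of the three-dimensional module\<close>

text \<open>
  The weight basis of \<open>V\<close>, of weights 2, 0, -2. The space \<open>V\<^sup>\<otimes>\<^sup>r\<close> is the homogeneous component of
  degree \<open>r\<close> of the tensor algebra of \<open>V\<close>, i.e. of the noncommutative polynomials in the basis;
  in particular the product of two such polynomials is their tensor product.
\<close>

datatype vbasis = Vp | Vz | Vm

primrec wt :: "vbasis \<Rightarrow> int" where
  "wt Vp = 2"
| "wt Vz = 0"
| "wt Vm = -2"

primrec V_E :: "vbasis \<Rightarrow> vbasis ncpoly" where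
  "V_E Vp = 0"
| "V_E Vz = sc (qint 2) * letter Vp"
| "V_E Vm = letter Vz"

primrec V_F :: "vbasis \<Rightarrow> vbasis ncpoly" where
  "V_F Vp = letter Vz"
| "V_F Vz = sc (qint 2) * letter Vm"
| "V_F Vm = 0"

definition tensor_power :: "nat \<Rightarrow> vbasis ncpoly set"
  where "tensor_power r = {v. \<forall>w\<in>Poly_Mapping.keys v. length w = r}"

text \<open>
  The action of the generators on basis tensors, through the iterated coproduct
  \<open>\<Delta>(K) = K \<otimes> K\<close>, \<open>\<Delta>(E) = E \<otimes> K + 1 \<otimes> E\<close>, \<open>\<Delta>(F) = F \<otimes> 1 + K\<^sup>-\<^sup>1 \<otimes> F\<close>.
\<close>

definition K_act :: "int \<Rightarrow> vbasis list \<Rightarrow> vbasis ncpoly"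
  where "K_act k w = sc (q powi (k * (\<Sum>a\<leftarrow>w. wt a))) * word w"

primrec E_act :: "vbasis list \<Rightarrow> vbasis ncpoly" where
  "E_act [] = 0"
| "E_act (a # w) = V_E a * K_act 1 w + letter a * E_act w"

primrec F_act :: "vbasis list \<Rightarrow> vbasis ncpoly" where
  "F_act [] = 0"
| "F_act (a # w) = V_F a * word w + K_act (-1) [a] * F_act w"

primrec gen_act :: "uq_gen \<Rightarrow> vbasis list \<Rightarrow> vbasis ncpoly" where
  "gen_act UE = E_act"
| "gen_act UF = F_act"
| "gen_act UK = K_act 1"
| "gen_act UKinv = K_act (-1)"

definition free_act :: "uq_gen ncpoly \<Rightarrow> vbasis ncpoly \<Rightarrow> vbasis ncpoly"
  where "free_act u v = lin (\<lambda>x. foldr (\<lambda>g. lin (gen_act g)) x v) u"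

text \<open>
  The action of an element of \<open>U\<^sub>q\<close>, i.e. of a coset, is that of any of its representatives;
  by \<open>Uq_act_pclass\<close> below the choice does not matter.
\<close>

definition Uq_act :: "uq_gen ncpoly set \<Rightarrow> vbasis ncpoly \<Rightarrow> vbasis ncpoly"
  where "Uq_act Y v = the_elem ((\<lambda>u. free_act u v) ` Y)"

text \<open>
  The algebra of \<open>U\<^sub>q\<close>-endomorphisms of \<open>V\<^sup>\<otimes>\<^sup>r\<close>. Maps are extensional (undefined outside
  \<^term>\<open>tensor_power r\<close>), so that equality is equality on \<^term>\<open>tensor_power r\<close>.
\<close>

definition End_Uq :: "nat \<Rightarrow> (qfield, vbasis ncpoly \<Rightarrow> vbasis ncpoly) module"
  where "End_Uq r =
    \<lparr>carrier = {f \<in> tensor_power r \<rightarrow>\<^sub>E tensor_power r.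
       (\<forall>u\<in>tensor_power r. \<forall>v\<in>tensor_power r. f (u + v) = f u + f v) \<and>
       (\<forall>c. \<forall>v\<in>tensor_power r. f (sc c * v) = sc c * f v) \<and>
       (\<forall>Y\<in>carrier Uq. \<forall>v\<in>tensor_power r. f (Uq_act Y v) = Uq_act Y (f v))},
     mult = compose (tensor_power r),
     one = (\<lambda>v\<in>tensor_power r. v),
     zero = (\<lambda>v\<in>tensor_power r. 0),
     add = (\<lambda>f g. \<lambda>v\<in>tensor_power r. f v + g v),
     smult = (\<lambda>c f. \<lambda>v\<in>tensor_power r. sc c * f v)\<rparr>"


section \<open>The \<open>R\<close>-matrix\<close>

text \<open>
  The universal \<open>R\<close>-matrix for the coproduct above is
  \[ q^{H \otimes H / 2} \sum_{n \ge 0} q^{n (n - 1) / 2} \frac{(q - q^{-1})^n}{[n]_q!}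
     E^n \otimes F^n, \]
  and \<open>E\<^sup>3 = 0\<close> on \<open>V\<close>. The function \<open>cartan_flip\<close> is \<open>q\<^sup>H\<^sup>\<otimes>\<^sup>H\<^sup>/\<^sup>2\<close> followed by the flip, on
  basis tensors of \<open>V \<otimes> V\<close>.
\<close>

definition cartan_flip :: "vbasis list \<Rightarrow> vbasis ncpoly"
  where "cartan_flip w =
    sc (q powi (wt (w ! 0) * wt (w ! 1) div 2)) * word [w ! 1, w ! 0]"

definition braiding :: "vbasis \<Rightarrow> vbasis \<Rightarrow> vbasis ncpoly"
  where "braiding a b = lin cartan_flip (\<Sum>n\<le>2.
    sc (q ^ (n * (n - 1) div 2) * (q - inverse q) ^ n / qfact n) *
    ((lin E_act ^^ n) (letter a) * (lin F_act ^^ n) (letter b)))"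

definition R_matrix :: "nat \<Rightarrow> nat \<Rightarrow> vbasis ncpoly \<Rightarrow> vbasis ncpoly"
  where "R_matrix r i = (\<lambda>v\<in>tensor_power r.
    lin (\<lambda>w. word (take (i - 1) w) * braiding (w ! (i - 1)) (w ! i) * word (drop (i + 1) w)) v)"


section \<open>The BMW algebra\<close>

datatype bmw_gen = Gen_g nat | Gen_ginv nat | Gen_e nat

definition bmw_gens :: "nat \<Rightarrow> bmw_gen set"
  where "bmw_gens r = Gen_g ` {1..<r} \<union> Gen_ginv ` {1..<r} \<union> Gen_e ` {1..<r}"

abbreviation bmw_g :: "nat \<Rightarrow> bmw_gen ncpoly" where "bmw_g i \<equiv> letter (Gen_g i)"
abbreviation bmw_ginv :: "nat \<Rightarrow> bmw_gen ncpoly" where "bmw_ginv i \<equiv> letter (Gen_ginv i)"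
abbreviation bmw_e :: "nat \<Rightarrow> bmw_gen ncpoly" where "bmw_e i \<equiv> letter (Gen_e i)"

definition bmw_rels :: "nat \<Rightarrow> bmw_gen ncpoly set"
  where "bmw_rels r =
    {bmw_g i * bmw_ginv i - 1 |i. i \<in> {1..<r}} \<union>
    {bmw_ginv i * bmw_g i - 1 |i. i \<in> {1..<r}} \<union>
    {bmw_g i * bmw_g j - bmw_g j * bmw_g i |i j.
       i \<in> {1..<r} \<and> j \<in> {1..<r} \<and> 2 \<le> \<bar>int i - int j\<bar>} \<union>
    {bmw_g i * bmw_g (i + 1) * bmw_g i - bmw_g (i + 1) * bmw_g i * bmw_g (i + 1) |i.
       i \<in> {1..<r} \<and> i + 1 \<in> {1..<r}} \<union>
    {bmw_g i - bmw_ginv i - sc (q powi 2 - q powi -2) * (1 - bmw_e i) |i. i \<in> {1..<r}} \<union>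
    {bmw_g i * bmw_e i - sc (q powi -4) * bmw_e i |i. i \<in> {1..<r}} \<union>
    {bmw_e i * bmw_g i - sc (q powi -4) * bmw_e i |i. i \<in> {1..<r}} \<union>
    {bmw_e i * bmw_g j * bmw_e i - sc (q powi 4) * bmw_e i |i j.
       i \<in> {1..<r} \<and> j \<in> {1..<r} \<and> \<bar>int i - int j\<bar> = 1} \<union>
    {bmw_e i * bmw_ginv j * bmw_e i - sc (q powi -4) * bmw_e i |i j.
       i \<in> {1..<r} \<and> j \<in> {1..<r} \<and> \<bar>int i - int j\<bar> = 1}"

definition BMW :: "nat \<Rightarrow> (qfield, bmw_gen ncpoly set) module"
  where "BMW r = presented_algebra (bmw_gens r) (bmw_rels r)"

definition bmw :: "nat \<Rightarrow> bmw_gen ncpoly \<Rightarrow> bmw_gen ncpoly set"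
  where "bmw r = pclass (bmw_gens r) (bmw_rels r)"


section \<open>The element \<open>\<Phi>\<^sub>q\<close>\<close>

definition bmw_f :: "nat \<Rightarrow> bmw_gen ncpoly"
  where "bmw_f i = - bmw_g i - sc (1 - q powi -2) * bmw_e i + sc (q powi 2)"

definition bmw_F :: "bmw_gen ncpoly"
  where "bmw_F = bmw_f 1 * bmw_f 3"

definition e14 :: "bmw_gen ncpoly"
  where "e14 = bmw_ginv 3 * bmw_g 1 * bmw_e 2 * bmw_ginv 1 * bmw_g 3"

definition e1234 :: "bmw_gen ncpoly"
  where "e1234 = bmw_e 2 * bmw_g 1 * bmw_ginv 3 * bmw_g 2 * bmw_ginv 1 * bmw_g 3"

definition coeff_a :: qfield
  where "coeff_a = 1 + (1 - q powi -2) ^ 2"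

definition coeff_b :: qfield
  where "coeff_b = 1 + (1 - q powi 2) ^ 2 + (1 - q powi -2) ^ 2"

definition three_q :: qfield
  where "three_q = q powi 2 + 1 + q powi -2"

definition coeff_c :: qfield
  where "coeff_c =
    (1 + (2 + q powi -2) * (1 - q powi -2) ^ 2 + (1 + q powi 2) * (1 - q powi -2) ^ 4)
      / (three_q - 1) ^ 2"

definition coeff_d :: qfield
  where "coeff_d = (q - q powi -1) ^ 2"

text \<open>\<open>\<Phi>\<^sub>q\<close> as a noncommutative polynomial; its image in the BMW algebra is \<open>bmw r Phi\<close>.\<close>

definition Phi :: "bmw_gen ncpoly"
  where "Phi = sc coeff_a * bmw_F * bmw_e 2 * bmw_F - sc coeff_b * bmw_F
    - sc coeff_c * bmw_F * bmw_e 2 * e14 * bmw_F + sc coeff_d * bmw_F * e1234 * bmw_F"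


section \<open>The action of \<open>U\<^sub>q\<close> is well defined; the spectrum of the \<open>R\<close>-matrix\<close>

lemma ncpoly_induct [case_names single add]:
  fixes p :: "'a \<Rightarrow>\<^sub>0 'b::comm_monoid_add"
  assumes s: "\<And>w c. P (Poly_Mapping.single w c)" and a: "\<And>p p'. P p \<Longrightarrow> P p' \<Longrightarrow> P (p + p')"
  shows "P p"
proof -
  have fin: "P (\<Sum>w\<in>A. Poly_Mapping.single w (Poly_Mapping.lookup p w))" if "finite A" for A
    using that
  proof (induction A rule: finite_induct)
    case empty
    show ?case using s[of undefined 0] by (simp add: single_zero)
  next
    case (insert x A)
    then show ?case by (simp add: a s)
  qed
  have "p = (\<Sum>w\<in>Poly_Mapping.keys p. Poly_Mapping.single w (Poly_Mapping.lookup p w))"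
    by (rule poly_mapping_eqI)
      (simp add: lookup_sum lookup_single when_def in_keys_iff)
  with fin[of "Poly_Mapping.keys p"] show ?thesis by simp
qed

lemma single_mult: "Poly_Mapping.single v c * Poly_Mapping.single w d = Poly_Mapping.single (v @ w) (c * d)"
  for c d :: qfield
  by (simp add: mult_single plus_list_def)

lemma sc_1: "sc 1 = 1"
  unfolding zero_list_def[symmetric] by simp

lemma sc_comm: "p * sc c = sc c * p"
  by (induction p rule: ncpoly_induct) (simp_all add: single_mult distrib_left distrib_right mult.commute)

lemma sc_left_comm: "p * (sc c * p') = sc c * (p * p')"
  by (simp only: mult.assoc[symmetric] sc_comm[of p c])

lemma sc_sc: "sc c * (sc d * p) = sc (c * d) * p"
  by (simp add: mult.assoc[symmetric] single_mult)

lemma lin_superset: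
  assumes "finite A" "Poly_Mapping.keys p \<subseteq> A"
  shows "lin h p = (\<Sum>w\<in>A. sc (Poly_Mapping.lookup p w) * h w)"
  unfolding lin_def
  by (rule sum.mono_neutral_left) (use assms in \<open>auto simp: in_keys_iff\<close>)

lemma lin_add: "lin h (p + p') = lin h p + lin h p'"
proof -
  let ?A = "Poly_Mapping.keys p \<union> Poly_Mapping.keys p'"
  have "lin h (p + p') = (\<Sum>w\<in>?A. sc (Poly_Mapping.lookup (p + p') w) * h w)"
    by (rule lin_superset) (auto simp: keys_add)
  also have "\<dots> = lin h p + lin h p'"
    by (simp add: lin_superset[of ?A p] lin_superset[of ?A p'] lookup_add single_add distrib_right sum.distrib)
  finally show ?thesis .
qed

lemma lin_single: "lin h (Poly_Mapping.single w c) = sc c * h w"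
  by (subst lin_superset[of "{w}"]) auto

lemma lin_0 [simp]: "lin h 0 = 0"
  by (simp add: lin_def)

lemma lin_sc: "lin h (sc c * p) = sc c * lin h p"
  by (induction p rule: ncpoly_induct)
    (simp_all add: single_mult lin_single lin_add sc_sc distrib_left)

lemma lin_uminus: "lin h (- p) = - lin h p"
  by (metis add_eq_0_iff lin_0 lin_add)

lemma lin_diff: "lin h (p - p') = lin h p - lin h p'"
  using lin_add[of h p "- p'"] by (simp add: lin_uminus)

lemma foldr_act_add: "foldr (\<lambda>x. lin (gen_act x)) xs (v + v') =
    foldr (\<lambda>x. lin (gen_act x)) xs v + foldr (\<lambda>x. lin (gen_act x)) xs v'"
  by (induction xs) (simp_all add: lin_add)

lemma foldr_act_sc: "foldr (\<lambda>x. lin (gen_act x)) xs (sc c * v) = sc c * foldr (\<lambda>x. lin (gen_act x)) xs v"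
  by (induction xs) (simp_all add: lin_sc)

lemma free_act_single:
  "free_act (Poly_Mapping.single xs c) v = sc c * foldr (\<lambda>x. lin (gen_act x)) xs v"
  by (simp add: free_act_def lin_single)

lemma free_act_add: "free_act (u + u') v = free_act u v + free_act u' v"
  by (simp add: free_act_def lin_add)

lemma free_act_diff: "free_act (u - u') v = free_act u v - free_act u' v"
  by (simp add: free_act_def lin_diff)

lemma free_act_uminus: "free_act (- u) v = - free_act u v"
  by (simp add: free_act_def lin_uminus)

lemma free_act_0 [simp]: "free_act 0 v = 0"
  by (simp add: free_act_def)

lemma free_act_right_add: "free_act u (v + v') = free_act u v + free_act u v'"
  by (induction u rule: ncpoly_induct)
    (simp_all add: free_act_single free_act_add foldr_act_add distrib_left add_ac)

lemma free_act_right_sc: "free_act u (sc c * v) = sc c * free_act u v"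
  by (induction u rule: ncpoly_induct)
    (simp_all add: free_act_single free_act_add foldr_act_sc sc_sc mult.commute distrib_left)

lemma free_act_right_0: "free_act u 0 = 0"
  using free_act_right_sc[of u 0 0] by (simp add: single_zero)

lemma free_act_mult: "free_act (u * u') v = free_act u (free_act u' v)"
proof (induction u rule: ncpoly_induct)
  case (single xs c)
  show ?case
    by (induction u' rule: ncpoly_induct)
      (simp_all add: single_mult free_act_single free_act_add foldr_act_add foldr_act_sc
        sc_sc distrib_left)
next
  case (add p p')
  then show ?case by (simp add: distrib_right free_act_add)
qed

lemma free_act_1: "free_act 1 v = v"
  unfolding sc_1[symmetric] by (simp add: free_act_single) (simp add: sc_1)

lemma free_act_sc: "free_act (sc c * u) v = sc c * free_act u v"
  by (simp add: free_act_def lin_sc)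

lemma free_act_scalar: "free_act (sc c) v = sc c * v"
  by (simp add: free_act_single)

lemma free_act_letter: "free_act (letter x) v = lin (gen_act x) v"
  by (simp add: free_act_single sc_1)


lemma q_nonzero [simp]: "q \<noteq> 0"
proof -
  have "qhalf \<noteq> 0" by (simp add: qhalf_def Zero_fract_def eq_fract)
  then show ?thesis by (simp add: q_def)
qed

lemma K_mult: "lin (K_act k) (u * v) = lin (K_act k) u * lin (K_act k) v"
proof (induction u rule: ncpoly_induct)
  case (single w c)
  show ?case
    by (induction v rule: ncpoly_induct)
      (simp_all add: single_mult lin_single lin_add K_act_def sc_sc distrib_left
         power_int_add mult_ac)
next
  case (add p p')
  then show ?case by (simp add: distrib_right lin_add)
qed

lemma K_K: "lin (K_act k) (lin (K_act l) v) = lin (K_act (k + l)) v"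
  by (induction v rule: ncpoly_induct)
    (simp_all add: single_mult lin_single lin_add K_act_def power_int_add distrib_right mult_ac)

lemma K_0: "lin (K_act 0) v = v"
  by (induction v rule: ncpoly_induct)
    (simp_all add: single_mult lin_single lin_add K_act_def)

lemma E_letter: "lin E_act (letter a * v) = V_E a * lin (K_act 1) v + letter a * lin E_act v"
  by (induction v rule: ncpoly_induct)
    (simp_all add: single_mult lin_single lin_add sc_left_comm[of "V_E a"] sc_left_comm[of "letter a"]
      distrib_left add_ac)

lemma F_letter: "lin F_act (letter a * v) = V_F a * v + lin (K_act (-1)) (letter a) * lin F_act v"
proof -
  have K: "lin (K_act (-1)) (letter a) = K_act (-1) [a]"
    by (simp add: lin_single sc_1)
  have w: "V_F a * Poly_Mapping.single w c = sc c * (V_F a * word w)" for w c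
    by (simp add: sc_left_comm[of "V_F a", symmetric] single_mult)
  show ?thesis
    unfolding K
  proof (induction v rule: ncpoly_induct)
    case (single w c)
    have "lin F_act (letter a * Poly_Mapping.single w c) = sc c * (V_F a * word w + K_act (-1) [a] * F_act w)"
      by (simp add: single_mult lin_single)
    also have "\<dots> = V_F a * Poly_Mapping.single w c + K_act (-1) [a] * lin F_act (Poly_Mapping.single w c)"
      by (simp only: w[of w c] lin_single distrib_left sc_left_comm[of "K_act (-1) [a]"])
    finally show ?case .
  next
    case (add p p')
    then show ?case by (simp add: distrib_left lin_add add_ac)
  qed
qed

lemma word_Cons: "word (a # w) = letter a * word w"
  by (simp add: single_mult)

lemma single_sc: "Poly_Mapping.single w c = sc c * word w"
  by (simp add: single_mult)

lemma EE_letter: "lin E_act (letter a) = V_E a"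
  by (simp add: lin_single sc_1 K_act_def single_mult)

lemma FF_letter: "lin F_act (letter a) = V_F a"
  by (simp add: lin_single sc_1)

lemma act_1: "lin E_act 1 = 0" "lin F_act 1 = 0" "lin (K_act k) 1 = 1"
  unfolding sc_1[symmetric] by (simp_all add: lin_single K_act_def single_mult)

lemma linear_ext:
  assumes "\<And>w. P (word w)" "\<And>c p. P p \<Longrightarrow> P (sc c * p)" "\<And>p p'. P p \<Longrightarrow> P p' \<Longrightarrow> P (p + p')"
  shows "P p"
proof (induction p rule: ncpoly_induct)
  case (single w c)
  show ?case using assms(1,2) by (simp only: single_sc[of w c])
next
  case (add p p')
  then show ?case by (rule assms(3))
qed

lemma EE_mult: "lin E_act (u * v) = lin E_act u * lin (K_act 1) v + u * lin E_act v"
proof (induction u rule: linear_ext)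
  case (1 w)
  show ?case
  proof (induction w)
    case Nil
    show ?case by (simp add: sc_1 act_1)
  next
    case (Cons a w)
    have "lin E_act (word (a # w) * v) = lin E_act (letter a * (word w * v))"
      by (simp only: word_Cons[of a w] mult.assoc)
    also have "\<dots> = V_E a * (lin (K_act 1) (word w) * lin (K_act 1) v) + letter a * (lin E_act (word w) * lin (K_act 1) v + word w * lin E_act v)"
      by (simp only: E_letter K_mult Cons.IH)
    also have "\<dots> = lin E_act (word (a # w)) * lin (K_act 1) v + word (a # w) * lin E_act v"
      by (simp only: word_Cons[of a w] E_letter distrib_left distrib_right mult.assoc add.assoc)
    finally show ?case .
  qed
next
  case (2 c p)
  then show ?case by (simp only: mult.assoc lin_sc distrib_left)
next
  case (3 p p')
  then show ?case by (simp add: distrib_right lin_add add_ac)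
qed

lemma FF_mult: "lin F_act (u * v) = lin F_act u * v + lin (K_act (-1)) u * lin F_act v"
proof (induction u rule: linear_ext)
  case (1 w)
  show ?case
  proof (induction w)
    case Nil
    show ?case by (simp add: sc_1 act_1)
  next
    case (Cons a w)
    have "lin F_act (word (a # w) * v) = lin F_act (letter a * (word w * v))"
      by (simp only: word_Cons[of a w] mult.assoc)
    also have "\<dots> = V_F a * (word w * v) + lin (K_act (-1)) (letter a) * (lin F_act (word w) * v + lin (K_act (-1)) (word w) * lin F_act v)"
      by (simp only: F_letter Cons.IH)
    also have "\<dots> = lin F_act (word (a # w)) * v + lin (K_act (-1)) (word (a # w)) * lin F_act v"
      by (simp only: word_Cons[of a w] F_letter K_mult distrib_left distrib_right mult.assoc add.assoc)
    finally show ?case .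
  qed
next
  case (2 c p)
  then show ?case by (simp only: mult.assoc lin_sc distrib_left)
next
  case (3 p p')
  then show ?case by (simp add: distrib_right lin_add add_ac)
qed

lemma K_letter: "lin (K_act k) (letter a) = sc (q powi (k * wt a)) * letter a"
  by (simp add: lin_single K_act_def single_mult)

lemma K_E_letter: "lin (K_act k) (V_E a) = sc (q powi (2 * k)) * lin E_act (lin (K_act k) (letter a))"
  by (cases a) (simp_all add: lin_single K_act_def single_mult power_int_minus mult.commute)

lemma K_F_letter: "lin (K_act k) (V_F a) = sc (q powi (- 2 * k)) * lin F_act (lin (K_act k) (letter a))"
  by (cases a) (simp_all add: lin_single K_act_def single_mult power_int_minus mult.commute)

lemma K_E: "lin (K_act k) (lin E_act v) = sc (q powi (2 * k)) * lin E_act (lin (K_act k) v)"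
proof (induction v rule: linear_ext)
  case (1 w)
  show ?case
  proof (induction w)
    case Nil
    show ?case by (simp add: sc_1 act_1)
  next
    case (Cons a w)
    have "lin (K_act k) (lin E_act (word (a # w))) =
        lin (K_act k) (V_E a) * lin (K_act k) (lin (K_act 1) (word w)) + lin (K_act k) (letter a) * lin (K_act k) (lin E_act (word w))"
      by (simp only: word_Cons[of a w] E_letter lin_add K_mult)
    also have "lin (K_act k) (lin (K_act 1) (word w)) = lin (K_act 1) (lin (K_act k) (word w))"
      by (simp only: K_K add.commute)
    also have "lin (K_act k) (V_E a) * lin (K_act 1) (lin (K_act k) (word w)) + lin (K_act k) (letter a) * lin (K_act k) (lin E_act (word w)) =
        sc (q powi (2 * k)) * lin E_act (lin (K_act k) (word (a # w)))"
      by (simp only: word_Cons[of a w] Cons.IH K_E_letter EE_mult K_mult distrib_left mult.assoc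
          sc_left_comm[of "lin (K_act k) (letter a)"])
    finally show ?case .
  qed
next
  case (2 c p)
  then show ?case by (simp add: lin_sc sc_sc mult.commute)
next
  case (3 p p')
  then show ?case by (simp add: lin_add distrib_left)
qed

lemma K_F: "lin (K_act k) (lin F_act v) = sc (q powi (- 2 * k)) * lin F_act (lin (K_act k) v)"
proof (induction v rule: linear_ext)
  case (1 w)
  show ?case
  proof (induction w)
    case Nil
    show ?case by (simp add: sc_1 act_1)
  next
    case (Cons a w)
    have "lin (K_act k) (lin F_act (word (a # w))) =
        lin (K_act k) (V_F a) * lin (K_act k) (word w) + lin (K_act k) (lin (K_act (-1)) (letter a)) * lin (K_act k) (lin F_act (word w))"
      by (simp only: word_Cons[of a w] F_letter lin_add K_mult)
    also have "lin (K_act k) (lin (K_act (-1)) (letter a)) = lin (K_act (-1)) (lin (K_act k) (letter a))"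
      by (simp only: K_K add.commute)
    also have "lin (K_act k) (V_F a) * lin (K_act k) (word w) + lin (K_act (-1)) (lin (K_act k) (letter a)) * lin (K_act k) (lin F_act (word w)) =
        sc (q powi (- 2 * k)) * lin F_act (lin (K_act k) (word (a # w)))"
      by (simp only: word_Cons[of a w] Cons.IH K_F_letter FF_mult K_mult distrib_left mult.assoc
          sc_left_comm[of "lin (K_act (-1)) (lin (K_act k) (letter a))"])
    finally show ?case .
  qed
next
  case (2 c p)
  then show ?case by (simp add: lin_sc sc_sc mult.commute)
next
  case (3 p p')
  then show ?case by (simp add: lin_add distrib_left)
qed

lemma E_F: "lin E_act (lin F_act v) - lin F_act (lin E_act v) = sc (inverse (q - inverse q)) * (lin (K_act 1) v - lin (K_act (-1)) v)"
proof (induction v rule: linear_ext)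
  case (1 w)
  show ?case
  proof (induction w)
    case Nil
    show ?case by (simp add: sc_1 act_1)
  next
    case (Cons a w)
    let ?L = "letter a" and ?W = "word w" and ?c = "inverse (q - inverse q)"
    have L: "lin E_act (lin F_act ?L) - lin F_act (lin E_act ?L) = sc ?c * (lin (K_act 1) ?L - lin (K_act (-1)) ?L)"
      by (cases a)
        (simp_all add: lin_single lin_diff K_act_def qint_def single_mult right_diff_distrib
          left_diff_distrib single_diff single_uminus divide_inverse power_int_minus algebra_simps)
    have cross: "lin E_act (lin (K_act (-1)) ?L) * lin (K_act 1) (lin F_act ?W) = lin (K_act (-1)) (lin E_act ?L) * lin F_act (lin (K_act 1) ?W)"
      by (simp add: K_E[of "-1" ?L] K_F[of 1 ?W] mult.assoc sc_left_comm[of "lin E_act (lin (K_act (-1)) ?L)"])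
    have "lin E_act (lin F_act (?L * ?W)) - lin F_act (lin E_act (?L * ?W)) =
        (lin E_act (lin F_act ?L) - lin F_act (lin E_act ?L)) * lin (K_act 1) ?W + lin (K_act (-1)) ?L * (lin E_act (lin F_act ?W) - lin F_act (lin E_act ?W))"
      by (simp add: EE_mult FF_mult lin_add cross left_diff_distrib right_diff_distrib
        del: add.commute)
    also have "\<dots> = sc ?c * (lin (K_act 1) (?L * ?W) - lin (K_act (-1)) (?L * ?W))"
      by (simp add: L Cons.IH K_mult right_diff_distrib left_diff_distrib mult.assoc
        sc_left_comm[of "lin (K_act (-1)) ?L"])
    finally show ?case by (simp only: word_Cons[of a w])
  qed
next
  case (2 c p)
  then show ?case
    by (simp add: lin_sc right_diff_distrib[symmetric] sc_left_comm[of "sc (inverse (q - inverse q))"])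
next
  case (3 p p')
  then show ?case by (simp add: lin_add algebra_simps)
qed

lemma free_act_rel:
  assumes "u \<in> uq_rels"
  shows "free_act u v = 0"
proof -
  have K1: "lin (K_act 1) (lin (K_act (-1)) v) = v" "lin (K_act (-1)) (lin (K_act 1) v) = v" for v
    by (simp_all add: K_K K_0)
  have KE: "lin (K_act 1) (lin E_act (lin (K_act (-1)) v)) = sc (q powi 2) * lin E_act v" for v
    by (simp only: K_E K1) simp
  have KF: "lin (K_act 1) (lin F_act (lin (K_act (-1)) v)) = sc (q powi -2) * lin F_act v" for v
    by (simp only: K_F K1) simp
  show ?thesis
    using assms unfolding uq_rels_def
    by (auto simp: free_act_diff free_act_mult free_act_1 free_act_scalar free_act_letter K1 KE KF E_F
        simp del: single_diff)
qed

lemma ring_free_algebra: "ring (free_algebra X)"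
proof -
  have m: "set w \<subseteq> X" if "\<forall>w\<in>Poly_Mapping.keys p. set w \<subseteq> X" "\<forall>w\<in>Poly_Mapping.keys p'. set w \<subseteq> X"
    "w \<in> Poly_Mapping.keys (p * p')" for p p' :: "'a ncpoly" and w
    using that keys_mult[of p p'] by (fastforce simp: plus_list_def)
  have a: "set w \<subseteq> X" if "\<forall>w\<in>Poly_Mapping.keys p. set w \<subseteq> X" "\<forall>w\<in>Poly_Mapping.keys p'. set w \<subseteq> X"
    "w \<in> Poly_Mapping.keys (p + p')" for p p' :: "'a ncpoly" and w
    using that keys_add[of p p'] by blast
  have "abelian_group (free_algebra X)"
  proof (rule abelian_groupI)
    fix p assume "p \<in> carrier (free_algebra X)"
    then show "\<exists>p'\<in>carrier (free_algebra X). p' \<oplus>\<^bsub>free_algebra X\<^esub> p = \<zero>\<^bsub>free_algebra X\<^esub>"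
      by (intro bexI[of _ "- p"]) (simp_all add: free_algebra_def in_keys_iff)
  next
    fix p p' assume "p \<in> carrier (free_algebra X)" "p' \<in> carrier (free_algebra X)"
    then show "p \<oplus>\<^bsub>free_algebra X\<^esub> p' \<in> carrier (free_algebra X)"
      using a[of p p'] by (simp add: free_algebra_def)
  qed (simp_all add: free_algebra_def add_ac)
  moreover have "monoid (free_algebra X)"
  proof (rule monoidI)
    fix p p' assume "p \<in> carrier (free_algebra X)" "p' \<in> carrier (free_algebra X)"
    then show "p \<otimes>\<^bsub>free_algebra X\<^esub> p' \<in> carrier (free_algebra X)"
      using m[of p p'] by (simp add: free_algebra_def)
  qed (simp_all add: free_algebra_def mult.assoc zero_list_def)
  ultimately show ?thesis
    by (rule ringI) (simp_all add: free_algebra_def distrib_left distrib_right)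
qed

lemma Uq_act_pclass: "Uq_act (pclass UNIV uq_rels u) v = free_act u v"
proof -
  let ?A = "free_algebra (UNIV :: uq_gen set)"
  let ?I = "{u. \<forall>v. free_act u v = 0}"
  interpret ring ?A by (rule ring_free_algebra)
  have A [simp]: "carrier ?A = UNIV" "mult ?A = (*)" "add ?A = (+)" "zero ?A = 0"
    by (simp_all add: free_algebra_def)
  have "\<ominus>\<^bsub>?A\<^esub> u = - u" for u
    by (rule minus_equality) simp_all
  then have "inv\<^bsub>add_monoid ?A\<^esub> u = - u" for u
    by (simp add: a_inv_def)
  then have "subgroup ?I (add_monoid ?A)"
    by unfold_locales (simp_all add: free_act_add free_act_uminus)
  then have "ideal ?I ?A"
    by (rule idealI[OF ring_axioms])
     (simp_all add: free_act_mult free_act_right_0)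
  then have "Idl\<^bsub>?A\<^esub> uq_rels \<subseteq> ?I"
    by (rule genideal_minimal) (auto simp: free_act_rel)
  moreover have "0 \<in> Idl\<^bsub>?A\<^esub> uq_rels"
    using additive_subgroup.zero_closed[OF ideal.axioms(1)[OF genideal_ideal[of uq_rels]]]
    by simp
  ultimately have "(\<lambda>u. free_act u v) ` pclass UNIV uq_rels u = {free_act u v}"
    by (force simp: pclass_def a_r_coset_def' free_act_add)
  then show ?thesis by (simp add: Uq_act_def)
qed


lemma q_q_nonzero: "q - inverse q \<noteq> 0"
proof
  assume "q - inverse q = 0"
  then have "q * q = 1" by (simp add: field_simps)
  moreover have "q * q = Fract [:0, 0, 0, 0, 1:] 1"
    by (simp add: q_def qhalf_def power2_eq_square)
  moreover have "[:0, 0, 0, 0, 1:] \<noteq> (1 :: complex poly)"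
    by (simp add: one_pCons)
  ultimately show False
    by (simp add: One_fract_def eq_fract)
qed

lemma qint_1: "qint 1 = 1"
  using q_q_nonzero by (simp add: qint_def power_int_minus)

lemma qint_2: "qint 2 = q + inverse q"
proof -
  have "q powi 2 - q powi - 2 = (q + inverse q) * (q - inverse q)"
    by (simp add: power_int_minus power2_eq_square field_simps)
  then show ?thesis using q_q_nonzero by (simp add: qint_def)
qed

lemma qint_2_nonzero: "qint 2 \<noteq> 0"
proof
  assume "qint 2 = 0"
  then have "q * q = -1" unfolding qint_2 by (simp add: field_simps eq_neg_iff_add_eq_0)
  moreover have "q * q = Fract [:0, 0, 0, 0, 1:] 1"
    by (simp add: q_def qhalf_def power2_eq_square)
  moreover have "[:0, 0, 0, 0, 1:] \<noteq> (-1 :: complex poly)"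
    by (simp add: one_pCons)
  ultimately show False
    by (simp add: One_fract_def eq_fract)
qed

lemma one_plus_q_q: "1 + q * q \<noteq> 0" "q * q + 1 \<noteq> 0"
  using qint_2_nonzero by (simp_all add: qint_2 field_simps)

lemma qint_2_Suc: "qint (Suc (Suc 0)) = q + inverse q" "qint (Suc (Suc 0)) \<noteq> 0"
  using qint_2 qint_2_nonzero by (simp_all add: numeral_2_eq_2)

lemma qfact_values: "qfact 0 = 1" "qfact 1 = 1" "qfact (Suc 0) = 1" "qfact (Suc (Suc 0)) = qint 2"
  using qint_1 by (simp_all add: qfact_def numeral_2_eq_2)

lemma single_eq_single: "Poly_Mapping.single w c = Poly_Mapping.single w d \<longleftrightarrow> c = d"
  by (metis lookup_single_eq)

lemma atMost_2: "{..2::nat} = {0, 1, 2}"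
  by auto

lemma braiding_table:
  "braiding Vp Vp = sc (q ^ 2) * word [Vp, Vp]"
  "braiding Vp Vz = word [Vz, Vp]"
  "braiding Vp Vm = sc (inverse (q ^ 2)) * word [Vm, Vp]"
  "braiding Vz Vp = word [Vp, Vz] + sc ((q - inverse q) * qint 2) * word [Vz, Vp]"
  "braiding Vz Vz = word [Vz, Vz] +
     sc ((q - inverse q) * qint 2 * qint 2 * inverse (q ^ 2)) * word [Vm, Vp]"
  "braiding Vz Vm = word [Vm, Vz]"
  "braiding Vm Vp = sc (inverse (q ^ 2)) * word [Vp, Vm] + sc (q - inverse q) * word [Vz, Vz] +
     sc (inverse q * (q - inverse q) ^ 2 * qint 2) * word [Vm, Vp]"
  "braiding Vm Vz = word [Vz, Vm] + sc ((q - inverse q) * qint 2) * word [Vm, Vz]"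
  "braiding Vm Vm = sc (q ^ 2) * word [Vm, Vm]"
  by (simp_all add: atMost_2 single_eq_single qint_2_Suc(2) braiding_def qfact_values lin_single
      lin_add cartan_flip_def K_act_def single_mult funpow_Suc_right numeral_2_eq_2
      power_int_minus field_simps del: funpow.simps(2) One_nat_def)

abbreviation braiding2 :: "vbasis ncpoly \<Rightarrow> vbasis ncpoly"
  where "braiding2 \<equiv> lin (\<lambda>w. braiding (w ! 0) (w ! 1))"

lemmas tensor2_simps = braiding_table lin_single lin_add lin_diff K_act_def single_mult
  left_diff_distrib right_diff_distrib distrib_left distrib_right
  lookup_add lookup_minus lookup_single when_def qint_2_Suc(1) qint_2 power_int_minus

text \<open>The braiding is \<open>U\<^sub>q\<close>-linear.\<close>

lemma braiding2_intertwines: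
  "braiding2 (lin E_act (word [a, b])) = lin E_act (braiding2 (word [a, b]))"
  "braiding2 (lin F_act (word [a, b])) = lin F_act (braiding2 (word [a, b]))"
  "braiding2 (lin (K_act 1) (word [a, b])) = lin (K_act 1) (braiding2 (word [a, b]))"
  by (rule poly_mapping_eqI; cases a; cases b;
      auto simp: tensor2_simps one_plus_q_q field_simps eval_nat_numeral)+

text \<open>Its eigenvalues on the highest weight vectors of weights 4, 2 and 0.\<close>

lemma braiding2_weight_4:
  fixes v defines "v \<equiv> letter Vp * letter Vp"
  shows "lin E_act v = 0" "lin (K_act 1) v = sc (q powi 4) * v" "braiding2 v = sc (q powi 2) * v"
  unfolding v_def
  by (rule poly_mapping_eqI; auto simp: tensor2_simps field_simps)+

lemma braiding2_weight_2:
  fixes v defines "v \<equiv> letter Vz * letter Vp - sc (q ^ 2) * letter Vp * letter Vz"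
  shows "lin E_act v = 0" "lin (K_act 1) v = sc (q powi 2) * v" "braiding2 v = sc (- (q powi -2)) * v"
  unfolding v_def
  by (rule poly_mapping_eqI; auto simp: tensor2_simps field_simps power2_eq_square)+

lemma braiding2_weight_0:
  fixes v defines "v \<equiv> sc (q ^ 2 * qint 2) * letter Vp * letter Vm
    - sc (q ^ 2) * letter Vz * letter Vz + sc (qint 2) * letter Vm * letter Vp"
  shows "lin E_act v = 0" "lin (K_act 1) v = v" "braiding2 v = sc (q powi -4) * v"
  unfolding v_def
  by (rule poly_mapping_eqI;
      auto simp: tensor2_simps one_plus_q_q field_simps eval_nat_numeral)+

end

theory Submission
  imports Defs
begin

text \<open>
  Let \<open>Q\<close> be the BMW algebra modulo \<open>Phi\<close> and \<open>A n\<close> its subalgebra generated by the generators of index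
  less than \<open>n\<close>. That \<open>\<eta>\<close> kills \<open>Phi\<close> is a computation on the fourth tensor power. Conversely,
  \<open>A n\<close> acts faithfully on the \<open>r\<close>-th tensor power, by induction on \<open>n\<close> in steps of two. Modulo
  the ideal \<open>J n\<close> generated by the \<open>e i\<close>, the relation \<open>Phi = 0\<close> gives \<open>f 1 * f 3 = 0\<close> (from four strands on;
  on three strands the antisymmetriser is an additional basis element), so \<open>A n\<close> is
  spanned modulo \<open>J n\<close> by \<open>1\<close> and the products \<open>F i j = f i \<cdots> f j\<close>, and these act independently on the
  vectors of weight \<open>2 r - 2\<close>. Hence the kernel lies in \<open>J n\<close>. As \<open>e (n - 1) * A n * e (n - 1)\<close> is contained in
  \<open>A (n - 2) * e (n - 1)\<close>, the induction hypothesis shows \<open>J n * x * J n = 0\<close> for \<open>x\<close> in the kernel. Finally the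
  eigenvalues of the full twist \<open>T n\<close> on \<open>J n\<close> are disjoint from those on the quotient,
  so a polynomial in \<open>T n\<close> is a unit of \<open>J n\<close>, and \<open>x = 0\<close>.
\<close>

section \<open>Relations in the BMW algebra\<close>

text \<open>Injectivity is obtained without counting dimensions and without semisimplicity. Capping
  the last two of \<open>n\<close> strands leaves the algebra on \<open>n - 2\<close> strands;
  accordingly the highest weights \<open>2 * m\<close> in the \<open>n\<close>-th tensor power are
  those met two strands earlier together with new ones, \<open>m = n\<close> and
  \<open>m = n - 1\<close>, and also \<open>m = 0\<close> when \<open>n = 3\<close>. The old ones
  belong to \<open>J n\<close>, the new ones to the quotient by it. The obstacle is that
  \<open>J n * x * J n = 0\<close> says nothing about \<open>x\<close> if products in
  \<open>J n\<close> degenerate. The full twist removes it: it is central, a cap rescales it by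
  \<open>q\<close> to the power \<open>-8\<close>, so its eigenvalues follow by the same induction,
  and \<open>lam\<close> separates different \<open>m\<close>. In the converse direction
  \<open>Phi\<close> enters through its one term without \<open>e 2\<close>, whose coefficient
  \<open>coeff_b\<close> is nonzero; the other coefficients are tied to the values of
  \<open>Phi\<close> on tensors. These are computed on the nine-dimensional image of
  \<open>F\<close>, where every term becomes a product of small explicit matrices.\<close>

lemma q_power_eq_1: "q ^ n = 1 \<longleftrightarrow> n = 0"
proof
  assume "q ^ n = 1"
  moreover have "q ^ n = Fract (monom 1 (2 * n)) 1"
    by (induction n) (simp_all add: One_fract_def q_def qhalf_def power2_eq_square mult_monom
        flip: monom_0 monom_Suc)
  ultimately have "monom (1 :: complex) (2 * n) = 1"
    by (simp add: One_fract_def eq_fract)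
  then show "n = 0"
    by (metis degree_1 degree_monom_eq mult_eq_0_iff zero_neq_numeral zero_neq_one)
qed simp

lemma q_powi_inj: "q powi a = q powi b \<longleftrightarrow> a = b"
proof -
  have *: "a = b" if "q powi a = q powi b" "a \<le> b" for a b
  proof -
    have "q ^ nat (b - a) = q powi (b - a)" using that by (simp add: power_int_def)
    also have "\<dots> = 1" using that by (simp add: power_int_diff)
    finally show ?thesis using that by (simp add: q_power_eq_1)
  qed
  show ?thesis using *[of a b] *[of b a] by (metis linear)
qed

text \<open>With \<open>t = q^2\<close>, each scalar is up to a power of \<open>t\<close> a factor
  of \<open>t^4 - 1\<close>, \<open>t^3 - 1\<close> or \<open>t^6 - 1\<close>, and no positive power
  of \<open>q\<close> is 1. They are the skein constant, the eigenvalue \<open>c\<close> of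
  \<open>f i\<close>, the quantum integer \<open>[3]_q\<close>, and \<open>c - 1\<close>.\<close>

lemma q_scalars_nonzero:
  "q^2 - inverse q^2 \<noteq> 0" "q^2 + inverse q^2 \<noteq> 0" "q^2 + 1 + inverse q^2 \<noteq> 0"
  "q^2 + inverse q^2 - 1 \<noteq> 0"
proof -
  define t where "t = q^2"
  have "t \<noteq> 0" "t^2 \<noteq> 1" "t^4 \<noteq> 1" "t^3 \<noteq> 1" "t^6 \<noteq> 1"
    by (simp_all add: t_def q_power_eq_1 flip: power_mult)
  moreover have "t^4 - 1 = (t^2 - 1) * (t^2 + 1)" "t^3 - 1 = (t - 1) * (t^2 + t + 1)"
    "t^6 - 1 = (t^3 - 1) * (t + 1) * (t^2 - t + 1)"
    by (simp_all add: algebra_simps eval_nat_numeral)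
  ultimately have "t^2 - 1 \<noteq> 0" "t^2 + 1 \<noteq> 0" "t^2 + t + 1 \<noteq> 0" "t^2 - t + 1 \<noteq> 0"
    by (metis diff_eq_eq add_0 mult_zero_right)+
  moreover have "t^2 - 1 = t * (t - inverse t)" "t^2 + 1 = t * (t + inverse t)"
    "t^2 + t + 1 = t * (t + 1 + inverse t)" "t^2 - t + 1 = t * (t + inverse t - 1)"
    using \<open>t \<noteq> 0\<close> by (simp_all add: field_simps power2_eq_square)
  ultimately show "q^2 - inverse q^2 \<noteq> 0" "q^2 + inverse q^2 \<noteq> 0" "q^2 + 1 + inverse q^2 \<noteq> 0"
    "q^2 + inverse q^2 - 1 \<noteq> 0"
    unfolding power_inverse t_def[symmetric] by (metis mult_zero_right)+
qed

text \<open>Allows \<open>f13_J\<close> to solve \<open>Phi = 0\<close> for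
  \<open>f 1 * f 3\<close>.\<close>

lemma coeff_b_nonzero: "coeff_b \<noteq> 0"
proof -
  have "coeff_b = (q^2 + inverse q^2 - 1)^2"
    by (simp add: coeff_b_def power_int_minus field_simps eval_nat_numeral)
  then show ?thesis using q_scalars_nonzero(4) by (metis power_not_zero)
qed

text \<open>The class \<open>ring_1\<close> would demand \<open>0 \<noteq> 1\<close>, which is not known for a presented algebra.\<close>

locale algebra_over =
  fixes scale :: "qfield \<Rightarrow> 'a::{ring,monoid_mult} \<Rightarrow> 'a" (infixr "*s" 75)
  assumes vs: "vector_space scale"
    and scale_mult: "(c *s x) * y = c *s (x * y)"
    and mult_scale: "x * (c *s y) = c *s (x * y)"

sublocale algebra_over \<subseteq> vector_space scale by (rule vs)

locale bmw_algebra = algebra_over scale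
  for scale :: "qfield \<Rightarrow> 'a::{ring,monoid_mult} \<Rightarrow> 'a" (infixr "*s" 75) +
  fixes g h e :: "nat \<Rightarrow> 'a" and r :: nat
  assumes gh: "0 < i \<and> i < r \<Longrightarrow> g i * h i = 1"
    and hg: "0 < i \<and> i < r \<Longrightarrow> h i * g i = 1"
    and gg_far: "0 < i \<and> i < r \<Longrightarrow> 0 < j \<and> j < r \<Longrightarrow> Suc i < j \<Longrightarrow> g i * g j = g j * g i"
    and braid: "0 < i \<Longrightarrow> Suc i < r \<Longrightarrow> g i * g (Suc i) * g i = g (Suc i) * g i * g (Suc i)"
    and skein: "0 < i \<and> i < r \<Longrightarrow> g i - h i = (q^2 - inverse q^2) *s (1 - e i)"
    and ge: "0 < i \<and> i < r \<Longrightarrow> g i * e i = inverse q^4 *s e i"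
    and eg: "0 < i \<and> i < r \<Longrightarrow> e i * g i = inverse q^4 *s e i"
    and ege: "0 < i \<and> i < r \<Longrightarrow> 0 < j \<and> j < r \<Longrightarrow> i = Suc j \<or> j = Suc i \<Longrightarrow>
      e i * g j * e i = q^4 *s e i"
    and ehe: "0 < i \<and> i < r \<Longrightarrow> 0 < j \<and> j < r \<Longrightarrow> i = Suc j \<or> j = Suc i \<Longrightarrow>
      e i * h j * e i = inverse q^4 *s e i"
begin

abbreviation "k \<equiv> q^2 - inverse q^2"
abbreviation "c \<equiv> q^2 + inverse q^2"

abbreviation ok :: "nat \<Rightarrow> bool" where "ok i \<equiv> 0 < i \<and> i < r"
abbreviation adj :: "nat \<Rightarrow> nat \<Rightarrow> bool" where "adj i j \<equiv> i = Suc j \<or> j = Suc i"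
abbreviation far :: "nat \<Rightarrow> nat \<Rightarrow> bool" where "far i j \<equiv> Suc i < j \<or> Suc j < i"

lemma q_cancel: "q * inverse q = 1" "inverse q * q = 1" "q * (inverse q * x) = x"
    "inverse q * (q * x) = x"
  by (simp_all flip: mult.assoc)

lemmas expand = algebra_simps scale_mult mult_scale scale_right_distrib
  scale_right_diff_distrib scale_left_distrib scale_left_diff_distrib q_cancel
  power2_eq_square power4_eq_xxxx

lemmas scale_simps = scale_mult mult_scale scale_scale scale_right_distrib scale_right_diff_distrib

lemma scale_cancel: "a \<noteq> 0 \<Longrightarrow> a *s x = a *s y \<Longrightarrow> x = y"
  by simp

section \<open>Derived relations on two and three strands\<close>

lemma e_eq: "ok i \<Longrightarrow> e i = 1 - inverse k *s (g i - h i)"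
  using skein[of i] q_scalars_nonzero(1) by simp

lemma h_eq: "ok i \<Longrightarrow> h i = g i - k *s 1 + k *s e i"
  using skein[of i] by (simp add: algebra_simps scale_right_diff_distrib)

lemma he: assumes "ok i" shows "h i * e i = q^4 *s e i"
proof -
  have "e i = h i * (g i * e i)" by (simp add: hg[OF assms] flip: mult.assoc)
  also have "\<dots> = inverse q^4 *s (h i * e i)" by (simp add: ge[OF assms] mult_scale)
  finally have "q^4 *s e i = q^4 *s inverse q^4 *s (h i * e i)" by simp
  then show ?thesis by (simp add: field_simps)
qed

lemma eh: assumes "ok i" shows "e i * h i = q^4 *s e i"
proof -
  have "e i = (e i * g i) * h i" by (simp add: gh[OF assms] mult.assoc)
  also have "\<dots> = inverse q^4 *s (e i * h i)" by (simp add: eg[OF assms] scale_mult)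
  finally have "q^4 *s e i = q^4 *s inverse q^4 *s (e i * h i)" by simp
  then show ?thesis by (simp add: field_simps)
qed

text \<open>In the skein relation times \<open>e i\<close>, both \<open>g i\<close> and
  \<open>h i\<close> become scalars; division by \<open>k\<close> leaves \<open>[3]_q\<close>, the
  value of a closed loop.\<close>

lemma ee: assumes "ok i" shows "e i * e i = (q^2 + 1 + inverse q^2) *s e i"
proof -
  have "k *s (e i * e i) = k *s e i - e i * (g i - h i)"
    by (simp add: skein[OF assms] algebra_simps scale_simps)
  also have "\<dots> = (k - inverse q^4 + q^4) *s e i"
    by (simp add: eg[OF assms] eh[OF assms] algebra_simps)
  also have "k - inverse q^4 + q^4 = k * (q^2 + 1 + inverse q^2)"
    by (simp add: field_simps eval_nat_numeral)
  finally have "k *s (e i * e i) = k *s (q^2 + 1 + inverse q^2) *s e i" by simp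
  then show ?thesis using scale_cancel[OF q_scalars_nonzero(1)] by blast
qed

lemma eee: assumes "ok i" "ok j" "adj i j" shows "e i * e j * e i = e i"
proof -
  have "k *s (e i * e j * e i) = k *s (e i * e i) - e i * (g j - h j) * e i"
    by (simp add: skein[OF assms(2)] algebra_simps scale_simps)
  also have "e i * (g j - h j) * e i = (q^4 - inverse q^4) *s e i"
    by (simp add: left_diff_distrib right_diff_distrib ege[OF assms] ehe[OF assms] scale_left_diff_distrib)
  also have "k *s (e i * e i) - (q^4 - inverse q^4) *s e i =
      (k * (q^2 + 1 + inverse q^2) - (q^4 - inverse q^4)) *s e i"
    by (simp only: ee[OF assms(1)] scale_left_diff_distrib scale_scale)
  also have "k * (q^2 + 1 + inverse q^2) - (q^4 - inverse q^4) = k"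
    by (simp add: field_simps eval_nat_numeral)
  finally show ?thesis using scale_cancel[OF q_scalars_nonzero(1)] by blast
qed

lemma gg_comm: "ok i \<Longrightarrow> ok j \<Longrightarrow> far i j \<Longrightarrow> g i * g j = g j * g i"
  using gg_far[of i j] gg_far[of j i] by metis

lemma inv_comm:
  fixes x y z :: 'a
  assumes "x * y = 1" "y * x = 1" "x * z = z * x" shows "y * z = z * y"
proof -
  have "y * z = y * (z * x) * y" by (simp add: assms mult.assoc)
  also have "\<dots> = z * y" by (simp add: assms(2) flip: mult.assoc assms(3))
  finally show ?thesis .
qed

lemma comm_e: "ok i \<Longrightarrow> x * g i = g i * x \<Longrightarrow> x * h i = h i * x \<Longrightarrow> x * e i = e i * x"
  by (simp add: e_eq algebra_simps scale_simps)

lemma comm_h: "ok i \<Longrightarrow> x * g i = g i * x \<Longrightarrow> x * h i = h i * x"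
  using inv_comm[OF gh hg, of i x] by simp

lemma comm_ge: "ok i \<Longrightarrow> x * g i = g i * x \<Longrightarrow> x * e i = e i * x"
  by (intro comm_e comm_h)

lemma ge_comm: "ok i \<Longrightarrow> ok j \<Longrightarrow> far i j \<Longrightarrow> g i * e j = e j * g i"
  using comm_ge gg_comm by blast

lemma braid': "ok i \<Longrightarrow> ok j \<Longrightarrow> adj i j \<Longrightarrow> g i * g j * g i = g j * g i * g j"
  using braid[of i] braid[of j] by auto

text \<open>The skein relation makes \<open>e i\<close> a combination of \<open>1\<close>,
  \<open>g i\<close> and \<open>h i\<close>, and the braid relation carries each of these past
  \<open>g i * g j\<close>.\<close>

lemma gge_conj: assumes "ok i" "ok j" "adj i j" shows "g i * g j * e i = e j * g i * g j"
proof -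
  have "g i * g j * h i = h j * g j * g i * g j * h i" by (simp only: assms hg mult_1_left)
  also have "\<dots> = h j * (g j * g i * g j) * h i" by (simp only: mult.assoc)
  also have "\<dots> = h j * (g i * g j * g i) * h i" by (simp only: braid'[OF assms])
  also have "\<dots> = h j * g i * g j * (g i * h i)" by (simp only: mult.assoc)
  finally have "g i * g j * h i = h j * g i * g j" by (simp only: assms gh mult_1_right)
  then show ?thesis
    using braid'[OF assms] by (simp only: assms e_eq right_diff_distrib left_diff_distrib mult_scale
        scale_mult mult_1_right mult_1_left)
qed

text \<open>Cancelling \<open>g j\<close> and \<open>g i\<close> in the conjugation identity
  expresses \<open>e j\<close> through \<open>e i\<close>; multiplied by \<open>e i\<close>, the
  expression contains \<open>e i * h j * e i\<close>, which collapses.\<close>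

lemma gge: assumes "ok i" "ok j" "adj i j" shows "g i * g j * e i = e j * e i"
proof -
  have "e j * g i * g j = g i * g j * e i" using gge_conj[OF assms] by simp
  then have "e j * g i = g i * g j * e i * h j"
    by (metis assms(2) gh mult.assoc mult.right_neutral)
  then have "e j = g i * g j * e i * h j * h i"
    by (metis assms(1) gh mult.assoc mult.right_neutral)
  then have "e j * e i = g i * g j * e i * h j * (h i * e i)" by (simp add: mult.assoc)
  also have "\<dots> = q^4 *s (g i * g j * (e i * h j * e i))"
    by (simp add: he[OF assms(1)] mult_scale mult.assoc)
  also have "\<dots> = g i * g j * e i" by (simp only: ehe[OF assms]) (simp add: mult_scale field_simps)
  finally show ?thesis by simp
qed

lemma egg: assumes "ok i" "ok j" "adj i j" shows "e i * g j * g i = e i * e j"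
proof -
  have "e i * g j * g i = g j * g i * e j" using gge_conj[of j i] assms by auto
  then show ?thesis using gge[of j i] assms by auto
qed

lemma ge_eq_hee: assumes "ok i" "ok j" "adj i j" shows "g j * e i = h i * e j * e i"
  using gge[OF assms] assms(1) hg[of i] by (metis mult.assoc mult.left_neutral)

lemma hee_eq_ge: assumes "ok i" "ok j" "adj i j" shows "h i * (e j * e i) = g j * e i"
  using ge_eq_hee[OF assms] by (simp add: mult.assoc)

lemma eg_eq_eeh: assumes "ok i" "ok j" "adj i j" shows "e i * g j = e i * e j * h i"
  using egg[OF assms] assms(1) gh[of i] by (metis mult.assoc mult.right_neutral)

lemma gee: assumes "ok i" "ok j" "adj i j" shows "g i * e j * e i = h j * e i"
proof -
  have "h j * e i = h j * (e i * e j * e i)" using eee[OF assms] by simp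
  also have "\<dots> = h j * e i * e j * e i" by (simp add: mult.assoc)
  also have "h j * e i * e j = g i * e j" using hee_eq_ge[of j i] assms by (auto simp: mult.assoc)
  finally show ?thesis by simp
qed

lemma eeg: assumes "ok i" "ok j" "adj i j" shows "e i * e j * g i = e i * h j"
proof -
  have "e i * h j = (e i * e j * e i) * h j" using eee[OF assms] by simp
  also have "\<dots> = e i * (e j * e i * h j)" by (simp add: mult.assoc)
  also have "e j * e i * h j = e j * g i" using eg_eq_eeh[of j i] assms by auto
  finally show ?thesis by (simp add: mult.assoc)
qed

lemma geg: assumes "ok i" "ok j" "adj i j" shows "g i * e j * g i = h j * e i * h j"
proof -
  have "g i * e j * g i = h j * g j * g i * e j * g i" by (simp only: assms hg mult_1_left)
  also have "\<dots> = h j * (g j * g i * e j) * g i" by (simp only: mult.assoc)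
  also have "g j * g i * e j = e i * e j" using gge[of j i] assms by auto
  also have "h j * (e i * e j) * g i = h j * e i * (e j * g i)" by (simp add: mult.assoc)
  also have "\<dots> = h j * (e i * e j * g i)" by (simp add: mult.assoc)
  finally show ?thesis using eeg[OF assms] by (simp add: mult.assoc)
qed

lemma gsq: assumes "ok i" shows "g i * g i = 1 + k *s g i - (k * inverse q^4) *s e i"
proof -
  have "g i * (g i - h i) = k *s g i - (k * inverse q^4) *s e i"
    by (simp only: skein[OF assms]) (simp add: expand ge assms)
  then show ?thesis by (simp add: gh[OF assms] algebra_simps)
qed

text \<open>Up to the factor \<open>c\<close>, the projection onto the eigenvalue
  \<open>- inverse q^2\<close> of \<open>g i\<close>: the combination vanishes at the eigenvalues
  \<open>q^2\<close> and \<open>inverse q^4\<close>. On tensors this is the summand of highest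
  weight 2.\<close>

definition f :: "nat \<Rightarrow> 'a" where "f i = q^2 *s 1 - g i - (1 - inverse q^2) *s e i"

lemma fe: assumes "ok i" shows "f i * e i = 0"
proof -
  have "f i * e i = (q^2 - inverse q^4 - (1 - inverse q^2) * (q^2 + 1 + inverse q^2)) *s e i"
    by (simp add: f_def expand ge ee assms)
  also have "q^2 - inverse q^4 - (1 - inverse q^2) * (q^2 + 1 + inverse q^2) = 0"
    by (simp add: field_simps eval_nat_numeral)
  finally show ?thesis by simp
qed

lemma gf: assumes "ok i" shows "g i * f i = (- (inverse q^2)) *s f i"
proof -
  have "g i * f i = inverse q^2 *s g i - 1 *s 1 + (k * inverse q^4 - (1 - inverse q^2) * inverse q^4) *s e i"
    by (simp add: f_def expand ge gsq assms)
  also have "k * inverse q^4 - (1 - inverse q^2) * inverse q^4 = inverse q^2 * (1 - inverse q^2)"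
    by (simp add: field_simps eval_nat_numeral)
  also have "inverse q^2 *s g i - 1 *s 1 + (inverse q^2 * (1 - inverse q^2)) *s e i = (- (inverse q^2)) *s f i"
    by (simp add: f_def expand)
  finally show ?thesis .
qed

lemma ff: assumes "ok i" shows "f i * f i = c *s f i"
proof -
  have "f i * e i = e i * f i"
    by (simp add: f_def expand ge eg assms)
  then have "e i * f i = 0" by (simp add: fe assms)
  then show ?thesis
    by (subst f_def) (simp add: left_diff_distrib scale_simps gf assms scale_left_distrib)
qed

lemma g_eq: "g i = q^2 *s 1 - f i - (1 - inverse q^2) *s e i"
  by (simp add: f_def)

section \<open>The filtration by subalgebras and the full twist\<close>

text \<open>Generators are multiplied on the left only, which gives an induction one generator at a
  time; products are recovered in \<open>A_mult\<close>, and the inverses \<open>h i\<close> in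
  \<open>A_h\<close> from the skein relation. Both \<open>A 0\<close> and \<open>A 1\<close> consist
  of scalars.\<close>

inductive_set A :: "nat \<Rightarrow> 'a set" for n :: nat where
  A_one: "1 \<in> A n"
| A_add: "x \<in> A n \<Longrightarrow> y \<in> A n \<Longrightarrow> x + y \<in> A n"
| A_scale: "x \<in> A n \<Longrightarrow> a *s x \<in> A n"
| A_g_mult: "0 < i \<Longrightarrow> i < n \<Longrightarrow> x \<in> A n \<Longrightarrow> g i * x \<in> A n"
| A_e_mult: "0 < i \<Longrightarrow> i < n \<Longrightarrow> x \<in> A n \<Longrightarrow> e i * x \<in> A n"

lemma A_mult: "x \<in> A n \<Longrightarrow> y \<in> A n \<Longrightarrow> x * y \<in> A n"
  by (induction rule: A.induct) (auto simp: distrib_right scale_mult mult.assoc intro: A.intros)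

lemma A_g: "0 < i \<Longrightarrow> i < n \<Longrightarrow> g i \<in> A n"
  using A_g_mult[OF _ _ A_one] by simp

lemma A_e: "0 < i \<Longrightarrow> i < n \<Longrightarrow> e i \<in> A n"
  using A_e_mult[OF _ _ A_one] by simp

lemma subspace_A: "subspace (A n)"
  using A_scale[OF A_one, where a = 0 and n = n] by (intro subspaceI A_add A_scale) simp_all

lemma A_diff: "x \<in> A n \<Longrightarrow> y \<in> A n \<Longrightarrow> x - y \<in> A n"
  by (rule subspace_diff[OF subspace_A])

lemma A_zero: "0 \<in> A n"
  by (rule subspace_0[OF subspace_A])

lemma A_h: assumes "0 < i" "i < n" "n \<le> r" shows "h i \<in> A n"
proof -
  have "h i = g i - k *s 1 + k *s e i" using assms by (intro h_eq) simp
  then show ?thesis using assms by (simp only: A_add A_diff A_scale A_one A_g A_e)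
qed

lemma A_f: "0 < i \<Longrightarrow> i < n \<Longrightarrow> f i \<in> A n"
  unfolding f_def by (intro A_diff A_scale A_one A_g A_e)

lemmas A_closed = A_one A_add A_scale A_mult A_diff A_zero A_g A_e A_f A_h

lemma A_mono: "x \<in> A m \<Longrightarrow> m \<le> n \<Longrightarrow> x \<in> A n"
  by (induction rule: A.induct) (auto intro: A.intros)

lemma A_comm:
  assumes "x \<in> A n" "n \<le> r" "\<And>i. 0 < i \<Longrightarrow> i < n \<Longrightarrow> y * g i = g i * y"
  shows "y * x = x * y"
  using assms(1)
proof (induction rule: A.induct)
  case (A_g_mult i x)
  then show ?case using assms(3)[of i] by (metis mult.assoc)
next
  case (A_e_mult i x)
  then have "y * e i = e i * y" using assms by (intro comm_ge) auto
  then show ?case using A_e_mult by (metis mult.assoc)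
qed (simp_all add: distrib_left distrib_right scale_mult mult_scale)

lemma A_1: "x \<in> A 1 \<Longrightarrow> \<exists>a. x = a *s 1"
proof (induction rule: A.induct)
  case A_one
  show ?case by (rule exI[of _ 1]) simp
next
  case (A_add x y)
  then show ?case using scale_left_distrib by metis
next
  case (A_scale x a)
  then show ?case using scale_scale by metis
qed auto

lemma A_0: "x \<in> A 0 \<Longrightarrow> \<exists>a. x = a *s 1"
  using A_mono[of x 0 1] A_1 by simp

section \<open>Two-sided decomposition of \<open>A (n + 1)\<close> over \<open>A n\<close>\<close>

inductive_set S :: "nat \<Rightarrow> 'a set" for n :: nat where
  S_base: "a \<in> A n \<Longrightarrow> b \<in> A n \<Longrightarrow> y \<in> {1, g n, e n} \<Longrightarrow> a * y * b \<in> S n"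
| S_add: "x \<in> S n \<Longrightarrow> y \<in> S n \<Longrightarrow> x + y \<in> S n"
| S_scale: "x \<in> S n \<Longrightarrow> a *s x \<in> S n"

lemma S_A: "a \<in> A n \<Longrightarrow> a \<in> S n"
  using S_base[of a n 1 1] by (simp add: A_one)

lemma S_left: "y \<in> {1, g n, e n} \<Longrightarrow> a \<in> A n \<Longrightarrow> a * y \<in> S n"
  using S_base[of a n 1 y] by (simp add: A_one)

lemma S_right: "y \<in> {1, g n, e n} \<Longrightarrow> b \<in> A n \<Longrightarrow> y * b \<in> S n"
  using S_base[of 1 n b y] by (simp add: A_one)

lemma S_diff: "x \<in> S n \<Longrightarrow> y \<in> S n \<Longrightarrow> x - y \<in> S n"
  using S_add[OF _ S_scale, of x n y "-1"] by simp

lemma S_mult: "x \<in> S n \<Longrightarrow> a \<in> A n \<Longrightarrow> b \<in> A n \<Longrightarrow> a * x * b \<in> S n"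
proof (induction rule: S.induct)
  case (S_base u v y)
  then have "(a * u) * y * (v * b) \<in> S n"
    by (intro S.S_base A_mult)
  then show ?case by (simp only: mult.assoc)
qed (simp_all add: distrib_left distrib_right mult_scale scale_mult S_add S_scale)

lemma S_square: assumes "ok n" "z \<in> {g n, e n}" "x \<in> {1, g n, e n}" shows "z * x \<in> S n"
proof -
  have y: "1 \<in> S n" "g n \<in> S n" "e n \<in> S n"
    using S_left[of _ n 1] by (auto simp: A_one)
  have "g n * g n \<in> S n" "g n * e n \<in> S n" "e n * g n \<in> S n" "e n * e n \<in> S n"
    using y by (simp_all only: gsq ge eg ee assms(1) S_scale S_add S_diff)
  then show ?thesis using assms y by auto
qed

text \<open>Two top generators around a generator of index \<open>n - 1\<close> can be traded for at
  most one top generator with elements of \<open>A n\<close> outside; these are the three-strand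
  relations above.\<close>

lemma S_table:
  assumes ok: "ok n" "ok m" "n = Suc m" and z: "z \<in> {g n, e n}" "x \<in> {1, g n, e n}" "y \<in> {1, g m, e m}"
  shows "z * y * x \<in> S n"
proof -
  have adj: "adj n m" "adj m n" using ok by auto
  note A = A_g[of m n] A_e[of m n] A_h[of m n]
  have gm: "g m \<in> A n" "e m \<in> A n" "h m \<in> A n" using A ok by simp_all
  have "g n * g m * g n \<in> S n"
    using S_base[of "g m" n "g m" "g n"] gm braid'[OF ok(1,2) adj(1)] by simp
  moreover have "g n * g m * e n \<in> S n"
    using S_left[of "e n" n "e m"] gm gge[OF ok(1,2) adj(1)] by simp
  moreover have "e n * g m * g n \<in> S n"
    using S_right[of "e n" n "e m"] gm egg[OF ok(1,2) adj(1)] by simp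
  moreover have "e n * g m * e n \<in> S n"
    using S_scale[OF S_right[of "e n" n 1], of "q^4"] A_one ege[OF ok(1,2) adj(1)] by simp
  moreover have "e n * e m * e n \<in> S n"
    using S_right[of "e n" n 1] A_one eee[OF ok(1,2) adj(1)] by simp
  moreover have "g n * e m * e n \<in> S n"
    using S_left[of "e n" n "h m"] gm gee[OF ok(1,2) adj(1)] by simp
  moreover have "e n * e m * g n \<in> S n"
    using S_right[of "e n" n "h m"] gm eeg[OF ok(1,2) adj(1)] by simp
  moreover have "g n * e m * g n \<in> S n"
    using S_base[of "h m" n "h m" "e n"] gm geg[OF ok(1,2) adj(1)] by simp
  moreover have "z * b \<in> S n" if "b \<in> {1, g m, e m}" for b
    using z that gm A_one by (intro S_right) auto
  ultimately show ?thesis using z S_square[OF ok(1)] by fastforce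
qed

lemma A_far_comm:
  assumes "a \<in> A m" "y \<in> {1, g n, e n, h n}" "m < n" "n < r" shows "y * a = a * y"
proof -
  have g: "g n * a = a * g n" using assms
    by (intro A_comm[OF assms(1)] gg_comm) auto
  then show ?thesis using comm_ge[of n a] comm_h[of n a] assms by auto
qed

text \<open>Two top generators enclose an element of \<open>A n\<close>. By induction it is a sum of
  \<open>u * w * v\<close> with \<open>w\<close> of index \<open>n - 1\<close> and \<open>u\<close>,
  \<open>v\<close> commuting with the top generators, so these meet around \<open>w\<close> and
  \<open>S_table\<close> merges them.\<close>

lemma A_Suc: "Suc n \<le> r \<Longrightarrow> x \<in> A (Suc n) \<Longrightarrow> x \<in> S n"
proof (induction n arbitrary: x)
  case 0
  then obtain a where "x = a *s 1" using A_1[of x] by auto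
  then show ?case using S_scale[OF S_A[OF A_one]] by simp
next
  case (Suc m)
  let ?n = "Suc m"
  have core: "z * a * y \<in> S ?n" if z: "z \<in> {g ?n, e ?n}" and a: "a \<in> A ?n" and y: "y \<in> {1, g ?n, e ?n}" for z a y
  proof (cases "m = 0")
    case True
    then obtain t where "a = t *s 1" using a A_1 by auto
    then show ?thesis using S_square[of ?n z y] z y Suc.prems(1) by (simp add: scale_mult mult_scale S_scale)
  next
    case False
    have "a \<in> S m" using Suc a by simp
    then show ?thesis
    proof (induction rule: S.induct)
      case (S_base u v w)
      have "z * w * y \<in> S ?n" using S_table[of ?n m z y w] False Suc.prems(1) z y S_base(3) by simp
      moreover have "u \<in> A ?n" "v \<in> A ?n" using S_base(1,2) A_mono by auto
      ultimately have "u * (z * w * y) * v \<in> S ?n" using S_mult by blast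
      moreover have "z * u = u * z" "y * v = v * y"
        using A_far_comm[of u m z ?n] A_far_comm[of v m y ?n] S_base(1,2) z y Suc.prems(1)
        by (simp_all only: insert_iff empty_iff lessI Suc_le_eq simp_thms) blast+
      then have "u * (z * w * y) * v = z * (u * w * v) * y" by (metis mult.assoc)
      ultimately show ?case by simp
    qed (simp_all add: distrib_left distrib_right mult_scale scale_mult S_add S_scale)
  qed
  have top: "z * x \<in> S ?n" if z: "z \<in> {g ?n, e ?n}" and x: "x \<in> S ?n" for z x
    using x
  proof (induction rule: S.induct)
    case (S_base a b y)
    show ?case using S_mult[OF core[OF z S_base(1,3)] A_one S_base(2)] by (simp add: mult.assoc)
  qed (simp_all add: distrib_left mult_scale S_add S_scale)
  have low: "z * x \<in> S ?n" if "z \<in> A ?n" "x \<in> S ?n" for z x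
    using S_mult[OF that(2,1) A_one] by simp
  from Suc.prems(2) show ?case
  proof (induction rule: A.induct)
    case (A_g_mult i x)
    then show ?case using top[of "g ?n" x] low[of "g i" x] A_g[of i ?n] by (cases "i = ?n") simp_all
  next
    case (A_e_mult i x)
    then show ?case using top[of "e ?n" x] low[of "e i" x] A_e[of i ?n] by (cases "i = ?n") simp_all
  qed (simp_all add: S_A A_one S_scale S_add)
qed

lemma A_Suc_induct [consumes 2, case_names add scale base]:
  assumes "Suc n \<le> r" "x \<in> A (Suc n)" and "\<And>x y. P x \<Longrightarrow> P y \<Longrightarrow> P (x + y)" "\<And>x a. P x \<Longrightarrow> P (a *s x)"
    and "\<And>a y b. a \<in> A n \<Longrightarrow> b \<in> A n \<Longrightarrow> y \<in> {1, g n, e n} \<Longrightarrow> P (a * y * b)"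
  shows "P x"
proof -
  have "x \<in> S n" using A_Suc assms(1,2) by blast
  then show ?thesis by (induction rule: S.induct) (simp_all only: assms(3-5))
qed

text \<open>In the decomposition \<open>S n\<close> of \<open>a\<close> the outer factors commute
  with \<open>e (Suc n)\<close>, and the middle one, enclosed by two copies of
  \<open>e (Suc n)\<close>, becomes a scalar.\<close>

lemma eAe:
  assumes "Suc n < r" "a \<in> A (Suc n)" shows "\<exists>b\<in>A n. e (Suc n) * a * e (Suc n) = b * e (Suc n)"
proof (cases "n = 0")
  case True
  then obtain t where "a = t *s 1" using assms A_1 by auto
  then have "e (Suc n) * a * e (Suc n) = (t * (q^2 + 1 + inverse q^2)) *s 1 * e (Suc n)"
    using ee[of "Suc n"] assms by (simp add: scale_mult mult_scale)
  then show ?thesis using A_scale[OF A_one] by blast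
next
  case False
  have "Suc n \<le> r" using assms by simp
  then show ?thesis using assms(2)
  proof (induction rule: A_Suc_induct)
    case (add x y)
    then obtain b d where "b \<in> A n" "d \<in> A n" "e (Suc n) * x * e (Suc n) = b * e (Suc n)"
      "e (Suc n) * y * e (Suc n) = d * e (Suc n)" by blast
    then show ?case by (intro bexI[of _ "b + d"] A_add) (simp_all add: distrib_left distrib_right)
  next
    case (scale x t)
    then obtain b where "b \<in> A n" "e (Suc n) * x * e (Suc n) = b * e (Suc n)" by blast
    then show ?case by (intro bexI[of _ "t *s b"] A_scale) (simp_all add: mult_scale scale_mult)
  next
    case (base a y b)
    have comm: "e (Suc n) * a = a * e (Suc n)" "e (Suc n) * b = b * e (Suc n)"
      using A_far_comm[of _ n "e (Suc n)" "Suc n"] base assms by auto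
    have "e (Suc n) * (a * y * b) * e (Suc n) = a * (e (Suc n) * y * e (Suc n)) * b"
      using comm by (metis mult.assoc)
    moreover obtain t where "e (Suc n) * y * e (Suc n) = t *s e (Suc n)"
    proof -
      have "ok n" "ok (Suc n)" using assms False by auto
      then have "e (Suc n) * 1 * e (Suc n) = (q^2 + 1 + inverse q^2) *s e (Suc n)"
        "e (Suc n) * g n * e (Suc n) = q^4 *s e (Suc n)" "e (Suc n) * e n * e (Suc n) = 1 *s e (Suc n)"
        using ee[of "Suc n"] ege[of "Suc n" n] eee[of "Suc n" n] by simp_all
      then show ?thesis using that base(3) by blast
    qed
    ultimately have "e (Suc n) * (a * y * b) * e (Suc n) = a * (t *s e (Suc n)) * b" by simp
    also have "\<dots> = (t *s (a * b)) * e (Suc n)"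
      by (simp only: mult_scale scale_mult mult.assoc comm(2))
    finally have "e (Suc n) * (a * y * b) * e (Suc n) = (t *s (a * b)) * e (Suc n)" .
    then show ?case using A_scale[OF A_mult[OF base(1,2)]] by blast
  qed
qed

text \<open>The left factor \<open>e (Suc n)\<close> absorbs every further top generator: at once
  where they meet, and by \<open>egg\<close>, \<open>eeg\<close>, \<open>ege\<close> or
  \<open>eee\<close> when a generator of index \<open>n\<close> stands between them.\<close>

lemma eA:
  assumes "Suc n < r" "x \<in> A (Suc (Suc n))" shows "\<exists>b\<in>A (Suc n). e (Suc n) * x = e (Suc n) * b"
proof -
  let ?n = "Suc n" and ?P = "\<lambda>x. \<exists>b\<in>A (Suc n). e (Suc n) * x = e (Suc n) * b"
  have add: "?P (x + y)" if "?P x" "?P y" for x y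
    using that by (metis A_add distrib_left)
  have scale: "?P (t *s x)" if "?P x" for t x
    using that by (metis A_scale mult_scale)
  have right: "?P (x * b)" if "?P x" "b \<in> A ?n" for x b
    using that by (metis A_mult mult.assoc)
  have y: "?P y" if "y \<in> {1, g ?n, e ?n}" for y
  proof -
    have "e ?n * g ?n = e ?n * inverse q^4 *s 1" "e ?n * e ?n = e ?n * (q^2 + 1 + inverse q^2) *s 1"
      using eg[of ?n] ee[of ?n] assms(1) by (simp_all add: mult_scale)
    then show ?thesis using that A_scale[OF A_one] A_one by auto
  qed
  have core: "?P (a * y)" if a: "a \<in> A ?n" and y': "y \<in> {1, g ?n, e ?n}" for a y
  proof (cases "n = 0")
    case True
    then obtain t where "a = t *s 1" using a A_1 by auto
    then show ?thesis using scale[OF y[OF y']] by (simp add: scale_mult)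
  next
    case False
    have ok: "ok n" "ok ?n" using False assms by auto
    have wy: "?P (w * y)" if "w \<in> {1, g n, e n}" for w
    proof -
      have 1: "e ?n * (g n * g ?n) = e ?n * e n" "e ?n * (e n * g ?n) = e ?n * h n"
        "e ?n * (g n * e ?n) = e ?n * q^4 *s 1" "e ?n * (e n * e ?n) = e ?n * 1"
        using egg[of ?n n] eeg[of ?n n] ege[of ?n n] eee[of ?n n] ok by (simp_all add: mult.assoc mult_scale)
      have 2: "e n \<in> A ?n" "h n \<in> A ?n" "g n \<in> A ?n" "q^4 *s 1 \<in> A ?n" "1 \<in> A ?n"
        using False assms(1) by (simp_all add: A_closed)
      have "?P (g n * g ?n)" "?P (e n * g ?n)" "?P (g n * e ?n)" "?P (e n * e ?n)" "?P (g n * 1)" "?P (e n * 1)"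
        using 1 2 by (metis mult_1_right)+
      moreover have "?P (1 * y)" using y[OF y'] by (simp only: mult_1_left)
      ultimately show ?thesis using that y' by (elim insertE emptyE; simp only:)
    qed
    have "a \<in> S n" using a assms by (intro A_Suc) auto
    then show ?thesis
    proof (induction rule: S.induct)
      case (S_base u v w)
      obtain b where b: "b \<in> A ?n" "e ?n * (w * y) = e ?n * b" using wy S_base(3) by blast
      have uv: "u \<in> A ?n" "v \<in> A ?n" using S_base A_mono by auto
      have "e ?n * u = u * e ?n" "y * v = v * y"
        using A_far_comm[of u n "e ?n" ?n] A_far_comm[of v n y ?n] S_base(1,2) y' assms(1) by auto
      then have "e ?n * (u * w * v * y) = u * (e ?n * (w * y)) * v" by (metis mult.assoc)
      also have "\<dots> = u * (e ?n * b) * v" by (simp only: b(2))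
      also have "\<dots> = e ?n * (u * b * v)" using \<open>e ?n * u = u * e ?n\<close> by (metis mult.assoc)
      finally show ?case using b(1) uv A_mult by blast
    next
      case (S_add x z)
      then show ?case using add by (simp add: distrib_right)
    next
      case (S_scale x t)
      then show ?case using scale by (simp add: scale_mult)
    qed
  qed
  have "Suc ?n \<le> r" using assms(1) by simp
  then show ?thesis using assms(2)
  proof (induction rule: A_Suc_induct)
    case (base a y b)
    then show ?case using right core by blast
  qed (use add scale in blast)+
qed

section \<open>Jucys-Murphy elements and the full twist\<close>

text \<open>Strand \<open>j\<close> wound once around all earlier ones:
  \<open>g (j - 1) ... g 1 * g 1 ... g (j - 1)\<close>. The first genuine value is
  \<open>L 1 = 1\<close>; the one at \<open>0\<close> is a default.\<close>

primrec L :: "nat \<Rightarrow> 'a" where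
  "L 0 = 1"
| "L (Suc j) = (if j = 0 then 1 else g j * L j * g j)"

text \<open>The full twist, as a product of Jucys-Murphy elements.\<close>

primrec T :: "nat \<Rightarrow> 'a" where
  "T 0 = 1"
| "T (Suc n) = T n * L (Suc n)"

lemma L_A: "j \<le> n \<Longrightarrow> L j \<in> A n"
  by (induction j) (auto intro!: A_mult A_g A_one)

lemma T_A: "m \<le> n \<Longrightarrow> T m \<in> A n"
  by (induction m) (auto intro!: A_mult L_A A_one simp del: L.simps)

lemma L_comm_far:
  assumes "ok i" "j < i" shows "L j * g i = g i * L j"
  using A_far_comm[OF L_A[OF order_refl], of "g i" i] assms by auto

text \<open>Outer factors commuting with \<open>g i\<close> are peeled off down to
  \<open>L (i + 2)\<close>; there \<open>g i\<close> passes by two braid moves, one on either side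
  of \<open>L i\<close>, which commutes with \<open>g (i + 1)\<close>.\<close>

lemma L_comm_low:
  "ok i \<Longrightarrow> Suc i < j \<Longrightarrow> j \<le> r \<Longrightarrow> L j * g i = g i * L j"
proof (induction j)
  case (Suc j)
  have j: "L (Suc j) = g j * L j * g j" using Suc.prems by simp
  show ?case
  proof (cases "Suc i < j")
    case True
    then have "L j * g i = g i * L j" "g j * g i = g i * g j"
      using Suc gg_comm[of i j] by auto
    then show ?thesis unfolding j by (metis mult.assoc)
  next
    case False
    then have ij: "j = Suc i" using Suc.prems by simp
    have ok: "ok i" "ok j" using Suc.prems ij by auto
    have Lj: "L j = g i * L i * g i" using ij ok by simp
    have b: "g j * g i * g j = g i * g j * g i" using braid'[of i j] ij ok by auto
    have c: "L i * g j = g j * L i" using L_comm_far[of j i] ij ok by auto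
    have "L (Suc j) * g i = g j * g i * L i * (g i * g j * g i)" unfolding j Lj by (simp only: mult.assoc)
    also have "\<dots> = g j * g i * L i * (g j * g i * g j)" by (simp only: b)
    also have "\<dots> = g j * g i * (L i * g j) * g i * g j" by (simp only: mult.assoc)
    also have "\<dots> = (g j * g i * g j) * L i * g i * g j" by (simp only: c mult.assoc)
    also have "\<dots> = g i * L (Suc j)" unfolding j Lj b by (simp only: mult.assoc)
    finally show ?thesis .
  qed
qed simp

lemma L_comm_A: assumes "x \<in> A j" "Suc j \<le> r" shows "L (Suc j) * x = x * L (Suc j)"
  using assms by (intro A_comm[OF assms(1)] L_comm_low) auto

lemma LL_comm_g: assumes "ok i" shows "L i * L (Suc i) * g i = g i * (L i * L (Suc i))"
proof -
  have "L (Suc i) * L i = L i * L (Suc i)" using assms by (intro L_comm_A L_A) auto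
  moreover have "L (Suc i) = g i * L i * g i" using assms by simp
  ultimately show ?thesis by (metis mult.assoc)
qed

text \<open>Neither \<open>L i\<close> nor \<open>L (i + 1)\<close> commutes with
  \<open>g i\<close>, but their product does, and all other factors are far from
  \<open>i\<close>.\<close>

lemma T_comm_g: "0 < i \<Longrightarrow> i < n \<Longrightarrow> n \<le> r \<Longrightarrow> T n * g i = g i * T n"
proof (induction n)
  case (Suc n)
  show ?case
  proof (cases "i < n")
    case True
    then have "T n * g i = g i * T n" "L (Suc n) * g i = g i * L (Suc n)"
      using Suc L_comm_low[of i "Suc n"] by auto
    then show ?thesis unfolding T.simps by (metis mult.assoc)
  next
    case False
    then have i: "i = n" using Suc.prems by simp
    then obtain m where m: "n = Suc m" using Suc.prems by (cases n) auto
    have "T m * g n = g n * T m"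
      using A_far_comm[OF T_A[OF order_refl], of "g n" n m] m Suc.prems by auto
    moreover have "L n * L (Suc n) * g n = g n * (L n * L (Suc n))" using LL_comm_g[of n] Suc.prems i by simp
    moreover have "T (Suc n) = T m * (L n * L (Suc n))" by (simp only: m T.simps mult.assoc)
    ultimately show ?thesis unfolding i by (metis mult.assoc)
  qed
qed simp

lemma T_central: assumes "x \<in> A n" "n \<le> r" shows "T n * x = x * T n"
  using assms by (intro A_comm[OF assms(1)] T_comm_g) auto

text \<open>The cap pulls its two strands off the earlier ones: \<open>egg\<close> turns
  \<open>e (i + 1)\<close> into \<open>e (i + 1) * e i\<close>, the induction hypothesis applies,
  and a second \<open>egg\<close> returns. The scalar is that of
  \<open>e 1 * g 1 * g 1\<close>.\<close>

lemma eLL: "ok i \<Longrightarrow> e i * L i * L (Suc i) = inverse q^8 *s e i"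
proof (induction i)
  case (Suc i)
  show ?case
  proof (cases "i = 0")
    case True
    then have "e (Suc i) * L (Suc i) * L (Suc (Suc i)) = e (Suc i) * g (Suc i) * g (Suc i)" by (simp add: mult.assoc)
    also have "\<dots> = (inverse q^4 * inverse q^4) *s e (Suc i)" using Suc.prems by (simp add: eg scale_mult)
    finally show ?thesis by (simp flip: power_add)
  next
    case False
    define a b M where "a = g i" "b = g (Suc i)" "M = L i"
    have ok: "ok i" "ok (Suc i)" "adj (Suc i) i" "adj i (Suc i)" using Suc.prems False by auto
    have L1: "L (Suc i) = a * M * a" and L2: "L (Suc (Suc i)) = b * (a * M * a) * b"
      using ok a_b_M_def by simp_all
    have Mb: "M * b = b * M" using L_comm_far[of "Suc i" i] ok a_b_M_def by auto
    have ab: "a * b * a = b * a * b" using braid'[OF ok(1,2,4)] a_b_M_def by simp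
    have IH: "e i * (M * a * M * a) = inverse q^8 *s e i"
      using Suc.IH ok a_b_M_def by (simp add: mult.assoc)
    have "e (Suc i) * L (Suc i) * L (Suc (Suc i)) = e (Suc i) * a * M * (a * b * a) * M * a * b"
      unfolding L1 L2 by (simp only: mult.assoc)
    also have "\<dots> = e (Suc i) * a * (M * b) * a * (b * M) * a * b" unfolding ab by (simp only: mult.assoc)
    also have "\<dots> = e (Suc i) * a * (b * M) * a * (M * b) * a * b" by (simp only: Mb)
    also have "\<dots> = e (Suc i) * a * b * M * a * M * (b * a * b)" by (simp only: mult.assoc)
    also have "\<dots> = (e (Suc i) * a * b) * (M * a * M * a) * b * a" unfolding ab[symmetric] by (simp only: mult.assoc)
    also have "e (Suc i) * a * b = e (Suc i) * e i" using egg[OF ok(2,1,3)] a_b_M_def by simp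
    also have "e (Suc i) * e i * (M * a * M * a) * b * a = e (Suc i) * (e i * (M * a * M * a)) * b * a"
      by (simp only: mult.assoc)
    also have "\<dots> = inverse q^8 *s (e (Suc i) * (e i * b * a))" unfolding IH
      by (simp only: mult_scale scale_mult mult.assoc)
    also have "e i * b * a = e i * e (Suc i)" using egg[OF ok(1,2,4)] a_b_M_def by simp
    also have "e (Suc i) * (e i * e (Suc i)) = e (Suc i)" using eee[OF ok(2,1,3)] by (simp add: mult.assoc)
    finally show ?thesis .
  qed
qed simp

text \<open>This is what relates the eigenvalues of the full twist two strands apart.\<close>

lemma eT: assumes "Suc n < r" shows "e (Suc n) * T (Suc (Suc n)) = inverse q^8 *s (T n * e (Suc n))"
proof -
  have "e (Suc n) * T n = T n * e (Suc n)"
    using A_far_comm[OF T_A[OF order_refl], of "e (Suc n)" "Suc n" n] assms by auto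
  then have "e (Suc n) * T (Suc (Suc n)) = T n * (e (Suc n) * L (Suc n) * L (Suc (Suc n)))"
    unfolding T.simps by (metis mult.assoc)
  also have "\<dots> = inverse q^8 *s (T n * e (Suc n))" using assms by (subst eLL) (simp_all add: mult_scale)
  finally show ?thesis .
qed

section \<open>The quotient by the cup-cap ideal\<close>

text \<open>Ideals of the subalgebra \<open>A n\<close>, not of the ambient algebra.\<close>

definition ideal_in :: "nat \<Rightarrow> 'a set \<Rightarrow> bool"
  where "ideal_in n I \<longleftrightarrow> subspace I \<and> I \<subseteq> A n \<and> (\<forall>x\<in>I. \<forall>a\<in>A n. a * x \<in> I \<and> x * a \<in> I)"

lemma
  assumes "ideal_in n I"
  shows ideal_zero: "0 \<in> I"
    and ideal_add: "x \<in> I \<Longrightarrow> y \<in> I \<Longrightarrow> x + y \<in> I"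
    and ideal_diff: "x \<in> I \<Longrightarrow> y \<in> I \<Longrightarrow> x - y \<in> I"
    and ideal_scale: "x \<in> I \<Longrightarrow> t *s x \<in> I"
    and ideal_left: "x \<in> I \<Longrightarrow> a \<in> A n \<Longrightarrow> a * x \<in> I"
    and ideal_right: "x \<in> I \<Longrightarrow> a \<in> A n \<Longrightarrow> x * a \<in> I"
    and ideal_A: "x \<in> I \<Longrightarrow> x \<in> A n"
  using assms by (auto simp: ideal_in_def subspace_0 subspace_add subspace_diff subspace_scale)

lemma ideal_unscale: "ideal_in n I \<Longrightarrow> t \<noteq> 0 \<Longrightarrow> t *s x \<in> I \<Longrightarrow> x \<in> I"
  using ideal_scale[of n I "t *s x" "inverse t"] by simp

lemma ideal_cong_trans: "ideal_in n I \<Longrightarrow> x - y \<in> I \<Longrightarrow> y - z \<in> I \<Longrightarrow> x - z \<in> I"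
  using ideal_add[of n I "x - y" "y - z"] by simp

lemma ideal_cong_mult:
  assumes "ideal_in n I" "x - x' \<in> I" "y - y' \<in> I" "x' \<in> A n" "y \<in> A n"
  shows "x * y - x' * y' \<in> I"
proof -
  have "x * y - x' * y' = (x - x') * y + x' * (y - y')" by (simp add: algebra_simps)
  then show ?thesis using assms by (simp add: ideal_add ideal_left ideal_right)
qed

inductive_set J :: "nat \<Rightarrow> 'a set" for n :: nat where
  J_base: "0 < i \<Longrightarrow> i < n \<Longrightarrow> a \<in> A n \<Longrightarrow> b \<in> A n \<Longrightarrow> a * e i * b \<in> J n"
| J_zero: "0 \<in> J n"
| J_add: "x \<in> J n \<Longrightarrow> y \<in> J n \<Longrightarrow> x + y \<in> J n"
| J_scale: "x \<in> J n \<Longrightarrow> t *s x \<in> J n"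

lemma ideal_J: "ideal_in n (J n)"
proof -
  have "a * x \<in> J n \<and> x * a \<in> J n" if "x \<in> J n" "a \<in> A n" for x a
    using that
  proof (induction rule: J.induct)
    case (J_base i u v)
    then show ?case using J.J_base[of i n "a * u" v] J.J_base[of i n u "v * a"] A_mult
      by (simp add: mult.assoc)
  qed (simp_all add: distrib_left distrib_right mult_scale scale_mult J_add J_scale J_zero)
  moreover have "x \<in> A n" if "x \<in> J n" for x
    using that by (induction rule: J.induct) (simp_all add: A_mult A_e A_add A_scale A_zero)
  ultimately show ?thesis by (auto simp: ideal_in_def intro!: subspaceI J_add J_zero J_scale)
qed

lemma e_J: "0 < i \<Longrightarrow> i < n \<Longrightarrow> e i \<in> J n"
  using J_base[of i n 1 1] A_one by simp

text \<open>\<open>J n\<close> is generated by its last generator, as \<open>e i = e i * e (i + 1) * e i\<close>.\<close>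

lemma e_top:
  assumes "0 < i" "i \<le> n" "Suc n \<le> r"
  shows "\<exists>u\<in>A (Suc n). \<exists>v\<in>A (Suc n). e i = u * e n * v"
  using assms(2,1)
proof (induction rule: inc_induct)
  case base
  show ?case by (intro bexI[of _ 1]) (simp_all add: A_one)
next
  case (step i)
  then obtain u v where uv: "u \<in> A (Suc n)" "v \<in> A (Suc n)" "e (Suc i) = u * e n * v" by auto
  have "e i = e i * e (Suc i) * e i" using eee[of i "Suc i"] step assms by auto
  then have "e i = (e i * u) * e n * (v * e i)" unfolding uv(3) by (simp add: mult.assoc)
  moreover have "e i \<in> A (Suc n)" using step by (intro A_e) auto
  ultimately show ?case using uv A_mult by blast
qed

lemma J_top_induct [consumes 2, case_names base zero add scale]:
  assumes "Suc n \<le> r" "x \<in> J (Suc n)"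
    and base: "\<And>a b. a \<in> A (Suc n) \<Longrightarrow> b \<in> A (Suc n) \<Longrightarrow> P (a * e n * b)"
    and "P 0" "\<And>x y. P x \<Longrightarrow> P y \<Longrightarrow> P (x + y)" "\<And>x t. P x \<Longrightarrow> P (t *s x)"
  shows "P x"
  using assms(2)
proof (induction rule: J.induct)
  case (J_base i a b)
  then obtain u v where uv: "u \<in> A (Suc n)" "v \<in> A (Suc n)" "e i = u * e n * v"
    using e_top[of i n] assms(1) by auto
  have "a * e i * b = (a * u) * e n * (v * b)" unfolding uv(3) by (simp only: mult.assoc)
  then show ?case using base uv A_mult J_base by metis
qed (simp_all only: assms(4-6))

lemma ggf: assumes "ok i" "ok j" "adj i j" shows "g i * g j * f i = f j * (g i * g j)"
  using gge_conj[OF assms] braid'[OF assms] unfolding f_def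
  by (simp only: right_diff_distrib left_diff_distrib mult_scale scale_mult mult_1_left mult_1_right mult.assoc)

text \<open>Conjugation by braids links all \<open>f i\<close>, so a congruence known at one index
  spreads to the others.\<close>

lemma f_conj: assumes "ok i" "ok j" "adj i j" shows "f j = g i * g j * f i * (h j * h i)"
proof -
  have "f j * (g i * g j) * (h j * h i) = f j * g i * (g j * h j) * h i" by (simp only: mult.assoc)
  also have "\<dots> = f j" using gh assms by (simp add: mult.assoc)
  finally show ?thesis using ggf[OF assms] by simp
qed

lemma gf_comm: assumes "ok i" "ok j" "far i j" shows "g i * f j = f j * g i"
  using gg_comm[OF assms] ge_comm[OF assms] unfolding f_def
  by (simp only: right_diff_distrib left_diff_distrib mult_scale scale_mult mult_1_left mult_1_right)

lemma ff_comm: assumes "ok i" "ok j" "far i j" shows "f i * f j = f j * f i"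
proof -
  have "f j * g i = g i * f j" using gf_comm[OF assms] by simp
  moreover from this have "f j * e i = e i * f j" using comm_ge assms(1) by blast
  ultimately show ?thesis unfolding f_def[of i]
    by (simp only: right_diff_distrib left_diff_distrib mult_scale scale_mult mult_1_left mult_1_right)
qed

lemma g_cong:
  assumes "ideal_in n I" "e i \<in> I" shows "g i - (q^2 *s 1 - f i) \<in> I"
proof -
  have "g i - (q^2 *s 1 - f i) = (inverse q^2 - 1) *s e i"
    by (simp add: f_def scale_left_diff_distrib)
  then show ?thesis using ideal_scale[OF assms] by simp
qed

text \<open>The braid relation modulo the ideal generated by the \<open>e i\<close>, where \<open>g i\<close> becomes \<open>q\<^sup>2 - f i\<close>.\<close>

lemma f_braid:
  assumes I: "ideal_in n I" and e: "e i \<in> I" "e j \<in> I" and ij: "0 < i" "i < n" "0 < j" "j < n" "n \<le> r" "adj i j"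
  shows "f i * f j * f i - f i - (f j * f i * f j - f j) \<in> I"
proof -
  define x y where "x = f i" "y = f j"
  let ?G = "\<lambda>x. q^2 *s 1 - x"
  have A: "x \<in> A n" "y \<in> A n" "g i \<in> A n" "g j \<in> A n" "?G x \<in> A n" "?G y \<in> A n"
    using ij unfolding x_y_def by (simp_all add: A_closed)
  have xx: "x * x = c *s x" "y * y = c *s y" using ff ij unfolding x_y_def by auto
  have gx: "g i - ?G x \<in> I" "g j - ?G y \<in> I" using g_cong I e unfolding x_y_def by auto
  have "g i * g j * g i - ?G x * ?G y * ?G x \<in> I" "g j * g i * g j - ?G y * ?G x * ?G y \<in> I"
    using gx A by (simp_all add: ideal_cong_mult[OF I] A_mult)
  moreover have "g i * g j * g i = g j * g i * g j" using braid' ij by auto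
  ultimately have "(g j * g i * g j - ?G y * ?G x * ?G y) - (g j * g i * g j - ?G x * ?G y * ?G x) \<in> I"
    using ideal_diff[OF I] by metis
  moreover have "(g j * g i * g j - ?G y * ?G x * ?G y) - (g j * g i * g j - ?G x * ?G y * ?G x) =
     (q^2 * c - q^2 * q^2) *s (x - y) - (x * y * x - y * x * y)"
    using xx by (simp add: algebra_simps scale_simps scale_left_distrib scale_left_diff_distrib)
  moreover have "q^2 * c - q^2 * q^2 = 1" by (simp add: field_simps)
  ultimately have "- ((x - y) - (x * y * x - y * x * y)) \<in> I"
    using ideal_scale[OF I, of _ "-1"] by fastforce
  then show ?thesis unfolding x_y_def by (simp add: algebra_simps)
qed

text \<open>Meant for \<open>x\<close>, \<open>y\<close>, \<open>z\<close> at three consecutive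
  indices: once \<open>x * z\<close> vanishes, so does the antisymmetriser
  \<open>y * x * y - y\<close>. The two braid relations, multiplied by \<open>z\<close> and by
  \<open>x\<close>, give \<open>m1\<close> and \<open>m2\<close>; their difference \<open>m3\<close>
  identifies \<open>y * z * y\<close> with \<open>y * x * y\<close>, and sandwiching the first braid
  relation by \<open>y\<close> then produces the factor \<open>c * c\<close>.\<close>

lemma near_of_far:
  assumes I: "ideal_in n I" and A: "x \<in> A n" "y \<in> A n" "z \<in> A n" and yy: "y * y = c *s y"
    and xz: "x * z \<in> I" "z * x \<in> I"
    and b1: "x * y * x - x - (y * x * y - y) \<in> I" and b2: "z * y * z - z - (y * z * y - y) \<in> I"
  shows "y * x * y - y \<in> I"
proof -
  define u v where "u = x * y * x - x - (y * x * y - y)" "v = z * y * z - z - (y * z * y - y)"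
  define m1 where "m1 = (z * x) * (y * x) - z * x - z * u"
  define m2 where "m2 = z * y * (z * x) - z * x - v * x"
  define m3 where "m3 = m2 * y - y * m1"
  have uv: "u \<in> I" "v \<in> I" using b1 b2 unfolding u_v_def by auto
  note cl = ideal_diff[OF I] ideal_left[OF I] ideal_right[OF I] A_mult A
  have m: "m1 \<in> I" "m2 \<in> I" unfolding m1_def m2_def using uv xz by (simp_all add: cl)
  then have m3: "m3 \<in> I" unfolding m3_def by (simp add: cl)
  have "m2 * y - m3 * (x * y) - y * u * y \<in> I" using uv m m3 by (simp add: cl)
  moreover have m2': "m2 = y * z * y * x - y * x" unfolding m2_def u_v_def by (simp add: algebra_simps)
  moreover have m1': "m1 = z * y * x * y - z * y" unfolding m1_def u_v_def by (simp add: algebra_simps)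
  moreover have "m3 = y * z * y - y * x * y" unfolding m3_def m1' m2' by (simp add: algebra_simps)
  moreover have "(y * z * y * x - y * x) * y - (y * z * y - y * x * y) * (x * y) - y * u * y = (t * t) *s (y * x * y - y)"
    if "y * y = t *s y" for t
  proof -
    have "y * (y * w) = t *s (y * w)" for w using that by (simp add: scale_mult flip: mult.assoc)
    then show ?thesis unfolding u_v_def using that by (simp add: algebra_simps scale_simps)
  qed
  note this[OF yy]
  ultimately have "(c * c) *s (y * x * y - y) \<in> I" by metis
  then show ?thesis using ideal_unscale[OF I] q_scalars_nonzero(2) by simp
qed

text \<open>Monotone products in both directions. Once \<open>f i * f j * f i\<close> reduces to
  \<open>f i\<close> for neighbours and far products vanish, they behave like rank one matrices with
  row \<open>i\<close> and column \<open>j\<close>.\<close>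

definition F :: "nat \<Rightarrow> nat \<Rightarrow> 'a"
  where "F i j = prod_list (map f (if i \<le> j then [i..<Suc j] else rev [j..<Suc i]))"

lemma F_same: "F i i = f i" by (simp add: F_def)

lemma F_up: "i < j \<Longrightarrow> F i j = f i * F (Suc i) j"
  by (simp add: F_def upt_conv_Cons)

lemma F_down: "j < i \<Longrightarrow> F i j = f i * F (i - 1) j"
  by (cases i) (auto simp: F_def less_Suc_eq)

lemma F_A: "0 < i \<Longrightarrow> i < n \<Longrightarrow> 0 < j \<Longrightarrow> j < n \<Longrightarrow> F i j \<in> A n"
proof -
  have "prod_list (map f xs) \<in> A n" if "\<forall>i\<in>set xs. 0 < i \<and> i < n" for xs
    using that by (induction xs) (auto intro!: A_one A_mult A_f)
  then show "0 < i \<Longrightarrow> i < n \<Longrightarrow> 0 < j \<Longrightarrow> j < n \<Longrightarrow> F i j \<in> A n"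
    unfolding F_def by auto
qed

lemma F_head: assumes "0 < i" "i < n" "0 < j" "j < n" shows "\<exists>w\<in>A n. F i j = f i * w"
proof -
  consider "i = j" | "i < j" | "j < i" by linarith
  then show ?thesis
  proof cases
    case 1
    then show ?thesis using F_same A_one by (intro bexI[of _ 1]) auto
  next
    case 2
    then show ?thesis using F_up[of i j] F_A[of "Suc i" n j] assms by auto
  next
    case 3
    then show ?thesis using F_down[of j i] F_A[of "i - 1" n j] assms by auto
  qed
qed

text \<open>The full twist acts on the summands of highest weight \<open>2 m\<close> of the \<open>n\<close>-th tensor power by \<open>q\<close> to the
  Casimir eigenvalue \<open>2 m (m + 1)\<close>, corrected by that of the \<open>n\<close> factors.\<close>

definition lam :: "nat \<Rightarrow> nat \<Rightarrow> qfield"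
  where "lam m n = q powi (2 * int m * (int m + 1) - 4 * int n)"

text \<open>The exponents differ by \<open>2 * (l - m) * (l + m + 1)\<close>, whose last factor is
  positive.\<close>

lemma lam_inj: "lam l n = lam m n \<longleftrightarrow> l = m"
proof -
  have "int l * (int l + 1) = int m * (int m + 1) \<longleftrightarrow> l = m"
  proof
    assume "int l * (int l + 1) = int m * (int m + 1)"
    then have "(int l - int m) * (int l + int m + 1) = 0" by (simp add: algebra_simps)
    then show "l = m" by auto
  qed simp
  then show ?thesis unfolding lam_def q_powi_inj by (auto simp: mult.assoc)
qed

text \<open>Being central, \<open>T n\<close> passes through the conjugation of
  \<open>f_conj\<close>.\<close>

lemma T_cong_conj:
  assumes "ideal_in n I" "ok i" "ok (Suc i)" "Suc i < n" "n \<le> r" "T n * f i - t *s f i \<in> I"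
  shows "T n * f (Suc i) - t *s f (Suc i) \<in> I"
proof -
  let ?w = "g i * g (Suc i)" and ?v = "h (Suc i) * h i"
  have A: "?w \<in> A n" "?v \<in> A n" using assms by (auto intro!: A_mult A_g A_h)
  have "f (Suc i) = ?w * f i * ?v" using f_conj[of i "Suc i"] assms by auto
  moreover have "T n * ?w = ?w * T n" using T_central[OF A(1)] assms by simp
  then have "T n * (?w * f i * ?v) = ?w * (T n * f i) * ?v" by (metis mult.assoc)
  ultimately have "T n * f (Suc i) - t *s f (Suc i) = ?w * (T n * f i - t *s f i) * ?v"
    by (simp only: right_diff_distrib left_diff_distrib mult_scale scale_mult)
  then show ?thesis using ideal_right[OF assms(1) ideal_left[OF assms(1,6) A(1)] A(2)] by simp
qed

end

text \<open>Applied with \<open>I = J n\<close>, and for \<open>n = 3\<close> with the span of \<open>J 3\<close> and the antisymmetriser.\<close>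

locale bmw_hook = bmw_algebra scale g h e r
  for scale :: "qfield \<Rightarrow> 'a::{ring,monoid_mult} \<Rightarrow> 'a" (infixr "*s" 75) and g h e r +
  fixes n :: nat and I :: "'a set"
  assumes n: "2 \<le> n" "n \<le> r" and I: "ideal_in n I"
    and eI: "0 < i \<Longrightarrow> i < n \<Longrightarrow> e i \<in> I"
    and far: "0 < i \<Longrightarrow> i < n \<Longrightarrow> 0 < j \<Longrightarrow> j < n \<Longrightarrow> far i j \<Longrightarrow> f i * f j \<in> I"
    and near: "0 < i \<Longrightarrow> i < n \<Longrightarrow> 0 < j \<Longrightarrow> j < n \<Longrightarrow> adj i j \<Longrightarrow> f i * f j * f i - f i \<in> I"
begin

lemmas cl = ideal_zero[OF I] ideal_add[OF I] ideal_diff[OF I] ideal_scale[OF I] ideal_left[OF I] ideal_right[OF I]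
lemmas cm = ideal_cong_mult[OF I]
lemmas ct = ideal_cong_trans[OF I]

text \<open>If \<open>k'\<close> is farther from \<open>j\<close> than \<open>i\<close> is, the
  product is \<open>F k' j\<close> itself. Otherwise \<open>F i j\<close> begins with
  \<open>f i * f k'\<close>, and the factor \<open>f k'\<close> in front contracts by
  \<open>near\<close>.\<close>

lemma f_F_near:
  assumes k: "0 < k'" "k' < n" and i: "0 < i" "i < n" and j: "0 < j" "j < n" and adj: "adj k' i"
  shows "f k' * F i j - F k' j \<in> I"
proof (cases "F k' j = f k' * F i j")
  case True
  then show ?thesis by (simp add: cl)
next
  case False
  then have "F i j = f i * F k' j"
    using adj F_up[of k' j] F_down[of j k'] F_up[of i j] F_down[of j i] F_same
    by (metis Suc_diff_1 diff_Suc_1 i(1) k(1) linorder_neqE_nat not_less_eq)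
  moreover obtain w where w: "w \<in> A n" "F k' j = f k' * w" using F_head k j by blast
  ultimately have "f k' * F i j - F k' j = (f k' * f i * f k' - f k') * w"
    by (simp add: algebra_simps)
  then show ?thesis using near[OF k i adj] w(1) by (simp add: cl)
qed

text \<open>The elements with a normal form modulo \<open>I\<close>. The coefficients are exposed
  because for kernel elements they are later shown to vanish.\<close>

definition N :: "'a set"
  where "N = {x. \<exists>a b. x - (a *s 1 + (\<Sum>i\<in>{1..<n}. \<Sum>j\<in>{1..<n}. b i j *s F i j)) \<in> I}"

lemma N_add: assumes "x \<in> N" "y \<in> N" shows "x + y \<in> N"
proof -
  obtain a b where 1: "x - (a *s 1 + (\<Sum>i\<in>{1..<n}. \<Sum>j\<in>{1..<n}. b i j *s F i j)) \<in> I"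
    using assms(1) N_def by auto
  obtain a' b' where 2: "y - (a' *s 1 + (\<Sum>i\<in>{1..<n}. \<Sum>j\<in>{1..<n}. b' i j *s F i j)) \<in> I"
    using assms(2) N_def by auto
  have "(x + y) - ((a + a') *s 1 + (\<Sum>i\<in>{1..<n}. \<Sum>j\<in>{1..<n}. (b i j + b' i j) *s F i j)) \<in> I"
    using cl(2)[OF 1 2] by (simp add: scale_left_distrib sum.distrib algebra_simps)
  then show ?thesis unfolding N_def by (intro CollectI exI)
qed

lemma N_scale: assumes "x \<in> N" shows "t *s x \<in> N"
proof -
  obtain a b where 1: "x - (a *s 1 + (\<Sum>i\<in>{1..<n}. \<Sum>j\<in>{1..<n}. b i j *s F i j)) \<in> I"
    using assms N_def by auto
  have "t *s x - ((t * a) *s 1 + (\<Sum>i\<in>{1..<n}. \<Sum>j\<in>{1..<n}. (t * b i j) *s F i j)) \<in> I"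
    using cl(4)[OF 1, of t] by (simp add: scale_right_distrib scale_right_diff_distrib scale_sum_right)
  then show ?thesis unfolding N_def by (intro CollectI exI)
qed

lemma N_I: "x \<in> I \<Longrightarrow> x \<in> N"
  unfolding N_def by (intro CollectI exI[of _ 0] exI[of _ "\<lambda>_ _. 0"]) simp

lemma N_one: "1 \<in> N"
  unfolding N_def by (intro CollectI exI[of _ 1] exI[of _ "\<lambda>_ _. 0"]) (simp add: cl)

lemma N_F: assumes "0 < i" "i < n" "0 < j" "j < n" shows "F i j \<in> N"
proof -
  have "(\<Sum>i'\<in>{1..<n}. \<Sum>j'\<in>{1..<n}. (if i' = i \<and> j' = j then 1 else 0) *s F i' j') =
      (\<Sum>i'\<in>{1..<n}. if i' = i then F i j else 0)"
    using assms by (intro sum.cong refl) (auto simp: if_distrib[of "\<lambda>t. t *s _"] cong: if_cong)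
  also have "\<dots> = F i j" using assms by simp
  finally show ?thesis
    unfolding N_def by (intro CollectI exI[of _ 0] exI[of _ "\<lambda>i' j'. if i' = i \<and> j' = j then 1 else 0"]) (simp add: cl)
qed

lemma N_cong: "y \<in> N \<Longrightarrow> x - y \<in> I \<Longrightarrow> x \<in> N"
  using N_add[of y "x - y"] N_I[of "x - y"] by simp

lemma subspace_N: "subspace N"
  using N_I[OF cl(1)] by (auto intro: subspaceI N_add N_scale)

lemma f_F_N: assumes k: "0 < k'" "k' < n" and i: "0 < i" "i < n" and j: "0 < j" "j < n"
  shows "f k' * F i j \<in> N"
proof -
  obtain w where w: "w \<in> A n" "F i j = f i * w" using F_head i j by blast
  consider "k' = i" | "adj k' i" | "far k' i" by linarith
  then show ?thesis
  proof cases
    case 1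
    then have "f k' * F i j = c *s F i j" using ff[of i] k n unfolding w(2)
      by (simp add: scale_mult flip: mult.assoc)
    then show ?thesis using N_scale N_F i j by simp
  next
    case 2
    then show ?thesis using N_cong[OF N_F f_F_near] k i j by blast
  next
    case 3
    then have "f k' * F i j \<in> I" using far[OF k i] w(1) unfolding w(2) by (simp add: cl flip: mult.assoc)
    then show ?thesis by (rule N_I)
  qed
qed

lemma f_N: assumes k: "0 < k'" "k' < n" and x: "x \<in> N" shows "f k' * x \<in> N"
proof -
  obtain a b where 1: "x - (a *s 1 + (\<Sum>i\<in>{1..<n}. \<Sum>j\<in>{1..<n}. b i j *s F i j)) \<in> I"
    using x N_def by auto
  have "f k' * (x - (a *s 1 + (\<Sum>i\<in>{1..<n}. \<Sum>j\<in>{1..<n}. b i j *s F i j))) \<in> I"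
    using 1 A_f k by (simp add: cl)
  then have "f k' * x - (a *s f k' + (\<Sum>i\<in>{1..<n}. \<Sum>j\<in>{1..<n}. b i j *s (f k' * F i j))) \<in> I"
    by (simp add: right_diff_distrib distrib_left mult_scale sum_distrib_left)
  moreover have "a *s f k' + (\<Sum>i\<in>{1..<n}. \<Sum>j\<in>{1..<n}. b i j *s (f k' * F i j)) \<in> N"
    using N_F[OF k k] by (intro N_add N_scale subspace_sum[OF subspace_N] f_F_N k) (auto simp: F_same)
  ultimately show ?thesis using N_cong by blast
qed

lemma A_N: "x \<in> A n \<Longrightarrow> x \<in> N"
proof (induction rule: A.induct)
  case (A_g_mult i x)
  have "e i * x \<in> N" using A_g_mult eI by (intro N_I cl)
  moreover have "f i * x \<in> N" using A_g_mult f_N by blast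
  ultimately have "q^2 *s x + (-1) *s (f i * x) + (- (1 - inverse q^2)) *s (e i * x) \<in> N"
    using A_g_mult by (intro N_add N_scale)
  moreover have "g i * x = q^2 *s x + (-1) *s (f i * x) + (- (1 - inverse q^2)) *s (e i * x)"
    by (subst g_eq) (simp add: algebra_simps scale_mult)
  ultimately show ?case by metis
next
  case (A_e_mult i x)
  then show ?case using eI by (intro N_I cl)
qed (simp_all add: N_one N_add N_scale)

lemma f_1: "f 1 \<in> A n" "g 1 \<in> A n" "ok 1" using n by (auto intro!: A_f A_g)

text \<open>The scalar is found between two factors \<open>x = f 1\<close>, where
  \<open>x * y * x\<close> reduces to \<open>x\<close>. As \<open>L 3\<close> commutes with
  \<open>f 1\<close>, the sandwich equals \<open>c\<close> times \<open>L 3 * x\<close>.\<close>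

lemma L3_f1: assumes "3 \<le> n" shows "L 3 * f 1 - q^4 *s f 1 \<in> I"
proof -
  define x y where "x = f 1" "y = f 2"
  let ?X = "q^2 *s 1 - x" and ?Y = "q^2 *s 1 - y"
  have A: "x \<in> A n" "y \<in> A n" "g 1 \<in> A n" "g 2 \<in> A n" "?X \<in> A n" "?Y \<in> A n"
    using assms unfolding x_y_def by (simp_all add: A_closed)
  have xx: "x * x = c *s x" "y * y = c *s y" using ff[of 1] ff[of 2] n assms unfolding x_y_def by auto
  have xyx: "x * y * x - x \<in> I" using near[of 1 2] assms unfolding x_y_def by simp
  have L3: "L 3 = g 2 * (g 1 * g 1) * g 2" by (simp add: numeral_3_eq_3 numeral_2_eq_2)
  have "g 1 - ?X \<in> I" "g 2 - ?Y \<in> I"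
    using g_cong[OF I] eI assms unfolding x_y_def by auto
  then have "L 3 - ?Y * (?X * ?X) * ?Y \<in> I" unfolding L3 using A by (simp add: cm A_mult)
  then have "x * (L 3 - ?Y * (?X * ?X) * ?Y) * x \<in> I" using A by (simp add: cl)
  then have 1: "x * L 3 * x - x * (?Y * (?X * ?X) * ?Y) * x \<in> I"
    by (simp only: right_diff_distrib left_diff_distrib mult.assoc)
  have x2: "x * (x * w) = c *s (x * w)" "y * (y * w) = c *s (y * w)" for w
    using xx by (simp_all add: scale_mult flip: mult.assoc)
  define u where "u = x * y * x - x"
  have XX: "?X * ?X = q^4 *s 1 - k *s x"
    using xx by (simp add: algebra_simps scale_simps scale_left_distrib scale_left_diff_distrib power4_eq_xxxx power2_eq_square)
  have YY: "?Y * ?Y = q^4 *s 1 - k *s y"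
    using xx by (simp add: algebra_simps scale_simps scale_left_distrib scale_left_diff_distrib power4_eq_xxxx power2_eq_square)
  have xYx: "x * ?Y * x = q^4 *s x - u"
  proof -
    have "x * ?Y * x = (q^2 * c - 1) *s x - u"
      using xx unfolding u_def by (simp add: algebra_simps scale_simps scale_left_distrib scale_left_diff_distrib)
    also have "q^2 * c - 1 = q^4" by (simp add: field_simps eval_nat_numeral)
    finally show ?thesis .
  qed
  \<comment> \<open>Bookkeeping: splits off the multiple of \<open>x\<close> from the terms that lie
    in \<open>I\<close> because they contain \<open>u\<close>.\<close>
  have collect: "a *s (b *s x - d *s u) - d *s (m *s x - a *s u - w) - (a * b - d * m) *s x =
      (- (a * d)) *s u + d *s (a *s u + w)" for a b d m w
    by (simp add: algebra_simps scale_right_diff_distrib scale_left_diff_distrib)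
  have "x * (w * (a *s 1 - b *s x) * w) * x = a *s (x * (w * w) * x) - b *s (x * w * x * w * x)" for w a b
    by (simp only: right_diff_distrib left_diff_distrib mult_scale scale_mult mult_1_right mult.assoc)
  then have "x * (?Y * (?X * ?X) * ?Y) * x = q^4 *s (x * (?Y * ?Y) * x) - k *s (x * ?Y * x * ?Y * x)"
    unfolding XX .
  also have "x * (?Y * ?Y) * x = (q^4 * c - k) *s x - k *s u"
    unfolding YY u_def using xx by (simp add: algebra_simps scale_simps scale_left_distrib scale_left_diff_distrib)
  also have "x * ?Y * x * ?Y * x = q^4 *s (x * ?Y * x) - u * ?Y * x"
    by (subst xYx) (simp only: left_diff_distrib scale_mult)
  also have "\<dots> = (q^4 * q^4) *s x - q^4 *s u - u * ?Y * x"
    unfolding xYx by (simp only: scale_right_diff_distrib scale_scale)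
  finally have "x * (?Y * (?X * ?X) * ?Y) * x - (q^4 * (q^4 * c - k) - k * (q^4 * q^4)) *s x =
      (- (q^4 * k)) *s u + k *s (q^4 *s u + u * ?Y * x)"
    using collect by metis
  moreover have "q^4 * (q^4 * c - k) - k * (q^4 * q^4) = q^4 * c"
    by (simp add: field_simps eval_nat_numeral)
  moreover have "(- (q^4 * k)) *s u + k *s (q^4 *s u + u * ?Y * x) \<in> I"
    using xyx A unfolding u_def by (simp add: cl)
  ultimately have "x * (?Y * (?X * ?X) * ?Y) * x - (q^4 * c) *s x \<in> I" by metis
  then have "x * L 3 * x - (q^4 * c) *s x \<in> I" using ct[OF 1] by blast
  moreover have "x * L 3 = L 3 * x"
  proof -
    have "f 1 \<in> A 2" by (intro A_f) simp_all
    then show ?thesis using L_comm_A[of x 2] n assms unfolding x_y_def by (simp add: numeral_3_eq_3 numeral_2_eq_2)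
  qed
  ultimately have "c *s (L 3 * x - q^4 *s x) \<in> I"
    by (simp add: xx mult_scale mult.assoc scale_right_diff_distrib mult.commute)
  then show ?thesis using ideal_unscale[OF I] q_scalars_nonzero(2) x_y_def by blast
qed

text \<open>Passing from \<open>L j\<close> to \<open>L (j + 1)\<close> adds \<open>g j\<close> on
  both sides, and each contributes \<open>q^2\<close>: \<open>f j * f 1\<close> lies in the ideal
  for \<open>j \<ge> 3\<close>, so \<open>g j * f 1\<close> reduces to
  \<open>q^2 *s f 1\<close>.\<close>

lemma L_f1: "3 \<le> j \<Longrightarrow> j \<le> n \<Longrightarrow> L j * f 1 - q^(4 * j - 8) *s f 1 \<in> I"
proof (induction j rule: dec_induct)
  case base
  then show ?case using L3_f1 by simp
next
  case (step j)
  then have j: "0 < j" "j < n" "3 \<le> j" by auto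
  have A: "g j \<in> A n" "L j \<in> A n" using j by (auto intro!: A_g L_A)
  have "g j - (q^2 *s 1 - f j) \<in> I" using g_cong[OF I eI] j by auto
  then have "(g j - (q^2 *s 1 - f j)) * f 1 - f j * f 1 \<in> I" using far[of j 1] j f_1 n by (simp add: cl)
  then have gf1: "g j * f 1 - q^2 *s f 1 \<in> I" by (simp add: algebra_simps scale_simps)
  have "L (Suc j) * f 1 = g j * (L j * (g j * f 1))" using j by (simp add: mult.assoc)
  moreover have "g j * (L j * (g j * f 1 - q^2 *s f 1)) \<in> I" using gf1 A by (simp add: cl)
  moreover have "q^2 *s (g j * (L j * f 1 - q^(4 * j - 8) *s f 1)) \<in> I" using step.IH j A by (simp add: cl)
  moreover have "(q^2 * q^(4 * j - 8)) *s (g j * f 1 - q^2 *s f 1) \<in> I" using gf1 by (simp add: cl)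
  ultimately have "g j * (L j * (g j * f 1 - q^2 *s f 1)) + q^2 *s (g j * (L j * f 1 - q^(4 * j - 8) *s f 1))
      + (q^2 * q^(4 * j - 8)) *s (g j * f 1 - q^2 *s f 1) \<in> I" by (intro cl(2))
  moreover have "g j * (L j * (g j * f 1 - q^2 *s f 1)) + q^2 *s (g j * (L j * f 1 - q^(4 * j - 8) *s f 1))
      + (q^2 * q^(4 * j - 8)) *s (g j * f 1 - q^2 *s f 1) = L (Suc j) * f 1 - (q^2 * q^(4 * j - 8) * q^2) *s f 1"
    using j by (simp add: algebra_simps scale_simps)
  moreover have "4 * Suc j - 8 = (4 * j - 8) + 4" using j by simp
  then have "q^2 * q^(4 * j - 8) * q^2 = q^(4 * Suc j - 8)"
    by (simp only: power_add) (simp add: power4_eq_xxxx power2_eq_square)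
  ultimately show ?case by simp
qed

text \<open>Starts from \<open>T 2 = g 1 * g 1\<close>, which is \<open>inverse q^4\<close> on
  \<open>f 1\<close>; the factors \<open>L j\<close> from \<open>j = 3\<close> on supply the powers
  of \<open>L_f1\<close>, and the exponents add up to that of \<open>lam\<close>.\<close>

lemma T_f1: "2 \<le> j \<Longrightarrow> j \<le> n \<Longrightarrow> T j * f 1 - lam (j - 1) j *s f 1 \<in> I"
proof (induction j rule: dec_induct)
  case base
  have "T 2 * f 1 = g 1 * (g 1 * f 1)" by (simp add: numeral_2_eq_2 mult.assoc)
  also have "\<dots> = (inverse q^2 * inverse q^2) *s f 1" using gf[of 1] f_1 by (simp add: mult_scale)
  also have "inverse q^2 * inverse q^2 = lam (2 - 1) 2"
    by (simp add: lam_def power_int_minus power_inverse power4_eq_xxxx power2_eq_square)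
  finally show ?case by (simp add: cl)
next
  case (step j)
  have e1: "4 * int (Suc j) - 8 = int (4 * Suc j - 8)" using step by simp
  have "lam (j - 1) j * q^(4 * Suc j - 8) = lam (j - 1) j * q powi (4 * int (Suc j) - 8)"
    unfolding e1 by (simp only: power_int_of_nat)
  also have "\<dots> = lam (Suc j - 1) (Suc j)"
    using step by (simp add: lam_def of_nat_diff algebra_simps flip: power_int_add)
  finally have lam: "q^(4 * Suc j - 8) * lam (j - 1) j = lam (Suc j - 1) (Suc j)" by (simp add: mult.commute)
  have "T j * (L (Suc j) * f 1 - q^(4 * Suc j - 8) *s f 1) + q^(4 * Suc j - 8) *s (T j * f 1 - lam (j - 1) j *s f 1) \<in> I"
    using step T_A[of j n] by (intro cl(2) cl(4) cl(5) L_f1) auto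
  moreover have "T j * (L (Suc j) * f 1 - q^(4 * Suc j - 8) *s f 1) + q^(4 * Suc j - 8) *s (T j * f 1 - lam (j - 1) j *s f 1)
      = T (Suc j) * f 1 - lam (Suc j - 1) (Suc j) *s f 1"
    unfolding lam[symmetric] T.simps
    by (simp only: right_diff_distrib mult_scale scale_right_diff_distrib scale_scale mult.assoc) simp
  ultimately show ?case by simp
qed

lemma T_f: "0 < i \<Longrightarrow> i < n \<Longrightarrow> T n * f i - lam (n - 1) n *s f i \<in> I"
proof (induction i)
  case (Suc i)
  show ?case
  proof (cases "i = 0")
    case True
    then show ?thesis using T_f1[of n] n by simp
  next
    case False
    then show ?thesis using Suc n I by (intro T_cong_conj) auto
  qed
qed simp

text \<open>Modulo the elements killed by \<open>T n - lam (n - 1) n\<close> every \<open>g i\<close> becomes \<open>q\<^sup>2\<close>, which makes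
  \<open>T n\<close> the scalar \<open>lam n n\<close>.\<close>

lemma T_quadratic: "(T n - lam (n - 1) n *s 1) * (T n - lam n n *s 1) \<in> I"
proof -
  define t where "t = T n - lam (n - 1) n *s 1"
  define Z where "Z = {x \<in> A n. t * x \<in> I}"
  have tA: "t \<in> A n" unfolding t_def by (intro A_diff T_A A_scale A_one) simp
  have tc: "t * a = a * t" if "a \<in> A n" for a
    unfolding t_def using T_central[OF that n(2)]
    by (simp only: left_diff_distrib right_diff_distrib scale_mult mult_scale mult_1_left mult_1_right)
  have "a * x \<in> Z" "x * a \<in> Z" if "x \<in> Z" "a \<in> A n" for a x
  proof -
    have "t * (a * x) = a * (t * x)" using tc[OF that(2)] by (metis mult.assoc)
    then show "a * x \<in> Z" using that cl(5)[of "t * x" a] A_mult unfolding Z_def by simp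
    show "x * a \<in> Z" using that cl(6)[of "t * x" a] A_mult unfolding Z_def by (simp add: mult.assoc)
  qed
  moreover have "subspace Z"
    unfolding Z_def by (intro subspaceI) (simp_all add: distrib_left mult_scale A_zero A_add A_scale cl)
  ultimately have Z: "ideal_in n Z" unfolding ideal_in_def Z_def by auto
  have e: "e i \<in> Z" if "0 < i" "i < n" for i
    unfolding Z_def using that eI tA by (simp add: A_e cl)
  have f: "f i \<in> Z" if "0 < i" "i < n" for i
    unfolding Z_def t_def using that T_f[of i] by (simp add: A_f left_diff_distrib scale_mult)
  have g: "g i - q^2 *s 1 \<in> Z" if "0 < i" "i < n" for i
  proof -
    have "(g i - (q^2 *s 1 - f i)) - f i \<in> Z" using g_cong[OF Z e] f that ideal_diff[OF Z] by blast
    then show ?thesis by simp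
  qed
  have "L j - q^(4 * (j - 1)) *s 1 \<in> Z" if "j \<le> n" for j
    using that
  proof (induction j)
    case 0
    then show ?case using ideal_zero[OF Z] by simp
  next
    case (Suc j)
    show ?case
    proof (cases "j = 0")
      case True
      then show ?thesis using ideal_zero[OF Z] by simp
    next
      case False
      then have "g j * L j * g j - (q^2 *s 1) * (q^(4 * (j - 1)) *s 1) * (q^2 *s 1) \<in> Z"
        using Suc g[of j] by (intro ideal_cong_mult[OF Z]) (auto intro!: A_closed L_A)
      moreover have "(q^2 *s 1) * (q^(4 * (j - 1)) *s 1) * (q^2 *s 1) = q^(4 * (Suc j - 1)) *s (1 :: 'a)"
      proof -
        have "q^2 * (q^(4 * (j - 1)) * q^2) = q^(4 * (Suc j - 1))"
          using False by (cases j) (simp_all add: power_add power4_eq_xxxx power2_eq_square)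
        then show ?thesis by (simp add: scale_simps mult_ac)
      qed
      ultimately show ?thesis using False by simp
    qed
  qed note L = this
  have "T j - lam j j *s 1 \<in> Z" if "j \<le> n" for j
    using that
  proof (induction j)
    case 0
    then show ?case using ideal_zero[OF Z] by (simp add: lam_def)
  next
    case (Suc j)
    then have "T j * L (Suc j) - (lam j j *s 1) * (q^(4 * (Suc j - 1)) *s 1) \<in> Z"
      using L[of "Suc j"] by (intro ideal_cong_mult[OF Z]) (auto intro!: A_closed L_A simp del: L.simps)
    moreover have "q^(4 * (Suc j - 1)) * lam j j = lam (Suc j) (Suc j)"
    proof -
      have "q^(4 * (Suc j - 1)) = q powi (int (4 * j))" by (simp only: power_int_of_nat diff_Suc_1)
      then show ?thesis by (simp add: lam_def algebra_simps flip: power_int_add)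
    qed
    ultimately show ?case by (simp add: scale_simps del: L.simps)
  qed
  then have "T n - lam n n *s 1 \<in> Z" by simp
  then show ?thesis unfolding Z_def t_def by simp
qed

end

section \<open>Consequences of \<open>Phi = 0\<close>\<close>

locale bmw_quotient = bmw_algebra scale g h e r
  for scale :: "qfield \<Rightarrow> 'a::{ring,monoid_mult} \<Rightarrow> 'a" (infixr "*s" 75) and g h e r +
  assumes Phi_eq: "4 \<le> r \<Longrightarrow> coeff_a *s (f 1 * f 3 * e 2 * (f 1 * f 3)) - coeff_b *s (f 1 * f 3)
    - coeff_c *s (f 1 * f 3 * e 2 * (h 3 * g 1 * e 2 * h 1 * g 3) * (f 1 * f 3))
    + coeff_d *s (f 1 * f 3 * (e 2 * g 1 * h 3 * g 2 * h 1 * g 3) * (f 1 * f 3)) = 0"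
begin

text \<open>Every term of \<open>Phi\<close> except the one with \<open>coeff_b\<close> contains
  \<open>e 2\<close>.\<close>

lemma f13_J: assumes "4 \<le> n" "n \<le> r" shows "f 1 * f 3 \<in> J n"
proof -
  have A: "f 1 * f 3 \<in> A n" "h 3 * g 1 * e 2 * h 1 * g 3 \<in> A n" "g 1 * h 3 * g 2 * h 1 * g 3 \<in> A n"
    using assms by (simp_all add: A_closed)
  have e2: "e 2 \<in> J n" using assms by (intro e_J) auto
  note cl = ideal_add[OF ideal_J] ideal_diff[OF ideal_J] ideal_scale[OF ideal_J] ideal_left[OF ideal_J] ideal_right[OF ideal_J]
  have "coeff_a *s (f 1 * f 3 * e 2 * (f 1 * f 3)) \<in> J n"
    "coeff_c *s (f 1 * f 3 * e 2 * (h 3 * g 1 * e 2 * h 1 * g 3) * (f 1 * f 3)) \<in> J n"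
    "coeff_d *s (f 1 * f 3 * (e 2 * (g 1 * h 3 * g 2 * h 1 * g 3)) * (f 1 * f 3)) \<in> J n"
    using cl(3)[OF cl(5)[OF cl(4)[OF e2 A(1)] A(1)]] cl(3)[OF cl(5)[OF cl(5)[OF cl(4)[OF e2 A(1)] A(2)] A(1)]]
      cl(3)[OF cl(5)[OF cl(4)[OF cl(5)[OF e2 A(3)] A(1)] A(1)]] by blast+
  moreover from this(3) have "coeff_d *s (f 1 * f 3 * (e 2 * g 1 * h 3 * g 2 * h 1 * g 3) * (f 1 * f 3)) \<in> J n"
    by (simp only: mult.assoc)
  moreover have "coeff_b *s (f 1 * f 3) = coeff_a *s (f 1 * f 3 * e 2 * (f 1 * f 3))
    - coeff_c *s (f 1 * f 3 * e 2 * (h 3 * g 1 * e 2 * h 1 * g 3) * (f 1 * f 3))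
    + coeff_d *s (f 1 * f 3 * (e 2 * g 1 * h 3 * g 2 * h 1 * g 3) * (f 1 * f 3))"
    using Phi_eq assms by (simp add: algebra_simps)
  ultimately have "coeff_b *s (f 1 * f 3) \<in> J n" using cl(1,2) by metis
  then show ?thesis using ideal_unscale[OF ideal_J] coeff_b_nonzero by blast
qed

text \<open>Raises the index of the second factor by conjugating with a braid that commutes with
  \<open>x\<close>.\<close>

lemma conj_J:
  assumes "x * f i \<in> J n" "ok i" "ok (Suc i)" "Suc i < n" "n \<le> r"
    and "x * g i = g i * x" "x * g (Suc i) = g (Suc i) * x"
  shows "x * f (Suc i) \<in> J n"
proof -
  let ?w = "g i * g (Suc i)" and ?v = "h (Suc i) * h i"
  have A: "?w \<in> A n" "?v \<in> A n" using assms by (auto intro!: A_mult A_g A_h)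
  have "f (Suc i) = ?w * f i * ?v" using f_conj[of i "Suc i"] assms by auto
  then have "x * f (Suc i) = ?w * (x * f i) * ?v" using assms(6,7) by (metis mult.assoc)
  then show ?thesis using ideal_right[OF ideal_J ideal_left[OF ideal_J assms(1) A(1)] A(2)] by simp
qed

lemma f1_far_J:
  assumes "4 \<le> n" "n \<le> r" shows "3 \<le> j \<Longrightarrow> j < n \<Longrightarrow> f 1 * f j \<in> J n"
proof (induction j rule: dec_induct)
  case base
  show ?case using f13_J assms by blast
next
  case (step j)
  then have "f 1 * g j = g j * f 1" "f 1 * g (Suc j) = g (Suc j) * f 1"
    using gf_comm[of j 1] gf_comm[of "Suc j" 1] assms by auto
  then show ?case using step assms by (intro conj_J) auto
qed

text \<open>\<open>f1_far_J\<close> moved the larger index up from 3 beside \<open>f 1\<close>. Here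
  the larger index is fixed and the smaller one moves up, the conjugating braid staying out of reach
  of \<open>f j\<close>.\<close>

lemma far_less_J:
  assumes "4 \<le> n" "n \<le> r" shows "0 < i \<Longrightarrow> Suc i < j \<Longrightarrow> j < n \<Longrightarrow> f j * f i \<in> J n"
proof (induction i)
  case (Suc i)
  show ?case
  proof (cases "i = 0")
    case True
    then have "f j * f (Suc i) = f 1 * f j" using ff_comm[of j 1] Suc.prems assms by auto
    then show ?thesis using f1_far_J[OF assms, of j] Suc.prems True by simp
  next
    case False
    then have "f j * g i = g i * f j" "f j * g (Suc i) = g (Suc i) * f j"
      using gf_comm[of i j] gf_comm[of "Suc i" j] Suc.prems assms by auto
    then show ?thesis using Suc False assms by (intro conj_J) auto
  qed
qed simp

lemma far_J:
  assumes "4 \<le> n" "n \<le> r" "0 < i" "i < n" "0 < j" "j < n" "far i j" shows "f i * f j \<in> J n"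
proof -
  have "f i * f j = f j * f i" using ff_comm assms by auto
  then show ?thesis using far_less_J[OF assms(1,2), of i j] far_less_J[OF assms(1,2), of j i] assms by auto
qed

lemma near_triple_J:
  assumes n: "4 \<le> n" "n \<le> r" and i: "0 < i" "Suc (Suc i) < n"
  shows "f (Suc i) * f i * f (Suc i) - f (Suc i) \<in> J n"
    "f (Suc i) * f (Suc (Suc i)) * f (Suc i) - f (Suc i) \<in> J n"
proof -
  let ?x = "f i" and ?y = "f (Suc i)" and ?z = "f (Suc (Suc i))"
  have A: "?x \<in> A n" "?y \<in> A n" "?z \<in> A n" using i by (auto intro!: A_f)
  have yy: "?y * ?y = c *s ?y" using ff i n by auto
  have xz: "?x * ?z \<in> J n" "?z * ?x \<in> J n" using far_J[OF n] i by auto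
  have b: "?x * ?y * ?x - ?x - (?y * ?x * ?y - ?y) \<in> J n" "?z * ?y * ?z - ?z - (?y * ?z * ?y - ?y) \<in> J n"
    using i n by (auto intro!: f_braid[OF ideal_J] e_J)
  show "?y * ?x * ?y - ?y \<in> J n" by (rule near_of_far[OF ideal_J A yy xz b])
  show "?y * ?z * ?y - ?y \<in> J n" by (rule near_of_far[OF ideal_J A(3,2,1) yy xz(2,1) b(2,1)])
qed

text \<open>On at least four strands a third index adjoins \<open>i\<close> and \<open>j\<close>, so
  one of the two is the middle of a triple and \<open>near_triple_J\<close> applies to it; the braid
  relation transfers the result to the other.\<close>

lemma near_J:
  assumes n: "4 \<le> n" "n \<le> r" and i: "0 < i" "i < n" and j: "0 < j" "j < n" and adj: "adj i j"
  shows "f i * f j * f i - f i \<in> J n"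
proof -
  have b: "f i * f j * f i - f i - (f j * f i * f j - f j) \<in> J n"
    using i j adj n by (auto intro!: f_braid[OF ideal_J] e_J)
  have "f i * f j * f i - f i \<in> J n \<or> f j * f i * f j - f j \<in> J n"
  proof -
    define m where "m = min i j"
    consider "Suc (Suc m) < n" | "0 < m - 1" "Suc (Suc (m - 1)) < n" "m \<noteq> 0"
      using n i j adj unfolding m_def by linarith
    then show ?thesis
    proof cases
      case 1
      then show ?thesis using near_triple_J[OF n, of m] i j adj unfolding m_def by (auto simp: min_def split: if_splits)
    next
      case 2
      then show ?thesis using near_triple_J[OF n, of "m - 1"] i j adj unfolding m_def by (auto simp: min_def split: if_splits)
    qed
  qed
  then show ?thesis using ideal_add[OF ideal_J b] by fastforce
qed

lemma hook_ge_4: "4 \<le> n \<Longrightarrow> n \<le> r \<Longrightarrow> bmw_hook scale g h e r n (J n)"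
  by unfold_locales (auto intro: ideal_J e_J far_J near_J)

lemma hook_2: "2 \<le> r \<Longrightarrow> bmw_hook scale g h e r 2 (J 2)"
  by unfold_locales (auto intro: ideal_J e_J)

text \<open>The antisymmetriser on three strands, up to a scalar and modulo \<open>J 3\<close>. It only survives
  for \<open>n = 3\<close>: from four strands on, \<open>Phi\<close> kills it.\<close>

definition alt :: 'a where "alt = f 1 * f 2 * f 1 - f 1"

definition J_alt :: "'a set" where "J_alt = {x + t *s alt |x t. x \<in> J 3}"

text \<open>For \<open>f 1\<close> this is read off the formula; for \<open>f 2\<close> the braid
  relation makes \<open>alt\<close> symmetric in the two indices modulo \<open>J 3\<close>.\<close>

lemma f_alt:
  assumes "3 \<le> r" "i \<in> {1, 2}"
  shows "f i * alt - c *s alt \<in> J 3" "alt * f i - c *s alt \<in> J 3"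
proof -
  have A: "f 1 \<in> A 3" "f 2 \<in> A 3" by (auto intro!: A_f)
  have b: "alt - (f 2 * f 1 * f 2 - f 2) \<in> J 3"
    unfolding alt_def using assms by (intro f_braid[OF ideal_J] e_J) auto
  have ff': "f 1 * f 1 = c *s f 1" "f 2 * f 2 = c *s f 2" using ff[of 1] ff[of 2] assms by auto
  have ff'': "f 1 * (f 1 * w) = c *s (f 1 * w)" "f 2 * (f 2 * w) = c *s (f 2 * w)" for w
    using ff' by (simp_all add: scale_mult flip: mult.assoc)
  have 1: "f 1 * alt = c *s alt" "alt * f 1 = c *s alt"
    unfolding alt_def by (simp_all add: ff' ff'' algebra_simps scale_simps scale_left_distrib del: One_nat_def)
  have 2: "f 2 * alt - c *s alt = f 2 * (alt - (f 2 * f 1 * f 2 - f 2)) - c *s (alt - (f 2 * f 1 * f 2 - f 2))"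
    "alt * f 2 - c *s alt = (alt - (f 2 * f 1 * f 2 - f 2)) * f 2 - c *s (alt - (f 2 * f 1 * f 2 - f 2))"
    by (simp_all add: ff' ff'' algebra_simps scale_simps scale_left_distrib del: One_nat_def)
  have "f 2 * alt - c *s alt \<in> J 3" "alt * f 2 - c *s alt \<in> J 3"
    unfolding 2 using A b by (simp_all add: ideal_diff[OF ideal_J] ideal_scale[OF ideal_J] ideal_left[OF ideal_J] ideal_right[OF ideal_J])
  then show "f i * alt - c *s alt \<in> J 3" "alt * f i - c *s alt \<in> J 3"
    using assms(2) 1 J_zero by auto
qed

lemma alt_A: "alt \<in> A 3"
  unfolding alt_def by (auto intro!: A_closed)

lemma g_alt:
  assumes "3 \<le> r" "i \<in> {1, 2}"
  shows "g i * alt - (- (inverse q^2)) *s alt \<in> J 3" "alt * g i - (- (inverse q^2)) *s alt \<in> J 3"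
proof -
  have e: "e i \<in> J 3" using assms by (intro e_J) auto
  have "(g i - (q^2 *s 1 - f i)) * alt - (f i * alt - c *s alt) \<in> J 3"
    "alt * (g i - (q^2 *s 1 - f i)) - (alt * f i - c *s alt) \<in> J 3"
    using g_cong[OF ideal_J e] f_alt[OF assms] alt_A
    by (simp_all add: ideal_diff[OF ideal_J] ideal_left[OF ideal_J] ideal_right[OF ideal_J])
  then show "g i * alt - (- (inverse q^2)) *s alt \<in> J 3" "alt * g i - (- (inverse q^2)) *s alt \<in> J 3"
    by (simp_all add: algebra_simps scale_simps scale_left_distrib)
qed

lemma A_alt:
  assumes "3 \<le> r" "x \<in> A 3" shows "\<exists>t. x * alt - t *s alt \<in> J 3"
  using assms(2)
proof (induction rule: A.induct)
  case A_one
  show ?case by (rule exI[of _ 1]) (simp add: J_zero)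
next
  case (A_add x y)
  then obtain s t where "x * alt - s *s alt \<in> J 3" "y * alt - t *s alt \<in> J 3" by blast
  then have "(x * alt - s *s alt) + (y * alt - t *s alt) \<in> J 3" by (rule J_add)
  then show ?case by (intro exI[of _ "s + t"]) (simp add: algebra_simps scale_left_distrib)
next
  case (A_scale x a)
  then obtain t where "x * alt - t *s alt \<in> J 3" by blast
  then have "a *s (x * alt - t *s alt) \<in> J 3" by (rule J_scale)
  then show ?case by (intro exI[of _ "a * t"]) (simp add: scale_right_diff_distrib scale_mult)
next
  case (A_g_mult i x)
  then obtain t where t: "x * alt - t *s alt \<in> J 3" by blast
  have i: "i \<in> {1, 2}" using A_g_mult by auto
  have "g i * (x * alt - t *s alt) + t *s (g i * alt - (- (inverse q^2)) *s alt) \<in> J 3"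
    using A_g_mult t g_alt(1)[OF assms(1) i] by (intro J_add J_scale ideal_left[OF ideal_J] A_g)
  then show ?case by (intro exI[of _ "t * - (inverse q^2)"]) (simp add: algebra_simps scale_simps)
next
  case (A_e_mult i x)
  then have "e i * (x * alt) - 0 *s alt \<in> J 3"
    using alt_A by (simp add: e_J ideal_right[OF ideal_J] A_mult)
  then show ?case by (metis mult.assoc)
qed

lemma alt_A':
  assumes "3 \<le> r" "x \<in> A 3" shows "\<exists>t. alt * x - t *s alt \<in> J 3"
proof -
  have "\<exists>t. y * alt * x - t *s alt \<in> J 3" if "y \<in> A 3" for y
    using assms(2) that
  proof (induction arbitrary: y rule: A.induct)
    case A_one
    then show ?case using A_alt[OF assms(1)] by simp
  next
    case (A_add x z)
    then obtain s t where "y * alt * x - s *s alt \<in> J 3" "y * alt * z - t *s alt \<in> J 3" by blast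
    then have "(y * alt * x - s *s alt) + (y * alt * z - t *s alt) \<in> J 3" by (rule J_add)
    then show ?case by (intro exI[of _ "s + t"]) (simp add: algebra_simps scale_left_distrib)
  next
    case (A_scale x a)
    then obtain t where "y * alt * x - t *s alt \<in> J 3" by blast
    then have "a *s (y * alt * x - t *s alt) \<in> J 3" by (rule J_scale)
    then show ?case by (intro exI[of _ "a * t"]) (simp add: scale_right_diff_distrib mult_scale)
  next
    case (A_g_mult i x)
    then have i: "i \<in> {1, 2}" by auto
    obtain t where t: "y * alt * x - t *s alt \<in> J 3" using A_g_mult by blast
    have "y * (alt * g i - (- (inverse q^2)) *s alt) * x \<in> J 3"
      using A_g_mult g_alt(2)[OF assms(1) i] by (intro ideal_left[OF ideal_J] ideal_right[OF ideal_J])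
    then have "y * (alt * g i - (- (inverse q^2)) *s alt) * x + (- (inverse q^2)) *s (y * alt * x - t *s alt) \<in> J 3"
      using t by (intro J_add J_scale)
    then show ?case by (intro exI[of _ "- (inverse q^2) * t"]) (simp add: algebra_simps scale_simps)
  next
    case (A_e_mult i x)
    then have "(y * alt) * (e i * x) - 0 *s alt \<in> J 3"
      using alt_A by (simp add: e_J ideal_left[OF ideal_J] ideal_right[OF ideal_J] A_mult)
    then show ?case by (metis mult.assoc)
  qed
  from this[OF A_one] show ?thesis by simp
qed

lemma J_sub_J_alt: "x \<in> J 3 \<Longrightarrow> x \<in> J_alt"
  unfolding J_alt_def by (intro CollectI exI[of _ x] exI[of _ 0]) simp

lemma ideal_J_alt: assumes "3 \<le> r" shows "ideal_in 3 J_alt"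
proof -
  have "subspace J_alt"
  proof (rule subspaceI)
    show "0 \<in> J_alt" by (simp add: J_sub_J_alt J_zero)
  next
    fix x y assume "x \<in> J_alt" "y \<in> J_alt"
    then obtain x' y' s t where "x' \<in> J 3" "y' \<in> J 3" "x = x' + s *s alt" "y = y' + t *s alt"
      unfolding J_alt_def by blast
    then show "x + y \<in> J_alt" unfolding J_alt_def
      by (intro CollectI exI[of _ "x' + y'"] exI[of _ "s + t"]) (simp add: J_add scale_left_distrib algebra_simps)
  next
    fix a x assume "x \<in> J_alt"
    then obtain x' s where "x' \<in> J 3" "x = x' + s *s alt" unfolding J_alt_def by blast
    then show "a *s x \<in> J_alt" unfolding J_alt_def
      by (intro CollectI exI[of _ "a *s x'"] exI[of _ "a * s"]) (simp add: J_scale scale_right_distrib)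
  qed
  moreover have "J_alt \<subseteq> A 3"
    unfolding J_alt_def using alt_A by (auto intro!: A_add A_scale dest: ideal_A[OF ideal_J])
  moreover have "a * x \<in> J_alt \<and> x * a \<in> J_alt" if xa: "x \<in> J_alt" "a \<in> A 3" for x a
  proof -
    obtain x' s where x: "x' \<in> J 3" "x = x' + s *s alt" using xa(1) by (auto simp: J_alt_def)
    obtain t u where tu: "a * alt - t *s alt \<in> J 3" "alt * a - u *s alt \<in> J 3"
      using A_alt alt_A' assms xa(2) by blast
    have "a * x' + s *s (a * alt - t *s alt) \<in> J 3" "x' * a + s *s (alt * a - u *s alt) \<in> J 3"
      using x(1) tu xa(2) by (simp_all add: J_add J_scale ideal_left[OF ideal_J] ideal_right[OF ideal_J])
    moreover have "a * x = a * x' + s *s (a * alt - t *s alt) + (s * t) *s alt"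
      "x * a = x' * a + s *s (alt * a - u *s alt) + (s * u) *s alt"
      unfolding x(2) by (simp_all add: algebra_simps scale_simps)
    ultimately show ?thesis unfolding J_alt_def by blast
  qed
  ultimately show ?thesis unfolding ideal_in_def by blast
qed

lemma hook_3: assumes "3 \<le> r" shows "bmw_hook scale g h e r 3 J_alt"
proof -
  have alt: "alt \<in> J_alt" unfolding J_alt_def by (intro CollectI exI[of _ 0] exI[of _ 1]) (simp add: J_zero)
  have "f 2 * f 1 * f 2 - f 2 = alt - (alt - (f 2 * f 1 * f 2 - f 2))" by simp
  moreover have "alt - (f 2 * f 1 * f 2 - f 2) \<in> J_alt"
    unfolding alt_def using assms by (intro J_sub_J_alt f_braid[OF ideal_J] e_J) auto
  ultimately have "f 2 * f 1 * f 2 - f 2 \<in> J_alt"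
    using ideal_diff[OF ideal_J_alt[OF assms] alt] by metis
  then have near: "f i * f j * f i - f i \<in> J_alt" if "(i = 1 \<and> j = 2) \<or> (i = 2 \<and> j = 1)" for i j
    using that alt unfolding alt_def by auto
  show ?thesis
  proof unfold_locales
    show "f i * f j * f i - f i \<in> J_alt" if "0 < i" "i < 3" "0 < j" "j < 3" "adj i j" for i j
      by (rule near) (use that in linarith)
  qed (use assms ideal_J_alt[OF assms] in \<open>auto intro: J_sub_J_alt e_J\<close>)
qed

text \<open>\<open>T 3\<close> is a word of six generators, each acting on \<open>alt\<close> by
  \<open>- inverse q^2\<close>; the product is \<open>q\<close> to the power \<open>-12\<close>, the
  value of \<open>lam\<close> at \<open>m = 0\<close>.\<close>

lemma T_alt: assumes "3 \<le> r" shows "(T 3 - lam 0 3 *s 1) * alt \<in> J 3"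
proof -
  let ?p = "- (inverse q^2)"
  have g: "g i * (t *s alt) - (t * ?p) *s alt \<in> J 3" if "i \<in> {1, 2}" for i t
    using J_scale[OF g_alt(1)[OF assms that], of t] by (simp only: scale_right_diff_distrib mult_scale scale_scale)
  have step: "g i * x - (t * ?p) *s alt \<in> J 3" if "x - t *s alt \<in> J 3" "i \<in> {1, 2}" for x t i
  proof -
    have "g i \<in> A 3" using that by (intro A_g) auto
    then have "g i * (x - t *s alt) + (g i * (t *s alt) - (t * ?p) *s alt) \<in> J 3"
      using that g by (intro J_add ideal_left[OF ideal_J])
    then show ?thesis by (simp add: algebra_simps)
  qed
  have "g 1 * (g 1 * (g 2 * (g 1 * (g 1 * (g 2 * alt))))) - (1 * ?p * ?p * ?p * ?p * ?p * ?p) *s alt \<in> J 3"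
    by (intro step) (simp_all add: J_zero)
  moreover have "g 1 * (g 1 * (g 2 * (g 1 * (g 1 * (g 2 * alt))))) = T 3 * alt"
    by (simp add: numeral_3_eq_3 numeral_2_eq_2 mult.assoc)
  moreover have "1 * ?p * ?p * ?p * ?p * ?p * ?p = lam 0 3"
    by (simp add: lam_def power_int_minus field_simps flip: power_mult power_add)
  ultimately show ?thesis by (simp add: left_diff_distrib scale_mult)
qed

section \<open>Polynomials in the full twist and its spectrum\<close>

definition pol :: "nat \<Rightarrow> nat list \<Rightarrow> 'a"
  where "pol n ks = prod_list (map (\<lambda>m. T n - lam m n *s 1) ks)"

lemma pol_simps [simp]: "pol n [] = 1" "pol n (m # ks) = (T n - lam m n *s 1) * pol n ks"
  "pol n (ks @ ls) = pol n ks * pol n ls"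
  by (simp_all add: pol_def)

lemma pol_A: "pol n ks \<in> A n"
  by (induction ks) (auto intro!: A_closed T_A)

lemma factor_central: assumes "x \<in> A n" "n \<le> r" shows "(T n - t *s 1) * x = x * (T n - t *s 1)"
  using T_central[OF assms]
  by (simp only: left_diff_distrib right_diff_distrib scale_mult mult_scale mult_1_left mult_1_right)

lemma pol_central: "x \<in> A n \<Longrightarrow> n \<le> r \<Longrightarrow> pol n ks * x = x * pol n ks"
proof (induction ks)
  case (Cons m ks)
  then show ?case using factor_central[of x n "lam m n"] by (metis pol_simps(2) mult.assoc)
qed simp

lemma pol_eigen:
  assumes "(T n - lam l n *s 1) * y = 0"
  shows "pol n ks * y = (\<Prod>m\<leftarrow>ks. lam l n - lam m n) *s y"
proof (induction ks)
  case (Cons m ks)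
  have "T n * y = lam l n *s y" using assms by (simp add: left_diff_distrib scale_mult)
  then have "(T n - lam m n *s 1) * y = (lam l n - lam m n) *s y"
    by (simp add: left_diff_distrib scale_mult scale_left_diff_distrib)
  then show ?case using Cons by (simp add: mult.assoc mult_scale mult.commute)
qed simp

text \<open>Peel off the factors of \<open>ls\<close>: an element killed by one of them is an
  eigenvector, on which \<open>pol n ks\<close> is a product of differences that
  \<open>lam_inj\<close> keeps from vanishing.\<close>

lemma pol_coprime:
  assumes "n \<le> r" "set ks \<inter> set ls = {}"
  shows "x \<in> A n \<Longrightarrow> pol n ks * x = 0 \<Longrightarrow> pol n ls * x = 0 \<Longrightarrow> x = 0"
  using assms(2)
proof (induction ls arbitrary: x)
  case (Cons l ls)
  define y where "y = pol n ls * x"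
  have y: "y \<in> A n" unfolding y_def using Cons pol_A A_mult by blast
  have "(T n - lam l n *s 1) * y = 0" using Cons by (simp add: y_def mult.assoc)
  then have "pol n ks * y = (\<Prod>m\<leftarrow>ks. lam l n - lam m n) *s y" by (rule pol_eigen)
  moreover have "pol n ks * y = 0"
    unfolding y_def using pol_central[OF pol_A assms(1), of ks ls] Cons.prems(2) by (metis mult.assoc mult_zero_right)
  moreover have "(\<Prod>m\<leftarrow>ks. lam l n - lam m n) \<noteq> 0"
    using Cons.prems by (auto simp: prod_list_zero_iff lam_inj)
  ultimately have "y = 0" by simp
  then show ?case using Cons unfolding y_def by auto
qed simp

text \<open>For \<open>n \<ge> 2\<close>, the \<open>m\<close> for which the highest weight
  \<open>2 * m\<close> occurs in the \<open>n\<close>-th tensor power but not in the one two steps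
  below. For \<open>n = 3\<close> the lower power contains only \<open>m = 1\<close>, so
  \<open>0\<close> is new as well.\<close>

definition Dl :: "nat \<Rightarrow> nat list"
  where "Dl n = (if n = 3 then [0] else []) @ [n - 1, n]"

text \<open>The \<open>m\<close> that occur in the \<open>n\<close>-th tensor power, each listed
  once. The recursion by two also provides the induction rule for
  \<open>kernel_zero\<close>.\<close>

fun Sl :: "nat \<Rightarrow> nat list" where
  "Sl 0 = [0]"
| "Sl (Suc 0) = [1]"
| "Sl (Suc (Suc n)) = Sl n @ Dl (Suc (Suc n))"

lemma Sl_le: "m \<in> set (Sl n) \<Longrightarrow> m \<le> n"
  by (induction n rule: Sl.induct) (auto simp: Dl_def split: if_splits)

text \<open>The repeated list stands for the square of \<open>pol\<close> on \<open>Dl\<close>,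
  which arises when this central element is put on both sides of \<open>x\<close>.\<close>

lemma Sl_Dl_disjoint: "set (Sl n) \<inter> set (Dl (Suc (Suc n)) @ Dl (Suc (Suc n))) = {}"
proof (cases "n = 1")
  case False
  then show ?thesis using Sl_le[of _ n] by (fastforce simp: Dl_def)
qed (auto simp: Dl_def)

text \<open>The quadratic relation holds modulo the ideal of the hook locale. On three strands this
  ideal still contains \<open>alt\<close>, which the additional factor for \<open>m = 0\<close>
  sends into \<open>J 3\<close>.\<close>

lemma pol_Dl_J: assumes "2 \<le> n" "n \<le> r" shows "pol n (Dl n) \<in> J n"
proof (cases "n = 3")
  case True
  interpret bmw_hook scale g h e r 3 J_alt using hook_3 assms True by simp
  obtain y t where y: "y \<in> J 3" "pol 3 [2, 3] = y + t *s alt"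
    using T_quadratic unfolding J_alt_def by auto
  have "pol 3 [0, 2, 3] = (T 3 - lam 0 3 *s 1) * y + t *s ((T 3 - lam 0 3 *s 1) * alt)"
    using y(2) by (simp only: pol_simps distrib_left mult_scale)
  then show ?thesis
    using True y(1) T_alt assms by (simp add: Dl_def J_add J_scale ideal_left[OF ideal_J] A_diff A_scale A_one T_A del: pol_simps)
next
  case False
  then have "bmw_hook scale g h e r n (J n)"
    using hook_2 hook_ge_4[of n] assms by (cases "n = 2") auto
  from bmw_hook.T_quadratic[OF this] show ?thesis using False by (simp add: Dl_def)
qed

text \<open>Each factor contributes \<open>inverse q^8\<close>: by \<open>eT\<close> for the twist,
  and because \<open>lam\<close> rescales in the same way when two strands are added.\<close>

lemma pol_e: assumes "Suc n < r" shows "\<exists>t. pol (Suc (Suc n)) ks * e (Suc n) = t *s (pol n ks * e (Suc n))"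
proof (induction ks)
  case Nil
  show ?case by (rule exI[of _ 1]) simp
next
  case (Cons m ks)
  then obtain t where t: "pol (Suc (Suc n)) ks * e (Suc n) = t *s (pol n ks * e (Suc n))" by blast
  let ?T = "T (Suc (Suc n)) - lam m (Suc (Suc n)) *s 1"
  have A: "e (Suc n) \<in> A (Suc (Suc n))" "pol n ks \<in> A (Suc (Suc n))"
    using A_mono[OF pol_A[of n ks], of "Suc (Suc n)"] by (simp_all add: A_e)
  have "lam m (Suc (Suc n)) = q powi (2 * int m * (int m + 1) - 4 * int n - 8)"
    by (simp add: lam_def algebra_simps)
  also have "\<dots> = lam m n / q powi 8" by (simp add: lam_def power_int_diff)
  finally have lam: "lam m (Suc (Suc n)) = inverse q^8 * lam m n"
    by (simp add: power_inverse divide_inverse mult.commute)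
  have "?T * e (Suc n) = e (Suc n) * T (Suc (Suc n)) - lam m (Suc (Suc n)) *s e (Suc n)"
    using T_central[OF A(1)] assms by (simp only: left_diff_distrib scale_mult mult_1_left Suc_leI)
  also have "\<dots> = inverse q^8 *s ((T n - lam m n *s 1) * e (Suc n))"
    unfolding eT[OF assms] lam
    by (simp only: left_diff_distrib scale_mult scale_right_diff_distrib scale_scale mult_1_left)
  finally have Te: "?T * e (Suc n) = inverse q^8 *s ((T n - lam m n *s 1) * e (Suc n))" .
  have comm: "pol n ks * e (Suc n) = e (Suc n) * pol n ks"
    using A_far_comm[OF pol_A, of "e (Suc n)" "Suc n" n ks] assms by auto
  have comm': "(T n - lam m n *s 1) * pol n ks = pol n ks * (T n - lam m n *s 1)"
    using pol_A assms by (intro factor_central) auto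
  have T_pol: "?T * pol n ks = pol n ks * ?T" using assms by (intro factor_central A(2)) simp
  have "pol (Suc (Suc n)) (m # ks) * e (Suc n) = t *s (?T * (pol n ks * e (Suc n)))"
    by (simp only: pol_simps mult.assoc t mult_scale)
  also have "?T * (pol n ks * e (Suc n)) = pol n ks * (?T * e (Suc n))"
    by (simp only: T_pol flip: mult.assoc)
  also have "\<dots> = inverse q^8 *s (pol n ks * (T n - lam m n *s 1) * e (Suc n))"
    unfolding Te by (simp only: mult_scale mult.assoc)
  finally have "pol (Suc (Suc n)) (m # ks) * e (Suc n) = (t * inverse q^8) *s (pol n (m # ks) * e (Suc n))"
    unfolding comm'[symmetric] by (simp only: scale_scale pol_simps)
  then show ?case by blast
qed

lemma pol_J:
  assumes "Suc n < r" "pol n ks = 0" "x \<in> J (Suc (Suc n))" shows "pol (Suc (Suc n)) ks * x = 0"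
proof -
  have "Suc (Suc n) \<le> r" using assms by simp
  then show ?thesis using assms(3)
  proof (induction rule: J_top_induct)
    case (base a b)
    have "pol (Suc (Suc n)) ks * a = a * pol (Suc (Suc n)) ks" using base assms(1) by (intro pol_central) auto
    then have "pol (Suc (Suc n)) ks * (a * e (Suc n) * b) = a * (pol (Suc (Suc n)) ks * e (Suc n)) * b"
      by (metis mult.assoc)
    then show ?case using pol_e[OF assms(1), of ks] assms(2) by auto
  qed (simp_all add: distrib_left mult_scale)
qed

text \<open>The factors from \<open>Dl\<close> lead into \<open>J (n + 2)\<close>, where by
  \<open>pol_J\<close> those inherited from \<open>n\<close> strands suffice. The start is
  \<open>T 0 = T 1 = 1\<close>, matching \<open>lam 0 0\<close> and \<open>lam 1 1\<close>.\<close>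

lemma pol_Sl: "n \<le> r \<Longrightarrow> pol n (Sl n) = 0"
proof (induction n rule: Sl.induct)
  case (3 n)
  then have "pol n (Sl n) = 0" by simp
  then have "pol (Suc (Suc n)) (Sl n) * pol (Suc (Suc n)) (Dl (Suc (Suc n))) = 0"
    using 3 by (intro pol_J pol_Dl_J) auto
  then show ?case by simp
qed (simp_all add: lam_def)

text \<open>The quotient of \<open>A (n + 2)\<close> by \<open>J (n + 2)\<close> and \<open>J (n + 2)\<close> itself are separated by the
  eigenvalues of the full twist, so \<open>J (n + 2)\<close> has a unit.\<close>

lemma J_x_J_zero:
  assumes n: "Suc n < r" and x: "x \<in> J (Suc (Suc n))"
    and JxJ: "\<And>y z. y \<in> J (Suc (Suc n)) \<Longrightarrow> z \<in> J (Suc (Suc n)) \<Longrightarrow> y * x * z = 0"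
  shows "x = 0"
proof -
  let ?m = "Suc (Suc n)"
  let ?D = "pol ?m (Dl ?m)"
  have D: "?D \<in> J ?m" using n by (intro pol_Dl_J) auto
  have xA: "x \<in> A ?m" using ideal_A[OF ideal_J x] .
  have "?D * x = x * ?D" using xA n by (intro pol_central) auto
  then have "pol ?m (Dl ?m @ Dl ?m) * x = 0"
    using JxJ[OF D D] unfolding pol_simps by (metis mult.assoc)
  moreover have "pol ?m (Sl n) * x = 0" using n x pol_Sl by (intro pol_J) auto
  ultimately show ?thesis
    using pol_coprime[OF _ Sl_Dl_disjoint xA] n by (simp del: pol_simps)
qed

end

section \<open>Tensor powers and the \<open>R\<close>-matrix on them\<close>

lemma tensor_power_add: "u \<in> tensor_power n \<Longrightarrow> v \<in> tensor_power n \<Longrightarrow> u + v \<in> tensor_power n"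
  unfolding tensor_power_def using keys_add[of u v] by blast

lemma tensor_power_uminus: "v \<in> tensor_power n \<Longrightarrow> - v \<in> tensor_power n"
  by (simp add: tensor_power_def in_keys_iff)

lemma tensor_power_diff: "u \<in> tensor_power n \<Longrightarrow> v \<in> tensor_power n \<Longrightarrow> u - v \<in> tensor_power n"
  using tensor_power_add[of u n "- v"] by (simp add: tensor_power_uminus)

lemma tensor_power_zero: "0 \<in> tensor_power n"
  by (simp add: tensor_power_def)

lemma tensor_power_mult: "u \<in> tensor_power m \<Longrightarrow> v \<in> tensor_power n \<Longrightarrow> u * v \<in> tensor_power (m + n)"
  unfolding tensor_power_def using keys_mult[of u v] by (fastforce simp: plus_list_def)

lemma tensor_power_single: "length w = n \<Longrightarrow> Poly_Mapping.single w c \<in> tensor_power n"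
  by (simp add: tensor_power_def)

lemma tensor_power_sc: "v \<in> tensor_power n \<Longrightarrow> sc c * v \<in> tensor_power n"
  using tensor_power_mult[of "sc c" 0 v n] tensor_power_single[of "[]" 0 c] by simp

lemmas tensor_power_closed = tensor_power_add tensor_power_diff tensor_power_zero tensor_power_single
  tensor_power_sc

lemma tensor_power_induct [consumes 1, case_names zero single add]:
  assumes "v \<in> tensor_power n" "P 0" "\<And>w c. length w = n \<Longrightarrow> P (Poly_Mapping.single w c)"
    "\<And>u v. u \<in> tensor_power n \<Longrightarrow> v \<in> tensor_power n \<Longrightarrow> P u \<Longrightarrow> P v \<Longrightarrow> P (u + v)"
  shows "P v"
proof -
  let ?s = "\<lambda>w. Poly_Mapping.single w (Poly_Mapping.lookup v w)"
  have "P (\<Sum>w\<in>B. ?s w) \<and> (\<Sum>w\<in>B. ?s w) \<in> tensor_power n"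
    if "finite B" "B \<subseteq> Poly_Mapping.keys v" for B
    using that
  proof (induction B rule: finite_induct)
    case (insert w B)
    moreover have "length w = n" using insert assms(1) by (auto simp: tensor_power_def)
    ultimately show ?case using assms(3,4) by (simp add: tensor_power_closed)
  qed (simp add: assms(2) tensor_power_zero)
  moreover have "v = (\<Sum>w\<in>Poly_Mapping.keys v. ?s w)"
    by (rule poly_mapping_eqI) (simp add: lookup_sum lookup_single when_def in_keys_iff)
  ultimately show ?thesis by (metis finite_keys order_refl)
qed

text \<open>A word splits uniquely once the length of its first part is fixed. This is what later
  cancels a tensor factor.\<close>

lemma lookup_tensor:
  assumes "y \<in> tensor_power n" "length u = n"
  shows "Poly_Mapping.lookup (y * z) (u @ t) = Poly_Mapping.lookup y u * Poly_Mapping.lookup z t"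
  using assms(1)
proof (induction rule: tensor_power_induct)
  case (single w c)
  show ?case
  proof (induction z rule: ncpoly_induct)
    case (single w' d)
    then show ?case using \<open>length w = n\<close> assms(2) by (auto simp: single_mult lookup_single when_def)
  qed (simp add: distrib_left lookup_add)
qed (simp_all add: distrib_right lookup_add)

lemma braiding_tensor_power: "braiding a b \<in> tensor_power 2"
  by (cases a; cases b) (simp_all add: braiding_table single_mult tensor_power_closed)

lemma R_matrix_single:
  assumes "length u + 2 + length t = r"
  shows "R_matrix r (Suc (length u)) (word (u @ [a, b] @ t)) = word u * braiding a b * word t"
  using assms by (simp add: R_matrix_def tensor_power_single lin_single sc_1 nth_append)

lemma R_matrix_add:
  "u \<in> tensor_power r \<Longrightarrow> v \<in> tensor_power r \<Longrightarrow> R_matrix r i (u + v) = R_matrix r i u + R_matrix r i v"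
  by (simp add: R_matrix_def tensor_power_closed lin_add)

lemma R_matrix_sc: "u \<in> tensor_power r \<Longrightarrow> R_matrix r i (sc c * u) = sc c * R_matrix r i u"
  by (simp add: R_matrix_def tensor_power_closed lin_sc)

lemma R_matrix_0: "R_matrix r i 0 = 0"
  by (simp add: R_matrix_def tensor_power_zero)

lemma split_word:
  assumes "0 < i" "i < length w"
  shows "\<exists>u a b t. w = u @ [a, b] @ t \<and> length u = i - 1"
proof -
  have "w = take (i - 1) w @ [w ! (i - 1), w ! i] @ drop (Suc i) w"
    using assms id_take_nth_drop[of "i - 1" w] Cons_nth_drop_Suc[of i w] by simp
  then show ?thesis using assms by (intro exI[of _ "take (i - 1) w"] exI[of _ "w ! (i - 1)"]
      exI[of _ "w ! i"] exI[of _ "drop (Suc i) w"]) auto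
qed

lemma R_matrix_word_mult:
  assumes "0 < i" "i < length w"
  shows "R_matrix (length w + length t) i (word (w @ t)) = R_matrix (length w) i (word w) * word t"
proof -
  obtain u a b s where w: "w = u @ [a, b] @ s" "length u = i - 1" using split_word assms by blast
  then have i: "i = Suc (length u)" using assms by simp
  have "R_matrix (length w + length t) i (word (w @ t)) = word u * braiding a b * word (s @ t)"
    unfolding i w(1) using R_matrix_single[of u "s @ t" "length (u @ [a, b] @ s) + length t"] by simp
  also have "word (s @ t) = word s * word t" by (simp add: single_mult)
  also have "word u * braiding a b * (word s * word t) = R_matrix (length w) i (word w) * word t"
    unfolding i w(1) using R_matrix_single[of u s "length (u @ [a, b] @ s)"] by (simp add: mult.assoc)
  finally show ?thesis .
qed

lemma R_matrix_mult:
  assumes "0 < i" "i < m" "y \<in> tensor_power m" "z \<in> tensor_power n"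
  shows "R_matrix (m + n) i (y * z) = R_matrix m i y * z"
  using assms(4)
proof (induction rule: tensor_power_induct)
  case (single t d)
  show ?case
    using assms(3)
  proof (induction rule: tensor_power_induct)
    case (single w c)
    have "R_matrix (m + n) i (Poly_Mapping.single w c * Poly_Mapping.single t d) = sc (c * d) * R_matrix (m + n) i (word (w @ t))"
      using single \<open>length t = n\<close> by (subst R_matrix_sc[symmetric]) (simp_all add: single_mult tensor_power_single)
    also have "\<dots> = (sc c * R_matrix m i (word w)) * (sc d * word t)"
      using R_matrix_word_mult[of i w t] single \<open>length t = n\<close> assms(1,2)
      by (simp add: mult.assoc sc_left_comm[of "R_matrix m i (word w)"] sc_sc)
    also have "\<dots> = R_matrix m i (Poly_Mapping.single w c) * Poly_Mapping.single t d"
      using single by (subst R_matrix_sc[symmetric]) (simp_all add: single_mult tensor_power_single)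
    finally show ?case .
  next
    case (add u v)
    have "Poly_Mapping.single t d \<in> tensor_power n" using \<open>length t = n\<close> by (rule tensor_power_single)
    then have "u * Poly_Mapping.single t d \<in> tensor_power (m + n)" "v * Poly_Mapping.single t d \<in> tensor_power (m + n)"
      using add(1,2) tensor_power_mult by blast+
    then show ?case using add(3,4) by (simp only: distrib_right R_matrix_add add(1,2))
  qed (simp add: R_matrix_0)
next
  case (add u v)
  then have "y * u \<in> tensor_power (m + n)" "y * v \<in> tensor_power (m + n)"
    using assms(3) tensor_power_mult by blast+
  then show ?case using add(3,4) by (simp only: distrib_left R_matrix_add)
qed (simp add: R_matrix_0)

lemma R_matrix_tensor_power:
  assumes "0 < i" "i < r" "v \<in> tensor_power r" shows "R_matrix r i v \<in> tensor_power r"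
  using assms(3)
proof (induction rule: tensor_power_induct)
  case (single w c)
  then obtain u a b t where w: "w = u @ [a, b] @ t" "length u = i - 1" using split_word[of i w] assms by auto
  have "word u * braiding a b * word t \<in> tensor_power (length u + 2 + length t)"
    using braiding_tensor_power by (intro tensor_power_mult tensor_power_single refl)
  moreover have i: "i = Suc (length u)" "length u + 2 + length t = r" using w single assms(1) by auto
  moreover have "R_matrix r i (Poly_Mapping.single w c) = sc c * R_matrix r i (word w)"
    using single by (subst R_matrix_sc[symmetric]) (simp_all add: single_mult tensor_power_single)
  ultimately show ?case unfolding w(1) i(1) R_matrix_single[OF i(2)] by (simp add: tensor_power_sc)
qed (simp_all add: R_matrix_0 R_matrix_add tensor_power_closed)

lemma R_matrix_word_mult_right:
  assumes "v \<in> tensor_power 2" "length u + 2 + length t = r"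
  shows "R_matrix r (Suc (length u)) (word u * v * word t) = word u * braiding2 v * word t"
  using assms(1)
proof (induction rule: tensor_power_induct)
  case (single w c)
  then obtain a b where w: "w = [a, b]" by (metis length_0_conv length_Suc_conv numeral_2_eq_2)
  have "R_matrix r (Suc (length u)) (word u * Poly_Mapping.single w c * word t)
      = sc c * R_matrix r (Suc (length u)) (word (u @ [a, b] @ t))"
    using assms(2) by (subst R_matrix_sc[symmetric]) (simp_all add: w single_mult tensor_power_single)
  also have "\<dots> = word u * (sc c * braiding a b) * word t"
    unfolding R_matrix_single[OF assms(2)] by (simp only: sc_left_comm[of "word u"] mult.assoc)
  finally show ?case by (simp add: w lin_single)
next
  case (add x y)
  have "word u * z * word t \<in> tensor_power r" if "z \<in> tensor_power 2" for z
    using tensor_power_mult[OF tensor_power_mult[OF tensor_power_single that]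
        tensor_power_single, OF refl refl, of u 1 t 1] assms(2) by simp
  then show ?case using add by (simp add: distrib_left distrib_right R_matrix_add lin_add)
qed (simp add: R_matrix_0)

text \<open>The invariants of the second and third tensor powers.\<close>

definition cup :: "vbasis ncpoly"
  where "cup = sc (q ^ 2 * qint 2) * letter Vp * letter Vm
    - sc (q ^ 2) * letter Vz * letter Vz + sc (qint 2) * letter Vm * letter Vp"

lemma cup_tensor_power: "cup \<in> tensor_power 2"
  by (simp add: cup_def single_mult tensor_power_closed)

definition alt3 :: "vbasis ncpoly"
  where "alt3 = sc (1 - q^2) * word [Vz, Vz, Vz] +
    sc (qint 2) * (sc (q^2) * word [Vp, Vz, Vm] - word [Vz, Vp, Vm] + word [Vm, Vp, Vz]
      - word [Vp, Vm, Vz] - sc (inverse q^2) * word [Vm, Vz, Vp] + word [Vz, Vm, Vp])"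

lemma alt3_tensor_power: "alt3 \<in> tensor_power 3"
  by (simp add: alt3_def single_mult right_diff_distrib distrib_left tensor_power_closed)

text \<open>Both generators act by the scalar that belongs to the antisymmetriser, so
  \<open>e 1\<close> and \<open>e 2\<close> kill \<open>alt3\<close> while \<open>alt\<close> does
  not: this vector tells \<open>alt\<close> from \<open>J 3\<close>.\<close>

lemma R_matrix_alt3:
  "R_matrix 3 1 alt3 = sc (- (inverse q^2)) * alt3" "R_matrix 3 2 alt3 = sc (- (inverse q^2)) * alt3"
proof -
  have *: "R_matrix 3 i alt3 =
    lin (\<lambda>w. word (take (i - 1) w) * braiding (w ! (i - 1)) (w ! i) * word (drop (i + 1) w)) alt3" for i
    by (simp add: R_matrix_def alt3_tensor_power)
  show "R_matrix 3 1 alt3 = sc (- (inverse q^2)) * alt3" "R_matrix 3 2 alt3 = sc (- (inverse q^2)) * alt3"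
    unfolding * unfolding alt3_def
    by (rule poly_mapping_eqI; auto simp: tensor2_simps one_plus_q_q field_simps eval_nat_numeral)+
qed

section \<open>Faithfulness on tensor space\<close>

text \<open>Only the action of the \<open>g i\<close> is prescribed; that of the \<open>e i\<close>
  follows through \<open>e_of_g\<close>. All laws are limited to the tensor power, outside of which
  \<open>\<rho>\<close> is arbitrary.\<close>

locale bmw_rep = bmw_quotient scale g h e r
  for scale :: "qfield \<Rightarrow> 'a::{ring,monoid_mult} \<Rightarrow> 'a" (infixr "*s" 75) and g h e r +
  fixes \<rho> :: "'a \<Rightarrow> vbasis ncpoly \<Rightarrow> vbasis ncpoly"
  assumes rho_add: "v \<in> tensor_power r \<Longrightarrow> \<rho> (x + y) v = \<rho> x v + \<rho> y v"
    and rho_scale: "v \<in> tensor_power r \<Longrightarrow> \<rho> (a *s x) v = sc a * \<rho> x v"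
    and rho_mult: "v \<in> tensor_power r \<Longrightarrow> \<rho> (x * y) v = \<rho> x (\<rho> y v)"
    and rho_one: "v \<in> tensor_power r \<Longrightarrow> \<rho> 1 v = v"
    and rho_add_right: "u \<in> tensor_power r \<Longrightarrow> v \<in> tensor_power r \<Longrightarrow> \<rho> x (u + v) = \<rho> x u + \<rho> x v"
    and rho_sc: "v \<in> tensor_power r \<Longrightarrow> \<rho> x (sc a * v) = sc a * \<rho> x v"
    and rho_TP: "v \<in> tensor_power r \<Longrightarrow> \<rho> x v \<in> tensor_power r"
    and rho_g: "0 < i \<and> i < r \<Longrightarrow> v \<in> tensor_power r \<Longrightarrow> \<rho> (g i) v = R_matrix r i v"
begin

abbreviation TP :: "vbasis ncpoly set" where "TP \<equiv> tensor_power r"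

lemma rho_diff: assumes "v \<in> TP" shows "\<rho> (x - y) v = \<rho> x v - \<rho> y v"
proof -
  have "\<rho> (x - y + y) v = \<rho> (x - y) v + \<rho> y v" using assms by (rule rho_add)
  then show ?thesis by simp
qed

lemma rho_zero: "v \<in> TP \<Longrightarrow> \<rho> 0 v = 0"
  using rho_diff[of v 0 0] by simp

lemma rho_right_zero: "\<rho> x 0 = 0"
  using rho_sc[of 0 x 0] by (simp add: tensor_power_zero)

lemma rho_diff_right: assumes "u \<in> TP" "v \<in> TP" shows "\<rho> x (u - v) = \<rho> x u - \<rho> x v"
proof -
  have "\<rho> x (u - v + v) = \<rho> x (u - v) + \<rho> x v" using assms by (intro rho_add_right tensor_power_diff)
  then show ?thesis by simp
qed

lemma rho_sum: "v \<in> TP \<Longrightarrow> \<rho> (\<Sum>i\<in>B. x i) v = (\<Sum>i\<in>B. \<rho> (x i) v)"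
  by (induction B rule: infinite_finite_induct) (simp_all add: rho_zero rho_add)

definition ker :: "'a \<Rightarrow> bool" where "ker x \<longleftrightarrow> (\<forall>v\<in>TP. \<rho> x v = 0)"

lemma ker_mult: assumes "ker x" shows "ker (y * x * z)"
  unfolding ker_def
proof
  fix v assume v: "v \<in> TP"
  have "\<rho> (y * x * z) v = \<rho> y (\<rho> x (\<rho> z v))" using v by (simp add: rho_mult rho_TP)
  then show "\<rho> (y * x * z) v = 0" using assms v rho_TP unfolding ker_def by (simp add: rho_right_zero)
qed

text \<open>Unlike the skein relation this expresses \<open>e i\<close> without \<open>h i\<close>,
  hence through operators whose action is known.\<close>

lemma e_of_g: assumes "ok i" shows "e i = (q^4 * inverse k) *s (1 + k *s g i - g i * g i)"
proof -
  have "1 + k *s g i - g i * g i = (k * inverse q^4) *s e i" unfolding gsq[OF assms] by simp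
  moreover have "q^4 * inverse K * (K * inverse q^4) = 1" if "K \<noteq> 0" for K
    using that by (simp add: field_simps)
  note this[OF q_scalars_nonzero(1)]
  ultimately show ?thesis by (simp only: scale_scale scale_one)
qed

lemma rho_e:
  assumes "ok i" "v \<in> TP"
  shows "\<rho> (e i) v = sc (q^4 * inverse k) * (v + sc k * \<rho> (g i) v - \<rho> (g i) (\<rho> (g i) v))"
  unfolding e_of_g[OF assms(1)] using assms(2) by (simp only: rho_scale rho_diff rho_add rho_one rho_mult)

lemma rho_f:
  assumes "v \<in> TP"
  shows "\<rho> (f i) v = sc (q^2) * v - \<rho> (g i) v - sc (1 - inverse q^2) * \<rho> (e i) v"
  using assms by (simp only: f_def rho_diff rho_scale rho_one)

lemma sc_linear_comb: "v + sc a * (sc b * v) - sc c' * (sc d * v) = sc (1 + a * b - c' * d) * v"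
proof -
  have "sc (1 + a * b - c' * d) * v = (sc 1 + sc (a * b) - sc (c' * d)) * v"
    by (simp only: single_add single_diff)
  then show ?thesis by (simp only: left_diff_distrib distrib_right sc_sc sc_1 mult_1_left)
qed

lemma rho_e_eigen:
  assumes "ok i" "v \<in> TP" "\<rho> (g i) v = sc t * v"
  shows "\<rho> (e i) v = sc (q^4 * inverse k * (1 + k * t - t * t)) * v"
proof -
  have "\<rho> (e i) v = sc (q^4 * inverse k) * (v + sc k * (sc t * v) - sc t * (sc t * v))"
    using assms(2) by (simp only: rho_e[OF assms(1,2)] assms(3) rho_sc)
  then show ?thesis by (simp only: sc_linear_comb) (simp only: sc_sc)
qed

lemma rho_e_alt:
  assumes "ok i" "v \<in> TP" "\<rho> (g i) v = sc (- (inverse q^2)) * v"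
  shows "\<rho> (e i) v = 0"
proof -
  have "1 + k * (- (inverse q^2)) - (- (inverse q^2)) * (- (inverse q^2)) = 0"
    by (simp add: field_simps eval_nat_numeral)
  then show ?thesis using rho_e_eigen[OF assms] by (simp only:) simp
qed

lemma rho_f_alt:
  assumes "ok i" "v \<in> TP" "\<rho> (g i) v = sc (- (inverse q^2)) * v"
  shows "\<rho> (f i) v = sc c * v"
proof -
  have "\<rho> (f i) v = sc (q^2) * v - sc (- (inverse q^2)) * v"
    using assms rho_e_alt[OF assms] by (simp add: rho_f)
  also have "\<dots> = (sc (q^2) - sc (- (inverse q^2))) * v" by (simp only: left_diff_distrib)
  finally show ?thesis by (simp flip: single_diff)
qed

text \<open>Applied to the span of the vectors of weight \<open>2 r - 2\<close> and to the line of
  \<open>alt3\<close> padded to length \<open>r\<close>.\<close>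

lemma J_kills:
  assumes n: "n \<le> r"
    and X: "X \<subseteq> TP" "\<And>u v. u \<in> X \<Longrightarrow> v \<in> X \<Longrightarrow> u + v \<in> X" "\<And>t v. v \<in> X \<Longrightarrow> sc t * v \<in> X"
    and g: "\<And>i v. 0 < i \<Longrightarrow> i < n \<Longrightarrow> v \<in> X \<Longrightarrow> \<rho> (g i) v \<in> X"
    and e: "\<And>i v. 0 < i \<Longrightarrow> i < n \<Longrightarrow> v \<in> X \<Longrightarrow> \<rho> (e i) v = 0"
    and y: "y \<in> J n" and v: "v \<in> X"
  shows "\<rho> y v = 0"
proof -
  have A: "\<rho> x v \<in> X" if "x \<in> A n" for x
    using that
  proof (induction rule: A.induct)
    case (A_e_mult i x)
    then have "\<rho> (e i * x) v = sc 0 * v" using X(1) v e by (simp add: rho_mult subsetD)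
    then show ?case using X(3)[OF v, of 0] by simp
  qed (use X v g in \<open>auto simp: rho_one rho_add rho_scale rho_mult\<close>)
  show ?thesis
    using y
  proof (induction rule: J.induct)
    case (J_base i a b)
    have vb: "\<rho> b v \<in> X" "v \<in> TP" "\<rho> b v \<in> TP" using A J_base X(1) v by auto
    then have "\<rho> (a * e i * b) v = \<rho> a (\<rho> (e i) (\<rho> b v))" by (simp add: rho_mult)
    then show ?case using e J_base vb by (simp add: rho_right_zero)
  qed (use X(1) v in \<open>auto simp: rho_zero rho_add rho_scale\<close>)
qed

text \<open>Elements of \<open>A m\<close> touch the first \<open>m\<close> factors only. The value
  \<open>y\<close> is merely asserted to exist, uniformly in \<open>z\<close>, which avoids building
  an action of \<open>A m\<close> on the smaller tensor power.\<close>

lemma rho_left: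
  assumes "x \<in> A m" "m \<le> r" "u \<in> tensor_power m"
  shows "\<exists>y\<in>tensor_power m. \<forall>z\<in>tensor_power (r - m). \<rho> x (u * z) = y * z"
proof -
  have TP: "y * z \<in> TP" if "y \<in> tensor_power m" "z \<in> tensor_power (r - m)" for y z
    using tensor_power_mult[OF that] assms(2) by simp
  let ?P = "\<lambda>x. \<exists>y\<in>tensor_power m. \<forall>z\<in>tensor_power (r - m). \<rho> x (u * z) = y * z"
  have g: "\<rho> (g i) (y * z) = R_matrix m i y * z"
    if "0 < i" "i < m" "y \<in> tensor_power m" "z \<in> tensor_power (r - m)" for i y z
    using that TP R_matrix_mult[OF that] assms(2) by (simp add: rho_g)
  have add: "?P (x + x')" if xx: "?P x" "?P x'" for x x'
  proof -
    obtain y y' where "y \<in> tensor_power m" "\<forall>z\<in>tensor_power (r - m). \<rho> x (u * z) = y * z"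
      "y' \<in> tensor_power m" "\<forall>z\<in>tensor_power (r - m). \<rho> x' (u * z) = y' * z" using xx by blast
    then show ?thesis using TP assms(3)
      by (intro bexI[of _ "y + y'"] ballI) (simp_all add: rho_add distrib_right tensor_power_add)
  qed
  have scl: "?P (t *s x)" if xx: "?P x" for t x
  proof -
    obtain y where "y \<in> tensor_power m" "\<forall>z\<in>tensor_power (r - m). \<rho> x (u * z) = y * z" using xx by blast
    then show ?thesis using TP assms(3)
      by (intro bexI[of _ "sc t * y"] ballI) (simp_all add: rho_scale mult.assoc tensor_power_sc)
  qed
  have gm: "?P (g i * x)" if xx: "?P x" "0 < i" "i < m" for i x
  proof -
    obtain y where "y \<in> tensor_power m" "\<forall>z\<in>tensor_power (r - m). \<rho> x (u * z) = y * z" using xx by blast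
    then show ?thesis using TP assms(3) xx g
      by (intro bexI[of _ "R_matrix m i y"] ballI) (simp_all add: rho_mult R_matrix_tensor_power)
  qed
  from assms(1) show ?thesis
  proof (induction rule: A.induct)
    case A_one
    then show ?case using assms(3) TP by (intro bexI[of _ u] ballI) (simp_all add: rho_one)
  next
    case (A_e_mult i x)
    \<comment> \<open>Reduces \<open>e i\<close> to \<open>g i\<close>, for which locality is
      already settled in \<open>gm\<close>.\<close>
    have "e i * x = (q^4 * inverse k) *s (x + k *s (g i * x) + (-1) *s (g i * (g i * x)))"
    proof -
      have ei: "e i = (q^4 * inverse k) *s (1 + k *s g i - g i * g i)"
        by (rule e_of_g) (use A_e_mult assms(2) in simp)
      have "e i * x = (q^4 * inverse k) *s ((1 + k *s g i - g i * g i) * x)"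
        by (simp only: ei scale_mult)
      then show ?thesis by (simp add: distrib_right left_diff_distrib scale_mult mult.assoc)
    qed
    moreover have "?P ((q^4 * inverse k) *s (x + k *s (g i * x) + (-1) *s (g i * (g i * x))))"
      by (intro scl add gm A_e_mult)
    ultimately show ?case by simp
  qed (use add scl gm in blast)+
qed

text \<open>A cup has eigenvalue \<open>inverse q^4\<close> under \<open>g i\<close>, for which the
  formula of \<open>rho_e_eigen\<close> evaluates to \<open>[3]_q\<close>.\<close>

lemma rho_cup:
  assumes "length u + 2 + length t = r"
  shows "\<exists>s. s \<noteq> 0 \<and> \<rho> (e (Suc (length u))) (word u * cup * word t) = sc s * (word u * cup * word t)"
proof -
  let ?v = "word u * cup * word t" and ?i = "Suc (length u)"
  have TP: "?v \<in> TP"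
    using tensor_power_mult[OF tensor_power_mult[OF tensor_power_single cup_tensor_power]
        tensor_power_single, OF refl refl, of u 1 t 1] assms by simp
  have "\<rho> (g ?i) ?v = word u * braiding2 cup * word t"
    using R_matrix_word_mult_right[OF cup_tensor_power assms] TP assms by (simp add: rho_g)
  also have "braiding2 cup = sc (q powi -4) * cup" unfolding cup_def by (rule braiding2_weight_0(3))
  also have "word u * (sc (q powi -4) * cup) * word t = sc (inverse q^4) * ?v"
    by (simp add: sc_left_comm[of "word u"] mult.assoc power_int_minus power_inverse)
  finally have "\<rho> (e ?i) ?v = sc (q^4 * inverse k * (1 + k * inverse q^4 - inverse q^4 * inverse q^4)) * ?v"
    using assms TP by (intro rho_e_eigen) auto
  moreover have "1 + k * inverse q^4 - inverse q^4 * inverse q^4 = inverse q^4 * k * (q^2 + 1 + inverse q^2)"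
    by (simp add: field_simps eval_nat_numeral)
  moreover have "q^4 * inverse k * (inverse q^4 * k * (q^2 + 1 + inverse q^2)) \<noteq> 0"
    using q_scalars_nonzero by simp
  ultimately show ?thesis by metis
qed

lemma ker_word: assumes "\<And>w. length w = r \<Longrightarrow> \<rho> x (word w) = 0" shows "ker x"
  unfolding ker_def
proof
  fix v assume "v \<in> TP"
  then show "\<rho> x v = 0"
  proof (induction rule: tensor_power_induct)
    case (single w a)
    then have "\<rho> x (sc a * word w) = sc a * \<rho> x (word w)" by (intro rho_sc tensor_power_single)
    then show ?case using assms single by (simp add: single_mult)
  qed (simp_all add: rho_right_zero rho_add_right)
qed

text \<open>Put a cup at the factors \<open>n + 1\<close> and \<open>n + 2\<close>. There
  \<open>e (Suc n)\<close> is a nonzero scalar, while \<open>b\<close> acts on the first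
  \<open>n\<close> factors and keeps the cup as a tensor factor; cancelling the cup shows that
  \<open>b\<close> vanishes on them.\<close>

lemma ker_cancel_e:
  assumes n: "Suc n < r" and b: "b \<in> A n" and ker: "ker (b * e (Suc n))"
  shows "ker b"
proof (rule ker_word)
  fix w :: "vbasis list" assume w: "length w = r"
  define u where "u = take n w"
  have u: "length u = n" using w n by (simp add: u_def)
  obtain y where y: "y \<in> tensor_power n" "\<And>z. z \<in> tensor_power (r - n) \<Longrightarrow> \<rho> b (word u * z) = y * z"
    using rho_left[OF b, of "word u"] n u by (auto simp: tensor_power_single)
  \<comment> \<open>A filler for the remaining factors; any word of this length would serve.\<close>
  define t where "t = replicate (r - n - 2) Vp"
  have len: "length u + 2 + length t = r" using u n by (simp add: t_def)
  let ?v = "word u * cup * word t"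
  have ct: "cup * word t \<in> tensor_power (r - n)"
  proof -
    have "r - n = 2 + length t" using len u by simp
    then show ?thesis using tensor_power_mult[OF cup_tensor_power tensor_power_single, OF refl, of t 1] by simp
  qed
  have TP: "?v \<in> TP"
    using tensor_power_mult[OF tensor_power_single ct, OF refl, of u 1] u n by (simp add: mult.assoc)
  obtain s where s: "s \<noteq> 0" "\<rho> (e (Suc n)) ?v = sc s * ?v" using rho_cup[OF len] u by auto
  have "sc s * \<rho> b ?v = \<rho> (b * e (Suc n)) ?v" using TP s(2) by (simp add: rho_mult rho_sc)
  also have "\<dots> = 0" using ker TP unfolding ker_def by blast
  finally have "sc (inverse s) * (sc s * \<rho> b ?v) = 0" by simp
  then have "\<rho> b ?v = 0" using s(1) by (simp add: sc_sc sc_1)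
  then have "y * (cup * word t) = 0" using y(2)[OF ct] by (simp add: mult.assoc)
  then have "Poly_Mapping.lookup (y * (cup * word t)) (u' @ ([Vz, Vz] @ t)) = 0" for u' by simp
  \<comment> \<open>One nonzero coefficient of the cup is enough to read off all coefficients of
    \<open>y\<close>.\<close>
  moreover have "Poly_Mapping.lookup cup [Vz, Vz] = - (q^2)"
    by (simp add: cup_def single_mult lookup_add lookup_minus lookup_single)
  then have "Poly_Mapping.lookup (cup * word t) ([Vz, Vz] @ t) = - (q^2)"
    using lookup_tensor[OF cup_tensor_power, of "[Vz, Vz]" "word t" t] by simp
  ultimately have y0: "Poly_Mapping.lookup y u' = 0" if "length u' = n" for u'
    using lookup_tensor[OF y(1) that, of "cup * word t" "[Vz, Vz] @ t"] by simp
  have "y = 0"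
  proof (rule poly_mapping_eqI)
    fix u' show "Poly_Mapping.lookup y u' = Poly_Mapping.lookup 0 u'"
      using y0 y(1) by (cases "length u' = n") (auto simp: tensor_power_def in_keys_iff)
  qed
  have "word w = word u * word (drop n w)" by (simp add: u_def single_mult)
  then show "\<rho> b (word w) = 0"
    using y(2)[of "word (drop n w)"] w \<open>y = 0\<close> by (simp add: tensor_power_single)
qed

lemma ker_scalar: assumes "ker (a *s 1)" shows "a = 0"
proof -
  let ?w = "replicate r Vp"
  have "\<rho> (a *s 1) (word ?w) = sc a * word ?w" by (simp add: rho_scale rho_one tensor_power_single)
  then have "sc a * word ?w = 0" using assms unfolding ker_def by (simp add: tensor_power_single)
  then have "Poly_Mapping.lookup (Poly_Mapping.single ?w a) ?w = 0" by (simp add: single_mult)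
  then show ?thesis by simp
qed

text \<open>The vectors of weight \<open>2 r - 2\<close>. The \<open>e i\<close> vanish on them and \<open>f i\<close> has rank one.\<close>

definition W :: "nat \<Rightarrow> vbasis list" where "W a = replicate a Vp @ Vz # replicate (r - 1 - a) Vp"

definition wv :: "nat \<Rightarrow> vbasis ncpoly" where "wv a = word (W a)"

lemma W_inj: assumes "a < r" "b < r" shows "W a = W b \<longleftrightarrow> a = b"
proof
  assume "W a = W b"
  moreover have "W a ! a = Vz" by (simp add: W_def nth_append)
  moreover have "W b ! a = Vp" if "a \<noteq> b"
    using that assms by (auto simp: W_def nth_append nth_Cons split: nat.split)
  ultimately show "a = b" by auto
qed simp

lemma wv_TP: "a < r \<Longrightarrow> wv a \<in> TP"
  by (auto simp: wv_def W_def intro: tensor_power_single)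

lemma R_word:
  assumes "ok i" "w = u @ [a, b] @ t" "i = Suc (length u)" "length w = r"
  shows "\<rho> (g i) (word w) = word u * braiding a b * word t"
proof -
  have "word w \<in> TP" using assms by (intro tensor_power_single) simp
  then have "\<rho> (g i) (word w) = R_matrix r i (word w)" using assms(1) by (simp add: rho_g)
  then show ?thesis using R_matrix_single[of u t r a b] assms by simp
qed

lemma rho_g_wv:
  assumes "ok i" "a < r"
  shows "\<rho> (g i) (wv a) = (if i = Suc a then wv i + sc k * wv a else if i = a then wv (i - 1) else sc (q^2) * wv a)"
proof -
  have len: "length (W a) = r" using assms by (simp add: W_def)
  consider "i = Suc a" | "i = a" | "i < a" | "Suc a < i" by linarith
  then show ?thesis
  proof cases
    case 1
    then have "W a = replicate a Vp @ [Vz, Vp] @ replicate (r - 2 - a) Vp"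
      using assms by (cases "r - 1 - a") (auto simp: W_def)
    from R_word[OF assms(1) this] have "\<rho> (g i) (wv a) = word (replicate a Vp) * braiding Vz Vp * word (replicate (r - 2 - a) Vp)"
      using 1 len by (simp add: wv_def)
    moreover have "(q - inverse q) * qint 2 = k" by (simp add: qint_2 algebra_simps power2_eq_square)
    moreover have "wv i = word (replicate a Vp @ [Vp, Vz] @ replicate (r - 2 - a) Vp)"
      using 1 by (simp add: wv_def W_def replicate_app_Cons_same)
    ultimately show ?thesis
      using 1 \<open>W a = _\<close> by (simp add: braiding_table wv_def single_mult distrib_left distrib_right)
  next
    case 2
    then obtain m where m: "a = Suc m" using assms by (cases a) auto
    then have "W a = replicate m Vp @ [Vp, Vz] @ replicate (r - 1 - a) Vp"
      by (simp add: W_def replicate_app_Cons_same)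
    from R_word[OF assms(1) this] have "\<rho> (g i) (wv a) = word (replicate m Vp) * braiding Vp Vz * word (replicate (r - 1 - a) Vp)"
      using 2 m len by (simp add: wv_def)
    moreover have "W m = replicate m Vp @ [Vz, Vp] @ replicate (r - 1 - a) Vp"
      using 2 m assms by (cases "r - 1 - m") (auto simp: W_def)
    ultimately show ?thesis using 2 m by (simp add: braiding_table wv_def single_mult)
  next
    case 3
    have "replicate a Vp = replicate (i - 1) Vp @ [Vp, Vp] @ replicate (a - i - 1) Vp"
      using 3 assms by (simp add: replicate_add[symmetric] flip: replicate_Suc)
    then have W: "W a = replicate (i - 1) Vp @ [Vp, Vp] @ (replicate (a - i - 1) Vp @ Vz # replicate (r - 1 - a) Vp)"
      by (simp add: W_def)
    from R_word[OF assms(1) this] have "\<rho> (g i) (wv a) = word (replicate (i - 1) Vp) * braiding Vp Vp * word (replicate (a - i - 1) Vp @ Vz # replicate (r - 1 - a) Vp)"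
      using 3 assms len by (simp add: wv_def)
    also have "\<dots> = sc (q^2) * word (W a)" unfolding W by (simp add: braiding_table single_mult)
    finally show ?thesis using 3 by (simp add: wv_def)
  next
    case 4
    have "replicate (r - 1 - a) Vp = replicate (i - 2 - a) Vp @ [Vp, Vp] @ replicate (r - 1 - i) Vp"
      using 4 assms by (simp add: replicate_add[symmetric] flip: replicate_Suc)
    then have W: "W a = (replicate a Vp @ Vz # replicate (i - 2 - a) Vp) @ [Vp, Vp] @ replicate (r - 1 - i) Vp"
      by (simp add: W_def)
    from R_word[OF assms(1) this] have "\<rho> (g i) (wv a) = word (replicate a Vp @ Vz # replicate (i - 2 - a) Vp) * braiding Vp Vp * word (replicate (r - 1 - i) Vp)"
      using 4 assms len by (simp add: wv_def)
    also have "\<dots> = sc (q^2) * word (W a)" unfolding W by (simp add: braiding_table single_mult)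
    finally show ?thesis using 4 by (simp add: wv_def)
  qed
qed

text \<open>On the vectors \<open>wv a\<close>, \<open>f i\<close> is the rank one matrix with
  column \<open>uv i\<close> and row \<open>phi i\<close>.\<close>

definition phi :: "nat \<Rightarrow> nat \<Rightarrow> qfield"
  where "phi i a = (if i = Suc a then 1 else if i = a then - (q^2) else 0)"

definition uv :: "nat \<Rightarrow> vbasis ncpoly" where "uv i = sc (inverse q^2) * wv (i - 1) - wv i"

lemma rho_e_wv: assumes "ok i" "a < r" shows "\<rho> (e i) (wv a) = 0"
proof -
  have "wv a + sc k * \<rho> (g i) (wv a) - \<rho> (g i) (\<rho> (g i) (wv a)) = 0"
  proof (cases "i = Suc a \<or> i = a")
    case True
    then consider "i = Suc a" | "i = a" by blast
    then show ?thesis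
    proof cases
      case 1
      then have "\<rho> (g i) (wv i + sc k * wv a) = wv a + sc k * (wv i + sc k * wv a)"
        using assms by (simp add: rho_add_right rho_sc wv_TP tensor_power_sc rho_g_wv)
      then show ?thesis using 1 assms by (simp add: rho_g_wv)
    next
      case 2
      then have "\<rho> (g i) (wv (i - 1)) = wv i + sc k * wv (i - 1)"
        using assms by (simp add: rho_g_wv)
      then show ?thesis using 2 assms by (simp add: rho_g_wv)
    qed
  next
    case False
    then have g: "\<rho> (g i) (wv a) = sc (q^2) * wv a" using assms by (simp add: rho_g_wv)
    have "wv a + sc k * (sc (q^2) * wv a) - sc (q^2) * (sc (q^2) * wv a) = sc (1 + k * q^2 - q^2 * q^2) * wv a"
      by (rule sc_linear_comb)
    also have "1 + k * q^2 - q^2 * q^2 = 0" by (simp add: field_simps)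
    finally show ?thesis using assms by (simp only: g rho_sc wv_TP) simp
  qed
  then show ?thesis using assms by (simp only: rho_e wv_TP) simp
qed

lemma rho_f_wv: assumes "ok i" "a < r" shows "\<rho> (f i) (wv a) = sc (phi i a) * uv i"
proof -
  have f: "\<rho> (f i) (wv a) = sc (q^2) * wv a - \<rho> (g i) (wv a)"
    using assms by (simp add: rho_f wv_TP rho_e_wv)
  consider "i = Suc a" | "i = a" | "i \<noteq> Suc a" "i \<noteq> a" by blast
  then show ?thesis
  proof cases
    case 1
    have "sc (q^2) * wv a - (wv i + sc k * wv a) = (sc (q^2) - sc k) * wv a - wv i" by (simp add: left_diff_distrib)
    also have "sc (q^2) - sc k = (sc (inverse q^2) :: vbasis ncpoly)" by (simp flip: single_diff)
    finally show ?thesis using 1 assms f by (simp add: rho_g_wv phi_def uv_def sc_1)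
  next
    case 2
    have "sc (- (q^2)) * uv i = sc (- (q^2)) * (sc (inverse q^2) * wv (i - 1)) - sc (- (q^2)) * wv i"
      by (simp add: uv_def right_diff_distrib)
    also have "sc (- (q^2)) * (sc (inverse q^2) * wv (i - 1)) = sc (-1) * wv (i - 1)"
      unfolding sc_sc by (simp add: field_simps)
    also have "sc (-1) * wv (i - 1) - sc (- (q^2)) * wv i = sc (q^2) * wv i - wv (i - 1)"
      by (simp add: single_uminus sc_1)
    finally show ?thesis using 2 assms f by (simp add: rho_g_wv phi_def)
  next
    case 3
    then show ?thesis using assms f by (simp add: rho_g_wv phi_def)
  qed
qed

lemma uv_TP: "ok i \<Longrightarrow> uv i \<in> TP"
  by (auto simp: uv_def intro!: tensor_power_diff tensor_power_sc wv_TP)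

text \<open>The row \<open>phi i\<close> pairs to \<open>-1\<close> with the column
  \<open>uv j\<close> of either neighbour. Hence \<open>f i * f j * f i\<close> and
  \<open>f i\<close> agree on these vectors, and hence the signs in \<open>rho_F\<close>.\<close>

lemma rho_f_uv: assumes "ok i" "ok j" "adj i j" shows "\<rho> (f i) (uv j) = - uv i"
proof -
  have "\<rho> (f i) (uv j) = sc (inverse q^2) * (sc (phi i (j - 1)) * uv i) - sc (phi i j) * uv i"
    using assms unfolding uv_def[of j]
    by (subst rho_diff_right) (auto simp: tensor_power_sc wv_TP rho_sc rho_f_wv)
  also have "\<dots> = (sc (inverse q^2 * phi i (j - 1)) - sc (phi i j)) * uv i"
    by (simp only: left_diff_distrib sc_sc)
  also have "\<dots> = sc (inverse q^2 * phi i (j - 1) - phi i j) * uv i" by (simp only: single_diff)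
  also have "inverse q^2 * phi i (j - 1) - phi i j = -1"
    using assms by (auto simp: phi_def power_inverse)
  finally show ?thesis by (simp add: single_uminus sc_1)
qed

text \<open>On natural numbers one of \<open>i - j\<close> and \<open>j - i\<close> is zero, so the
  exponent is the distance of \<open>i\<close> and \<open>j\<close>, the number of neighbour
  steps.\<close>

lemma rho_F:
  assumes i: "ok i" and j: "ok j" and a: "a < r"
  shows "\<rho> (F i j) (wv a) = sc ((-1) ^ (i - j + (j - i)) * phi j a) * uv i"
proof -
  have f_step: "\<rho> (f i' * x) (wv a) = sc (- s) * uv i'"
    if "ok i'" "ok i''" "adj i' i''" "\<rho> x (wv a) = sc s * uv i''" for i' i'' x s
    using that a rho_f_uv[of i' i''] by (simp add: rho_mult wv_TP rho_sc uv_TP single_uminus)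
  show ?thesis
  proof (cases "i \<le> j")
    case True
    then show ?thesis
    proof (induction rule: inc_induct)
      case base
      show ?case using rho_f_wv[OF j a] by (simp add: F_same)
    next
      case (step m)
      have "\<rho> (f m * F (Suc m) j) (wv a) = sc (- ((-1) ^ (Suc m - j + (j - Suc m)) * phi j a)) * uv m"
        using step i j by (intro f_step[of m "Suc m"]) auto
      moreover have "Suc m - j + (j - Suc m) = j - Suc m" "m - j + (j - m) = Suc (j - Suc m)"
        using step by auto
      ultimately show ?case using step by (simp add: F_up)
    qed
  next
    case False
    then have "j \<le> i" by simp
    then show ?thesis
    proof (induction rule: dec_induct)
      case base
      show ?case using rho_f_wv[OF j a] by (simp add: F_same)
    next
      case (step m)
      have "\<rho> (f (Suc m) * F m j) (wv a) = sc (- ((-1) ^ (m - j + (j - m)) * phi j a)) * uv (Suc m)"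
        using step i j by (intro f_step[of "Suc m" m]) auto
      moreover have "m - j + (j - m) = m - j" "Suc m - j + (j - Suc m) = Suc (m - j)"
        using step by auto
      ultimately show ?case using step by (simp add: F_down)
    qed
  qed
qed

text \<open>Independence of the identity and the rank one matrices on \<open>n\<close> coordinates:
  \<open>n - 1\<close> columns \<open>uv i\<close> cannot make up the identity. Here
  \<open>\<beta>\<close> holds the coefficients with the signs of \<open>rho_F\<close>,
  \<open>s i p\<close> is the resulting coefficient of \<open>uv i\<close> in the image of
  \<open>wv p\<close>, and \<open>eq\<close> is the matrix entry at row \<open>l\<close> and column
  \<open>p\<close>.\<close>

lemma F_coeffs_zero:
  fixes \<beta> :: "nat \<Rightarrow> nat \<Rightarrow> qfield"
  assumes n: "0 < n" and out: "\<And>i j. i \<notin> {1..<n} \<or> j \<notin> {1..<n} \<Longrightarrow> \<beta> i j = 0"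
    and s: "\<And>i p. s i p = \<beta> i (Suc p) - q^2 * \<beta> i p"
    and eq: "\<And>l p. l < n \<Longrightarrow> p < n \<Longrightarrow> (if l = p then a else 0) + inverse q^2 * s (Suc l) p - s l p = 0"
  shows "a = 0" "\<beta> i j = 0"
proof -
  have step: "s (Suc l) p = q^2 * (s l p - (if l = p then a else 0))" if "l < n" "p < n" for l p
  proof -
    have "inverse q^2 * s (Suc l) p = s l p - (if l = p then a else 0)"
      using eq[OF that] by (metis add_diff_cancel_left' eq_iff_diff_eq_0)
    then have "q^2 * (inverse q^2 * s (Suc l) p) = q^2 * (s l p - (if l = p then a else 0))" by (rule arg_cong)
    moreover have "q^2 * (inverse q^2 * s (Suc l) p) = s (Suc l) p" by (simp add: power_inverse)
    ultimately show ?thesis by (rule trans[OF sym, rotated])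
  qed
  have s0: "s 0 p = 0" "s n p = 0" for p using out[of 0] out[of n] by (simp_all add: s)
  \<comment> \<open>In the last column the recursion starts at zero and stays there up to the
    diagonal; one further step gives \<open>s n (n - 1) = - (q^2) * a\<close>, which is zero as
    well.\<close>
  have sn: "s l (n - 1) = 0" if "l \<le> n - 1" for l
    using that
  proof (induction l)
    case (Suc l)
    then show ?case using step[of l "n - 1"] by simp
  qed (simp add: s0)
  then show a: "a = 0" using step[of "n - 1" "n - 1"] n s0(2)[of "n - 1"] by simp
  have sl: "s l p = 0" if "l \<le> n" "p < n" for l p
    using that
  proof (induction l)
    case (Suc l)
    then show ?case using step[of l p] a by simp
  qed (simp add: s0)
  have "\<beta> i j = 0" if "i < n" "j \<le> n" for i j
    using that(2)
  proof (induction j)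
    case (Suc j)
    then show ?case using sl[of i j] that(1) by (simp add: s)
  qed (use out[of i 0] in simp)
  then show "\<beta> i j = 0" using out[of i j] by (cases "i < n \<and> j \<le> n") auto
qed

lemma lookup_sc: "Poly_Mapping.lookup (sc t * v) w = t * Poly_Mapping.lookup v w"
  by (induction v rule: ncpoly_induct) (simp_all add: single_mult lookup_single when_def distrib_left lookup_add)

lemma lookup_uv:
  assumes "ok i" "l < r"
  shows "Poly_Mapping.lookup (uv i) (W l) = (if i = Suc l then inverse q^2 else 0) - (if i = l then 1 else 0)"
proof -
  have "i - 1 < r" using assms by auto
  then show ?thesis using assms W_inj[of "i - 1" l] W_inj[of i l]
    by (auto simp: uv_def wv_def lookup_minus lookup_sc lookup_single when_def)
qed

lemma normal_form_kernel:
  assumes n: "0 < n" "n \<le> r" and x: "ker x"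
    and y: "\<And>l. l < r \<Longrightarrow> \<rho> (x - (a *s 1 + (\<Sum>i\<in>{1..<n}. \<Sum>j\<in>{1..<n}. b i j *s F i j))) (wv l) = 0"
  shows "a = 0" "i \<in> {1..<n} \<Longrightarrow> j \<in> {1..<n} \<Longrightarrow> b i j = 0"
proof -
  \<comment> \<open>Extension by zero turns the boundary rows and columns into ordinary cases of the
    recursion.\<close>
  define \<beta> where "\<beta> i j = (if i \<in> {1..<n} \<and> j \<in> {1..<n} then b i j * (-1) ^ (i - j + (j - i)) else 0)" for i j
  define s where "s i p = \<beta> i (Suc p) - q^2 * \<beta> i p" for i p
  have s': "s i p = (\<Sum>j\<in>{1..<n}. b i j * ((-1) ^ (i - j + (j - i)) * phi j p))" if "i \<in> {1..<n}" for i p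
  proof -
    have "(\<Sum>j\<in>{1..<n}. b i j * ((-1) ^ (i - j + (j - i)) * phi j p)) =
        (\<Sum>j\<in>{1..<n}. (if j = Suc p then \<beta> i j else 0) - (if j = p then q^2 * \<beta> i j else 0))"
      using that by (intro sum.cong) (auto simp: phi_def \<beta>_def)
    also have "\<dots> = s i p" unfolding s_def by (auto simp: sum_subtractf \<beta>_def)
    finally show ?thesis by simp
  qed
  have eq: "(if l = p then a else 0) + inverse q^2 * s (Suc l) p - s l p = 0" if "l < n" "p < n" for l p
  proof -
    have TP: "wv p \<in> TP" using that n by (intro wv_TP) simp
    let ?z = "a *s 1 + (\<Sum>i\<in>{1..<n}. \<Sum>j\<in>{1..<n}. b i j *s F i j)"
    have "\<rho> x (wv p) - \<rho> ?z (wv p) = 0" using y[of p] that n TP by (simp add: rho_diff)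
    then have "\<rho> ?z (wv p) = 0" using x TP by (simp add: ker_def)
    moreover have "\<rho> ?z (wv p) = sc a * wv p + (\<Sum>i\<in>{1..<n}. \<Sum>j\<in>{1..<n}. \<rho> (b i j *s F i j) (wv p))"
      using TP by (simp add: rho_add rho_scale rho_one rho_sum)
    moreover have "\<dots> = sc a * wv p + (\<Sum>i\<in>{1..<n}. \<Sum>j\<in>{1..<n}. sc (b i j * ((-1) ^ (i - j + (j - i)) * phi j p)) * uv i)"
      using TP that n rho_F[of _ _ p]
      by (intro arg_cong[of _ _ "\<lambda>x. sc a * wv p + x"] sum.cong refl) (simp add: rho_scale sc_sc)
    ultimately have "Poly_Mapping.lookup (sc a * wv p + (\<Sum>i\<in>{1..<n}. \<Sum>j\<in>{1..<n}.
        sc (b i j * ((-1) ^ (i - j + (j - i)) * phi j p)) * uv i)) (W l) = 0" by simp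
    moreover have "Poly_Mapping.lookup (sc a * wv p) (W l) = (if l = p then a else 0)"
      using that n W_inj[of p l] by (auto simp: lookup_sc wv_def lookup_single when_def)
    moreover have "Poly_Mapping.lookup (\<Sum>i\<in>{1..<n}. \<Sum>j\<in>{1..<n}.
        sc (b i j * ((-1) ^ (i - j + (j - i)) * phi j p)) * uv i) (W l)
        = (\<Sum>i\<in>{1..<n}. s i p * Poly_Mapping.lookup (uv i) (W l))"
      unfolding lookup_sum lookup_sc by (intro sum.cong refl) (simp add: s' sum_distrib_right)
    moreover have "\<dots> = (\<Sum>i\<in>{1..<n}. (if i = Suc l then inverse q^2 * s i p else 0) - (if i = l then s i p else 0))"
      using that n by (intro sum.cong refl) (auto simp: lookup_uv)
    moreover have "\<dots> = inverse q^2 * s (Suc l) p - s l p"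
      by (auto simp: sum_subtractf s_def \<beta>_def)
    ultimately have "(if l = p then a else 0) + (inverse q^2 * s (Suc l) p - s l p) = 0"
      by (simp only: lookup_add)
    then show ?thesis by (simp only: add_diff_eq)
  qed
  have out: "i \<notin> {1..<n} \<or> j \<notin> {1..<n} \<Longrightarrow> \<beta> i j = 0" for i j by (auto simp: \<beta>_def)
  show "a = 0" by (rule F_coeffs_zero(1)[OF n(1) out s_def eq])
  show "b i j = 0" if "i \<in> {1..<n}" "j \<in> {1..<n}"
    using F_coeffs_zero(2)[OF n(1) out s_def eq, of i j] that by (simp add: \<beta>_def)
qed

inductive_set Wspan :: "vbasis ncpoly set" where
  Wspan_wv: "a < r \<Longrightarrow> wv a \<in> Wspan"
| Wspan_add: "u \<in> Wspan \<Longrightarrow> v \<in> Wspan \<Longrightarrow> u + v \<in> Wspan"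
| Wspan_sc: "v \<in> Wspan \<Longrightarrow> sc t * v \<in> Wspan"

lemma Wspan_TP: "v \<in> Wspan \<Longrightarrow> v \<in> TP"
  by (induction rule: Wspan.induct) (auto intro: wv_TP tensor_power_add tensor_power_sc)

lemma J_wv: assumes "n \<le> r" "y \<in> J n" "l < r" shows "\<rho> y (wv l) = 0"
proof (rule J_kills[OF assms(1), of Wspan])
  show "\<rho> (g i) v \<in> Wspan" if "0 < i" "i < n" "v \<in> Wspan" for i v
    using that(3)
  proof (induction rule: Wspan.induct)
    case (Wspan_wv a)
    then show ?case using that assms(1) by (auto simp: rho_g_wv intro!: Wspan.intros)
  qed (auto simp: rho_add_right rho_sc Wspan_TP intro: Wspan.intros)
  show "\<rho> (e i) v = 0" if "0 < i" "i < n" "v \<in> Wspan" for i v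
    using that(3)
  proof (induction rule: Wspan.induct)
    case (Wspan_wv a)
    then show ?case using that assms(1) by (simp add: rho_e_wv)
  qed (auto simp: rho_add_right rho_sc Wspan_TP)
qed (use assms Wspan_TP in \<open>auto intro: Wspan.intros\<close>)

lemma rho_alt_wv: assumes "3 \<le> r" "l < r" shows "\<rho> alt (wv l) = 0"
proof -
  have "\<rho> alt (wv l) = \<rho> (f 1) (\<rho> (f 2) (\<rho> (f 1) (wv l))) - \<rho> (f 1) (wv l)"
    using assms wv_TP[of l] by (simp add: alt_def rho_diff rho_mult rho_TP)
  also have "\<dots> = sc (phi 1 l) * \<rho> (f 1) (\<rho> (f 2) (uv 1)) - sc (phi 1 l) * uv 1"
    using assms by (simp add: rho_f_wv rho_sc uv_TP rho_TP)
  also have "\<rho> (f 2) (uv 1) = - uv 2" using assms by (intro rho_f_uv) auto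
  also have "\<rho> (f 1) (- uv 2) = uv 1"
    using assms rho_diff_right[of 0 "uv 2" "f 1"] rho_f_uv[of 1 2]
    by (simp add: tensor_power_zero uv_TP rho_right_zero)
  finally show ?thesis by simp
qed

text \<open>The vectors of weight \<open>2 r - 2\<close> force the coefficients of the normal form
  to vanish. For \<open>n = 3\<close> they do not see \<open>alt\<close>, whose coefficient is
  detected by \<open>alt3\<close> instead.\<close>

lemma kernel_in_J:
  assumes n: "2 \<le> n" "n \<le> r" and x: "x \<in> A n" "ker x"
  shows "x \<in> J n"
proof (cases "n = 3")
  case False
  then have "bmw_hook scale g h e r n (J n)" using hook_2 hook_ge_4[of n] n by (cases "n = 2") auto
  then interpret bmw_hook scale g h e r n "J n" .
  obtain a b where ab: "x - (a *s 1 + (\<Sum>i\<in>{1..<n}. \<Sum>j\<in>{1..<n}. b i j *s F i j)) \<in> J n"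
    using A_N[OF x(1)] unfolding N_def by blast
  have "a = 0" "\<And>i j. i \<in> {1..<n} \<Longrightarrow> j \<in> {1..<n} \<Longrightarrow> b i j = 0"
    using normal_form_kernel[OF _ n(2) x(2) J_wv[OF n(2) ab]] n by auto
  then show ?thesis using ab by simp
next
  case True
  then have r: "3 \<le> r" using n by simp
  interpret bmw_hook scale g h e r 3 J_alt using hook_3[OF r] .
  obtain a b where ab: "x - (a *s 1 + (\<Sum>i\<in>{1..<3}. \<Sum>j\<in>{1..<3}. b i j *s F i j)) \<in> J_alt"
    using A_N x(1) True unfolding N_def by blast
  then obtain y t where yt: "y \<in> J 3" "x - (a *s 1 + (\<Sum>i\<in>{1..<3}. \<Sum>j\<in>{1..<3}. b i j *s F i j)) = y + t *s alt"
    unfolding J_alt_def by blast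
  have "\<rho> (y + t *s alt) (wv l) = 0" if "l < r" for l
    using J_wv[OF r yt(1) that] rho_alt_wv[OF r that] wv_TP[OF that] by (simp add: rho_add rho_scale)
  then have "a = 0" "\<And>i j. i \<in> {1..<3} \<Longrightarrow> j \<in> {1..<3} \<Longrightarrow> b i j = 0"
    using normal_form_kernel[OF _ r x(2), of a b] yt(2) by auto
  then have xy: "x = y + t *s alt" using yt(2) by simp
  define w where "w = word (replicate (r - 3) Vp)"
  define v where "v = alt3 * w"
  have w: "w \<in> tensor_power (r - 3)" by (simp add: w_def tensor_power_single)
  then have v: "v \<in> TP" using tensor_power_mult[OF alt3_tensor_power w] r by (simp add: v_def)
  have g: "\<rho> (g i) v = sc (- (inverse q^2)) * v" if "0 < i" "i < 3" for i
  proof -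
    have i: "i = 1 \<or> i = 2" using that by auto
    have "\<rho> (g i) v = R_matrix (3 + (r - 3)) i (alt3 * w)" using that r v by (simp add: rho_g v_def)
    also have "\<dots> = R_matrix 3 i alt3 * w" using that w by (intro R_matrix_mult alt3_tensor_power)
    finally show ?thesis using i R_matrix_alt3 by (auto simp: v_def mult.assoc)
  qed
  have "\<rho> y v = 0"
  proof (rule J_kills[OF r, of "range (\<lambda>s. sc s * v)"])
    show "v \<in> range (\<lambda>s. sc s * v)" by (rule range_eqI[of _ _ 1]) (simp add: sc_1)
    show "\<rho> (g i) u \<in> range (\<lambda>s. sc s * v)" if "0 < i" "i < 3" "u \<in> range (\<lambda>s. sc s * v)" for i u
      using that v g by (auto simp: rho_sc sc_sc)
    show "\<rho> (e i) u = 0" if "0 < i" "i < 3" "u \<in> range (\<lambda>s. sc s * v)" for i u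
      using that v g[OF that(1,2)] rho_e_alt[of i v] r by (auto simp: rho_sc)
    show "u + u' \<in> range (\<lambda>s. sc s * v)" if "u \<in> range (\<lambda>s. sc s * v)" "u' \<in> range (\<lambda>s. sc s * v)" for u u'
      using that by (auto simp flip: distrib_right single_add)
  qed (use yt(1) v in \<open>auto simp: tensor_power_sc sc_sc\<close>)
  moreover have "\<rho> alt v = sc (c * (c * c) - c) * v"
  proof -
    have "\<rho> (f i) v = sc c * v" if "0 < i" "i < 3" for i
      using rho_f_alt[of i v] g[OF that] that r v by simp
    then have "\<rho> alt v = sc c * (sc c * (sc c * v)) - sc c * v"
      using v r by (simp only: alt_def rho_diff rho_mult rho_TP rho_sc tensor_power_sc)
    then show ?thesis by (simp only: sc_sc single_diff left_diff_distrib)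
  qed
  moreover have "\<rho> x v = 0" using x(2) v by (simp add: ker_def)
  ultimately have "sc (t * (c * (c * c) - c)) * v = 0"
    using v by (simp add: xy rho_add rho_scale sc_sc)
  then have "Poly_Mapping.lookup (sc (t * (c * (c * c) - c)) * v) ([Vp, Vm, Vz] @ replicate (r - 3) Vp) = 0" by simp
  moreover have "Poly_Mapping.lookup v ([Vp, Vm, Vz] @ replicate (r - 3) Vp) = - qint 2"
    unfolding v_def using lookup_tensor[OF alt3_tensor_power, of "[Vp, Vm, Vz]" w "replicate (r - 3) Vp"]
    by (simp add: alt3_def w_def single_mult lookup_add lookup_minus lookup_single right_diff_distrib distrib_left)
  \<comment> \<open>The three factors are \<open>c\<close>, \<open>q^2 + inverse q^2 - 1\<close> and
    \<open>[3]_q\<close>, all nonzero.\<close>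
  moreover have "c * (c * c) - c = c * (c - 1) * (c + 1)" by (simp add: algebra_simps)
  moreover have "c + 1 = q^2 + 1 + inverse q^2" by simp
  ultimately have "t = 0" using q_scalars_nonzero qint_2_nonzero by (auto simp: lookup_sc)
  then show ?thesis using yt(1) True xy by simp
qed

theorem kernel_zero: "n \<le> r \<Longrightarrow> x \<in> A n \<Longrightarrow> ker x \<Longrightarrow> x = 0"
proof (induction n arbitrary: x rule: Sl.induct)
  case 1
  then show ?case using A_0 ker_scalar by fastforce
next
  case 2
  then show ?case using A_1 ker_scalar by fastforce
next
  case (3 n)
  let ?n = "Suc n"
  have n: "Suc n < r" "Suc (Suc n) \<le> r" using 3 by auto
  have x: "x \<in> J (Suc (Suc n))" using 3 by (intro kernel_in_J) auto
  have exe: "e ?n * w * e ?n = 0" if w: "w \<in> A (Suc (Suc n))" "ker w" for w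
  proof -
    \<comment> \<open>Two reductions carry \<open>w\<close> from \<open>A (n + 2)\<close> to an
      element \<open>b\<close> of \<open>A n\<close>; as the kernel is two-sided and
      \<open>e ?n\<close> cancels, the induction hypothesis applies to \<open>b\<close>.\<close>
    obtain a where a: "a \<in> A ?n" "e ?n * w = e ?n * a" using eA[OF n(1) w(1)] by blast
    obtain b where b: "b \<in> A n" "e ?n * a * e ?n = b * e ?n" using eAe[OF n(1) a(1)] by blast
    have "ker (b * e ?n)" using ker_mult[OF w(2), of "e ?n" "e ?n"] a(2) b(2) by simp
    then have "ker b" by (rule ker_cancel_e[OF n(1) b(1)])
    then have "b = 0" using 3 b(1) by simp
    then show ?thesis using a(2) b(2) by simp
  qed
  show ?case
  proof (rule J_x_J_zero[OF n(1) x])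
    fix y z assume "y \<in> J (Suc (Suc n))" "z \<in> J (Suc (Suc n))"
    from n(2) this(1) show "y * x * z = 0"
    proof (induction rule: J_top_induct)
      case (base a b)
      from n(2) \<open>z \<in> J (Suc (Suc n))\<close> show ?case
      proof (induction rule: J_top_induct)
        case (base u v)
        have "e ?n * (b * x * u) * e ?n = 0"
          using base \<open>b \<in> A (Suc (Suc n))\<close> 3 by (intro exe A_mult ker_mult)
        moreover have "a * e ?n * b * x * (u * e ?n * v) = a * (e ?n * (b * x * u) * e ?n) * v"
          by (simp only: mult.assoc)
        ultimately show ?case by simp
      qed (simp_all add: distrib_left mult_scale)
    qed (simp_all add: distrib_right scale_mult)
  qed
qed

end

section \<open>\<open>Phi\<close> vanishes on the fourth tensor power\<close>

text \<open>The inverse of \<open>[2]_q\<close> as a constant of its own, so that the identities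
  below become polynomial ones and are decided by rewriting to a normal form.\<close>

definition tau :: qfield where "tau = inverse (q + inverse q)"

lemma tau: "(q + inverse q) * tau = 1"
  using qint_2_nonzero unfolding qint_2 tau_def by (rule right_inverse)

text \<open>Rewrites a polynomial in \<open>q\<close>, \<open>q\<^sup>-\<^sup>1\<close> and \<open>tau\<close> to the basis \<open>q\<^sup>n\<close>, \<open>tau ^ m\<close>, \<open>q\<^sup>-\<^sup>1 tau ^ m\<close>.\<close>

lemma tau_rules:
  "q * inverse q = 1" "q * (inverse q * x) = x" "inverse q * q = 1" "inverse q * (q * x) = x"
  "tau * q = 1 - tau * inverse q" "tau * (q * x) = x - tau * (inverse q * x)"
  "q * tau = 1 - tau * inverse q" "q * (tau * x) = x - tau * (inverse q * x)"
  "tau * (inverse q * inverse q) = inverse q - tau"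
  "tau * (inverse q * (inverse q * x)) = inverse q * x - tau * x"
proof -
  have 1: "tau * q = 1 - tau * inverse q" using tau by (simp add: algebra_simps)
  have 2: "tau * (inverse q * inverse q) = inverse q - tau"
  proof -
    have "tau * (inverse q * inverse q) = inverse q * (tau * (q + inverse q)) - tau * (inverse q * q)"
      by (simp add: algebra_simps)
    then show ?thesis using tau by (simp add: mult.commute)
  qed
  show "q * inverse q = 1" "q * (inverse q * x) = x" "inverse q * q = 1" "inverse q * (q * x) = x"
    by (simp_all flip: mult.assoc)
  show "tau * q = 1 - tau * inverse q" "q * tau = 1 - tau * inverse q"
    "tau * (inverse q * inverse q) = inverse q - tau"
    using 1 2 by (simp_all add: mult.commute)
  show "tau * (q * x) = x - tau * (inverse q * x)" "q * (tau * x) = x - tau * (inverse q * x)"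
    using arg_cong[OF 1, of "\<lambda>t. t * x"] by (simp_all add: algebra_simps)
  show "tau * (inverse q * (inverse q * x)) = inverse q * x - tau * x"
    using arg_cong[OF 2, of "\<lambda>t. t * x"] by (simp add: algebra_simps)
qed

lemmas scalar_norm = tau_rules algebra_simps eval_nat_numeral power_inverse[symmetric]

text \<open>The shape of \<open>R_matrix\<close> for any map of two factors, without restriction to
  a tensor power, so that linearity holds on all polynomials.\<close>

definition local_op :: "(vbasis \<Rightarrow> vbasis \<Rightarrow> vbasis ncpoly) \<Rightarrow> nat \<Rightarrow> vbasis ncpoly \<Rightarrow> vbasis ncpoly"
  where "local_op M i = lin (\<lambda>w. word (take (i - 1) w) * M (w ! (i - 1)) (w ! i) * word (drop (i + 1) w))"

text \<open>The inverse of \<open>braiding\<close>; \<open>local_op_inverse\<close> confirms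
  it.\<close>

fun ibraiding :: "vbasis \<Rightarrow> vbasis \<Rightarrow> vbasis ncpoly" where
  "ibraiding Vp Vp = sc (inverse q^2) * word [Vp, Vp]"
| "ibraiding Vp Vz = word [Vz, Vp] - sc (q^2 - inverse q^2) * word [Vp, Vz]"
| "ibraiding Vp Vm = sc (q^2) * word [Vm, Vp] - sc (q^2 * (q - inverse q)) * word [Vz, Vz]
    + sc ((q^2 - inverse q^2) * (q^2 - 1)) * word [Vp, Vm]"
| "ibraiding Vz Vp = word [Vp, Vz]"
| "ibraiding Vz Vz = word [Vz, Vz] - sc ((q^2 - inverse q^2) * (q + inverse q)) * word [Vp, Vm]"
| "ibraiding Vz Vm = word [Vm, Vz] - sc (q^2 - inverse q^2) * word [Vz, Vm]"
| "ibraiding Vm Vp = sc (q^2) * word [Vp, Vm]"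
| "ibraiding Vm Vz = word [Vz, Vm]"
| "ibraiding Vm Vm = sc (inverse q^2) * word [Vm, Vm]"

text \<open>The invariant form, normalised to take the value \<open>[3]_q\<close> on
  \<open>cup\<close>. With this normalisation \<open>cupcap\<close> satisfies the skein relation of
  \<open>e i\<close>, as \<open>cupcap_eq\<close> shows.\<close>

fun cap_coeff :: "vbasis \<Rightarrow> vbasis \<Rightarrow> qfield" where
  "cap_coeff Vp Vm = tau"
| "cap_coeff Vz Vz = - (inverse q^2)"
| "cap_coeff Vm Vp = inverse q^2 * tau"
| "cap_coeff _ _ = 0"

definition cupcap :: "vbasis \<Rightarrow> vbasis \<Rightarrow> vbasis ncpoly" where "cupcap a b = sc (cap_coeff a b) * cup"

text \<open>A basis of the summand of highest weight 2 of the second tensor power, and the projection onto it.\<close>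

fun weight2 :: "vbasis \<Rightarrow> vbasis ncpoly" where
  "weight2 Vp = word [Vz, Vp] - sc (q^2) * word [Vp, Vz]"
| "weight2 Vz = sc (q + inverse q) * word [Vm, Vp] - sc (q + inverse q) * word [Vp, Vm] + sc (1 - q^2) * word [Vz, Vz]"
| "weight2 Vm = word [Vm, Vz] - sc (q^2) * word [Vz, Vm]"

fun weight2_proj :: "vbasis \<Rightarrow> vbasis \<Rightarrow> vbasis ncpoly" where
  "weight2_proj Vz Vp = sc (inverse q^2) * weight2 Vp"
| "weight2_proj Vp Vz = sc (-1) * weight2 Vp"
| "weight2_proj Vz Vm = sc (-1) * weight2 Vm"
| "weight2_proj Vm Vz = sc (inverse q^2) * weight2 Vm"
| "weight2_proj Vp Vm = sc (- tau) * weight2 Vz"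
| "weight2_proj Vz Vz = sc (- (1 - inverse q^2)) * weight2 Vz"
| "weight2_proj Vm Vp = sc (tau) * weight2 Vz"
| "weight2_proj Vp Vp = 0"
| "weight2_proj Vm Vm = 0"

lemmas expand_simps = tensor2_simps cup_def right_diff_distrib distrib_left

lemma cupcap_eq:
  "cupcap a b = word [a, b] - sc (inverse (q^2 - inverse q^2)) * (braiding a b - ibraiding a b)"
proof -
  have "sc (q^2 - inverse q^2) * cupcap a b = sc (q^2 - inverse q^2) * word [a, b] - (braiding a b - ibraiding a b)"
    unfolding cupcap_def cup_def
    by (rule poly_mapping_eqI; cases a; cases b;
      auto simp: tensor2_simps scalar_norm)
  then have "sc (inverse (q^2 - inverse q^2)) * (sc (q^2 - inverse q^2) * cupcap a b) =
      sc (inverse (q^2 - inverse q^2)) * (sc (q^2 - inverse q^2) * word [a, b] - (braiding a b - ibraiding a b))"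
    by simp
  then show ?thesis
    by (simp only: right_diff_distrib[of "sc (inverse (q^2 - inverse q^2))"] sc_sc
        left_inverse[OF q_scalars_nonzero(1)] sc_1 mult_1_left)
qed

lemma proj_eq: "weight2_proj a b = sc (q^2) * word [a, b] - braiding a b - sc (1 - inverse q^2) * cupcap a b"
  unfolding cupcap_def cup_def
  by (rule poly_mapping_eqI; cases a; cases b;
    auto simp: tensor2_simps scalar_norm)

lemma UNIV_vbasis: "(UNIV :: vbasis set) = {Vp, Vz, Vm}"
  using vbasis.exhaust by blast

lemma sum_vbasis: "(\<Sum>x\<in>UNIV. f x) = f Vp + f Vz + f Vm" for f :: "vbasis \<Rightarrow> 'b::comm_monoid_add"
  by (simp add: UNIV_vbasis add.assoc)

definition weight22 :: "vbasis \<Rightarrow> vbasis \<Rightarrow> vbasis ncpoly" where "weight22 i j = weight2 i * weight2 j"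

definition cup_between :: "vbasis \<Rightarrow> vbasis \<Rightarrow> vbasis ncpoly" where "cup_between x y = letter x * cup * letter y"

definition lincomb :: "(vbasis \<Rightarrow> vbasis \<Rightarrow> vbasis ncpoly) \<Rightarrow> (vbasis \<Rightarrow> vbasis \<Rightarrow> qfield) \<Rightarrow> vbasis ncpoly"
  where "lincomb B n = (\<Sum>x\<in>UNIV. \<Sum>y\<in>UNIV. sc (n x y) * B x y)"

text \<open>The terms of \<open>Phi\<close> factor through maps between the images of \<open>F\<close> and of the second cup-cap, which have the bases
  \<open>weight22\<close> and \<open>cup_between\<close>. The tables are their matrices: \<open>M_table\<close> for the cup-cap and, in the
  opposite direction, for \<open>F\<close>; \<open>N_table\<close> and \<open>K_table\<close> for what remains of the last two terms in between.\<close>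

fun M_table :: "vbasis \<Rightarrow> vbasis \<Rightarrow> vbasis \<Rightarrow> vbasis \<Rightarrow> qfield" where
  "M_table Vp Vp = (\<lambda>x y. if x = Vp \<and> y = Vp then 1 else 0)"
| "M_table Vp Vz = (\<lambda>x y. if x = Vp \<and> y = Vz then 1 - q^2 else if x = Vz \<and> y = Vp then 1 else 0)"
| "M_table Vp Vm = (\<lambda>x y. if x = Vp \<and> y = Vm then - (q^2) else if x = Vz \<and> y = Vz then tau else 0)"
| "M_table Vz Vp = (\<lambda>x y. if x = Vp \<and> y = Vz then 1 else if x = Vz \<and> y = Vp then 1 - inverse q^2 else 0)"
| "M_table Vz Vz = (\<lambda>x y. if x = Vm \<and> y = Vp then inverse q + q
    else if x = Vp \<and> y = Vm then inverse q^3 + inverse q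
    else if x = Vz \<and> y = Vz then 2 - inverse q^2 - q^2 else 0)"
| "M_table Vz Vm = (\<lambda>x y. if x = Vm \<and> y = Vz then 1 else if x = Vz \<and> y = Vm then 1 - q^2 else 0)"
| "M_table Vm Vp = (\<lambda>x y. if x = Vm \<and> y = Vp then - (inverse q^2) else if x = Vz \<and> y = Vz then q^2 * tau else 0)"
| "M_table Vm Vz = (\<lambda>x y. if x = Vm \<and> y = Vz then 1 - inverse q^2 else if x = Vz \<and> y = Vm then 1 else 0)"
| "M_table Vm Vm = (\<lambda>x y. if x = Vm \<and> y = Vm then 1 else 0)"

fun N_table :: "vbasis \<Rightarrow> vbasis \<Rightarrow> vbasis \<Rightarrow> vbasis \<Rightarrow> qfield" where
  "N_table Vp Vm = (\<lambda>x y. if x = Vm \<and> y = Vp then 1 else if x = Vp \<and> y = Vm then q^2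
    else if x = Vz \<and> y = Vz then - (q^2) * tau else 0)"
| "N_table Vz Vz = (\<lambda>x y. if x = Vm \<and> y = Vp then - (inverse q^3) - inverse q
    else if x = Vp \<and> y = Vm then - inverse q - q
    else if x = Vz \<and> y = Vz then 1 else 0)"
| "N_table Vm Vp = (\<lambda>x y. if x = Vm \<and> y = Vp then inverse q^2 else if x = Vp \<and> y = Vm then 1
    else if x = Vz \<and> y = Vz then - tau else 0)"
| "N_table _ _ = (\<lambda>x y. 0)"

fun K_table :: "vbasis \<Rightarrow> vbasis \<Rightarrow> vbasis \<Rightarrow> vbasis \<Rightarrow> qfield" where
  "K_table Vp Vp = (\<lambda>x y. if x = Vp \<and> y = Vp then q^2 else 0)"
| "K_table Vp Vz = (\<lambda>x y. if x = Vz \<and> y = Vp then 1 else 0)"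
| "K_table Vp Vm = (\<lambda>x y. if x = Vm \<and> y = Vp then inverse q^2 else 0)"
| "K_table Vz Vp = (\<lambda>x y. if x = Vp \<and> y = Vz then 1 else if x = Vz \<and> y = Vp then q^2 - inverse q^2 else 0)"
| "K_table Vz Vz = (\<lambda>x y. if x = Vm \<and> y = Vp then q + inverse q - inverse q^3 - inverse q^5
    else if x = Vz \<and> y = Vz then 1 else 0)"
| "K_table Vz Vm = (\<lambda>x y. if x = Vm \<and> y = Vz then 1 else 0)"
| "K_table Vm Vp = (\<lambda>x y. if x = Vm \<and> y = Vp then q^2 - 1 - inverse q^2 + inverse q^4
    else if x = Vp \<and> y = Vm then inverse q^2
    else if x = Vz \<and> y = Vz then q - inverse q else 0)"
| "K_table Vm Vz = (\<lambda>x y. if x = Vm \<and> y = Vz then q^2 - inverse q^2 else if x = Vz \<and> y = Vm then 1 else 0)"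
| "K_table Vm Vm = (\<lambda>x y. if x = Vm \<and> y = Vm then q^2 else 0)"

lemma local_op_add: "local_op A i (u + v) = local_op A i u + local_op A i v"
  and local_op_diff: "local_op A i (u - v) = local_op A i u - local_op A i v"
  and local_op_sc: "local_op A i (sc a * v) = sc a * local_op A i v"
  and local_op_0: "local_op A i 0 = 0"
  by (simp_all add: local_op_def lin_add lin_diff lin_sc)

lemma local_op_single:
  "local_op A 1 (Poly_Mapping.single [a, b, d, e] t) = sc t * (A a b * word [d, e])"
  "local_op A 2 (Poly_Mapping.single [a, b, d, e] t) = sc t * (letter a * A b d * letter e)"
  "local_op A 3 (Poly_Mapping.single [a, b, d, e] t) = sc t * (word [a, b] * A d e)"
  by (simp_all add: local_op_def lin_single sc_1 numeral_2_eq_2 numeral_3_eq_3)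

lemmas local_op_simps = local_op_add local_op_diff local_op_sc local_op_0 local_op_single
  local_op_single(1)[unfolded One_nat_def]

text \<open>Reduces each evaluation of the second cup-cap to nine scalars, one for each pair of
  outer letters.\<close>

lemma cupcap_lincomb:
  assumes "v \<in> tensor_power 4"
  shows "local_op cupcap 2 v = lincomb cup_between (\<lambda>x y. \<Sum>b\<in>UNIV. \<Sum>d\<in>UNIV. Poly_Mapping.lookup v [x, b, d, y] * cap_coeff b d)"
  using assms
proof (induction rule: tensor_power_induct)
  case zero
  show ?case by (simp add: local_op_0 lincomb_def single_zero)
next
  case (single w t)
  then obtain a b d e where w: "w = [a, b, d, e]"
    by (auto simp: numeral_eq_Suc length_Suc_conv)
  have "letter a * cupcap b d * letter e = sc (cap_coeff b d) * cup_between a e"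
    by (simp add: cupcap_def cup_between_def sc_left_comm[of "letter a"] mult.assoc)
  then have "local_op cupcap 2 (Poly_Mapping.single w t) = sc (t * cap_coeff b d) * cup_between a e"
    by (simp add: w local_op_single sc_sc)
  moreover have "(\<Sum>b'\<in>UNIV. \<Sum>d'\<in>UNIV. Poly_Mapping.lookup (Poly_Mapping.single w t) [x, b', d', y] * cap_coeff b' d') =
      (if x = a \<and> y = e then t * cap_coeff b d else 0)" for x y
    by (cases b; cases d) (auto simp: w sum_vbasis lookup_single when_def)
  moreover have "lincomb cup_between (\<lambda>x y. if x = a \<and> y = e then t * cap_coeff b d else 0) = sc (t * cap_coeff b d) * cup_between a e"
    by (cases a; cases e) (simp_all add: lincomb_def sum_vbasis)
  ultimately show ?case by simp
next
  case (add u v)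
  then show ?case
    by (simp add: local_op_add lookup_add distrib_right single_add sum.distrib lincomb_def)
qed

lemma cupcap_weight22: "local_op cupcap 2 (weight22 i j) = lincomb cup_between (M_table i j)"
proof -
  have "weight22 i j \<in> tensor_power 4"
    by (cases i; cases j) (simp_all add: weight22_def single_mult distrib_left distrib_right left_diff_distrib right_diff_distrib tensor_power_closed)
  moreover have "(\<Sum>b\<in>UNIV. \<Sum>d\<in>UNIV. Poly_Mapping.lookup (weight22 i j) [x, b, d, y] * cap_coeff b d) = M_table i j x y" for x y
    by (cases i; cases j; cases x; cases y; simp add: sum_vbasis weight22_def expand_simps; (simp add: scalar_norm)?)
  ultimately show ?thesis by (simp add: cupcap_lincomb)
qed

lemma cupcap_cup_between: "local_op cupcap 2 (local_op ibraiding 3 (local_op braiding 1 (cup_between i j))) = lincomb cup_between (N_table i j)"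
proof -
  let ?v = "local_op ibraiding 3 (local_op braiding 1 (cup_between i j))"
  have "?v \<in> tensor_power 4"
    by (cases i; cases j) (simp_all add: cup_between_def cup_def local_op_simps braiding_table single_mult distrib_left distrib_right
        left_diff_distrib right_diff_distrib tensor_power_closed)
  moreover have "(\<Sum>b\<in>UNIV. \<Sum>d\<in>UNIV. Poly_Mapping.lookup ?v [x, b, d, y] * cap_coeff b d) = N_table i j x y" for x y
    by (cases i; cases j; simp add: cup_between_def cup_def local_op_simps braiding_table single_mult distrib_left distrib_right
        left_diff_distrib right_diff_distrib; cases x; cases y; simp add: sum_vbasis expand_simps; (simp add: scalar_norm)?)
  ultimately show ?thesis by (simp add: cupcap_lincomb)
qed

lemma cupcap_braiding_cup_between: "local_op cupcap 2 (local_op braiding 1 (local_op cupcap 3 (cup_between i j))) = lincomb cup_between (K_table i j)"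
proof -
  let ?v = "local_op braiding 1 (local_op cupcap 3 (cup_between i j))"
  have "?v \<in> tensor_power 4"
    by (cases i; cases j) (simp_all add: cup_between_def cupcap_def cup_def local_op_simps braiding_table single_mult distrib_left distrib_right
        left_diff_distrib right_diff_distrib tensor_power_closed)
  moreover have "(\<Sum>b\<in>UNIV. \<Sum>d\<in>UNIV. Poly_Mapping.lookup ?v [x, b, d, y] * cap_coeff b d) = K_table i j x y" for x y
    by (cases i; cases j; simp add: cup_between_def cupcap_def cup_def local_op_simps braiding_table single_mult distrib_left distrib_right
        left_diff_distrib right_diff_distrib; cases x; cases y; simp add: sum_vbasis expand_simps; (simp add: scalar_norm)?)
  ultimately show ?thesis by (simp add: cupcap_lincomb)
qed

lemma local_op_ext:
  assumes v: "v \<in> tensor_power 4"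
    and \<phi>: "\<And>u v. \<phi> (u + v) = \<phi> u + \<phi> v" "\<And>a v. \<phi> (sc a * v) = sc a * \<phi> v"
    and \<psi>: "\<And>u v. \<psi> (u + v) = \<psi> u + \<psi> v" "\<And>a v. \<psi> (sc a * v) = sc a * \<psi> v"
    and eq: "\<And>a b d e. \<phi> (word [a, b, d, e]) = \<psi> (word [a, b, d, e])"
  shows "\<phi> v = \<psi> v"
  using v
proof (induction rule: tensor_power_induct)
  case zero
  show ?case using \<phi>(2)[of 0 0] \<psi>(2)[of 0 0] by simp
next
  case (single w t)
  then obtain a b d e where "w = [a, b, d, e]" by (auto simp: numeral_eq_Suc length_Suc_conv)
  then show ?case using \<phi>(2)[of t "word w"] \<psi>(2)[of t "word w"] eq by (simp add: single_mult)
qed (simp add: \<phi> \<psi>)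

text \<open>The relation \<open>eeg\<close> on tensors. It concerns the last three factors, so the
  first letter stays a variable and 27 cases remain.\<close>

lemma cupcap_ibraiding:
  assumes "v \<in> tensor_power 4"
  shows "local_op cupcap 2 (local_op ibraiding 3 v) = local_op cupcap 2 (local_op cupcap 3 (local_op braiding 2 v))"
proof (rule local_op_ext[OF assms])
  fix a b d e
  show "local_op cupcap 2 (local_op ibraiding 3 (word [a, b, d, e])) =
    local_op cupcap 2 (local_op cupcap 3 (local_op braiding 2 (word [a, b, d, e])))"
    by (rule poly_mapping_eqI; cases b; cases d; cases e;
        simp add: cupcap_def cup_def local_op_simps expand_simps; (simp add: scalar_norm)?)
qed (simp_all only: local_op_add local_op_sc)

lemma cupcap_braiding:
  assumes "v \<in> tensor_power 4"
  shows "local_op cupcap 3 (local_op braiding 2 v) = local_op cupcap 3 (local_op cupcap 2 (local_op ibraiding 3 v))"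
proof (rule local_op_ext[OF assms])
  fix a b d e
  show "local_op cupcap 3 (local_op braiding 2 (word [a, b, d, e])) =
    local_op cupcap 3 (local_op cupcap 2 (local_op ibraiding 3 (word [a, b, d, e])))"
    by (rule poly_mapping_eqI; cases b; cases d; cases e;
        simp add: cupcap_def cup_def local_op_simps expand_simps; (simp add: scalar_norm)?)
qed (simp_all only: local_op_add local_op_sc)

lemma local_op_braid:
  assumes "v \<in> tensor_power 4"
  shows "local_op braiding 1 (local_op braiding 2 (local_op braiding 1 v)) =
    local_op braiding 2 (local_op braiding 1 (local_op braiding 2 v))"
proof (rule local_op_ext[OF assms])
  fix a b d e
  show "local_op braiding 1 (local_op braiding 2 (local_op braiding 1 (word [a, b, d, e]))) =
    local_op braiding 2 (local_op braiding 1 (local_op braiding 2 (word [a, b, d, e])))"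
    by (rule poly_mapping_eqI; cases a; cases b; cases d;
        simp add: local_op_simps expand_simps; (simp add: scalar_norm)?)
qed (simp_all only: local_op_add local_op_sc)

fun proj_coeff :: "vbasis \<Rightarrow> vbasis \<Rightarrow> vbasis \<Rightarrow> qfield" where
  "proj_coeff Vz Vp = (\<lambda>i. if i = Vp then inverse q^2 else 0)"
| "proj_coeff Vp Vz = (\<lambda>i. if i = Vp then -1 else 0)"
| "proj_coeff Vz Vm = (\<lambda>i. if i = Vm then -1 else 0)"
| "proj_coeff Vm Vz = (\<lambda>i. if i = Vm then inverse q^2 else 0)"
| "proj_coeff Vp Vm = (\<lambda>i. if i = Vz then - tau else 0)"
| "proj_coeff Vz Vz = (\<lambda>i. if i = Vz then - (1 - inverse q^2) else 0)"
| "proj_coeff Vm Vp = (\<lambda>i. if i = Vz then tau else 0)"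
| "proj_coeff Vp Vp = (\<lambda>i. 0)"
| "proj_coeff Vm Vm = (\<lambda>i. 0)"

abbreviation proj2 :: "vbasis ncpoly \<Rightarrow> vbasis ncpoly"
  where "proj2 v \<equiv> local_op weight2_proj 1 (local_op weight2_proj 3 v)"

lemma lincomb_add: "lincomb B m + lincomb B n = lincomb B (\<lambda>x y. m x y + n x y)"
  by (simp add: lincomb_def sum.distrib single_add distrib_right)

lemma lincomb_sc: "sc t * lincomb B n = lincomb B (\<lambda>x y. t * n x y)"
  by (simp add: lincomb_def sum_distrib_left sc_sc)

lemma lincomb_diff: "lincomb B m - lincomb B n = lincomb B (\<lambda>x y. m x y - n x y)"
  by (simp add: lincomb_def sum_subtractf single_diff left_diff_distrib)

lemma lincomb_0: "lincomb B (\<lambda>x y. 0) = 0"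
  by (simp add: lincomb_def)

lemma local_op_lincomb:
  assumes \<phi>: "\<And>u v. \<phi> (u + v) = \<phi> u + \<phi> v" "\<And>a v. \<phi> (sc a * v) = sc a * \<phi> v"
    and K: "\<And>i j. \<phi> (B i j) = lincomb B' (K i j)"
  shows "\<phi> (lincomb B n) = lincomb B' (\<lambda>x y. \<Sum>i\<in>UNIV. \<Sum>j\<in>UNIV. n i j * K i j x y)"
  unfolding lincomb_def[of B] sum_vbasis \<phi> K lincomb_sc lincomb_add ..

lemma proj2_word:
  "proj2 (word [a, b, d, e]) = lincomb weight22 (\<lambda>i j. proj_coeff a b i * proj_coeff d e j)"
proof -
  have weight2: "local_op weight2_proj 1 (word [a, b] * weight2 k) = weight2_proj a b * weight2 k" for k
    by (cases k) (simp_all add: single_mult right_diff_distrib distrib_left local_op_simps sc_left_comm[of "weight2_proj a b", symmetric])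
  have p: "weight2_proj d e = (\<Sum>j\<in>UNIV. sc (proj_coeff d e j) * weight2 j)" for d e
    by (cases d; cases e) (simp_all add: sum_vbasis del: weight2.simps)
  have "proj2 (word [a, b, d, e]) = local_op weight2_proj 1 (word [a, b] * weight2_proj d e)"
    by (simp add: local_op_single sc_1)
  also have "\<dots> = (\<Sum>j\<in>UNIV. sc (proj_coeff d e j) * (weight2_proj a b * weight2 j))"
    unfolding p[of d e] sum_vbasis distrib_left local_op_add local_op_sc weight2
      sc_left_comm[of "word [a, b]"] ..
  also have "\<dots> = (\<Sum>j\<in>UNIV. \<Sum>i\<in>UNIV. sc (proj_coeff a b i * proj_coeff d e j) * weight22 i j)"
    unfolding p[of a b] weight22_def
    by (simp add: sum_distrib_left sum_distrib_right sc_sc mult.assoc mult.commute del: weight2.simps)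
  also have "\<dots> = lincomb weight22 (\<lambda>i j. proj_coeff a b i * proj_coeff d e j)"
    unfolding lincomb_def by (rule sum.swap)
  finally show ?thesis .
qed

lemma proj2_add: "proj2 (u + v) = proj2 u + proj2 v" and proj2_sc: "proj2 (sc a * v) = sc a * proj2 v"
  by (simp_all only: local_op_add local_op_sc)

lemma proj2_cup_between: "proj2 (cup_between i j) = lincomb weight22 (M_table i j)"
proof -
  have "cup_between i j = sc (q^2 * qint 2) * word [i, Vp, Vm, j] + sc (- (q^2)) * word [i, Vz, Vz, j] + sc (qint 2) * word [i, Vm, Vp, j]"
    by (simp add: cup_between_def cup_def single_mult distrib_left distrib_right left_diff_distrib right_diff_distrib single_uminus)
  then have "proj2 (cup_between i j) = lincomb weight22 (\<lambda>k l. q^2 * qint 2 * (proj_coeff i Vp k * proj_coeff Vm j l)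
      + - (q^2) * (proj_coeff i Vz k * proj_coeff Vz j l) + qint 2 * (proj_coeff i Vm k * proj_coeff Vp j l))"
    by (simp only: proj2_add proj2_sc proj2_word lincomb_sc lincomb_add)
  moreover have "q^2 * qint 2 * (proj_coeff i Vp k * proj_coeff Vm j l)
      + - (q^2) * (proj_coeff i Vz k * proj_coeff Vz j l) + qint 2 * (proj_coeff i Vm k * proj_coeff Vp j l)
      = M_table i j k l" for k l
    by (cases i; cases j; cases k; cases l; simp add: qint_2; (simp add: scalar_norm)?)
  ultimately show ?thesis by simp
qed

lemma proj2_lincomb: "v \<in> tensor_power 4 \<Longrightarrow> \<exists>n. proj2 v = lincomb weight22 n"
proof (induction rule: tensor_power_induct)
  case zero
  show ?case by (intro exI[of _ "\<lambda>x y. 0"]) (simp add: local_op_0 lincomb_0)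
next
  case (single w t)
  then obtain a b d e where "w = [a, b, d, e]" by (auto simp: numeral_eq_Suc length_Suc_conv)
  then have "proj2 (Poly_Mapping.single w t) = proj2 (sc t * word [a, b, d, e])"
    by (simp add: single_mult)
  also have "\<dots> = sc t * proj2 (word [a, b, d, e])" by (rule proj2_sc)
  finally have "proj2 (Poly_Mapping.single w t) = sc t * proj2 (word [a, b, d, e])" .
  then show ?case by (metis proj2_word lincomb_sc)
next
  case (add u v)
  then show ?case by (metis proj2_add lincomb_add)
qed

lemma weight22_tensor_power: "weight22 i j \<in> tensor_power 4"
  by (cases i; cases j) (simp_all add: weight22_def single_mult distrib_left distrib_right left_diff_distrib right_diff_distrib tensor_power_closed)

lemma local_op_tensor:
  assumes "u \<in> tensor_power 2" "v \<in> tensor_power 2"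
  shows "local_op A 1 (u * v) = lin (\<lambda>w. A (w ! 0) (w ! 1)) u * v"
    "local_op A 3 (u * v) = u * lin (\<lambda>w. A (w ! 0) (w ! 1)) v"
proof -
  have *: "local_op A 1 (Poly_Mapping.single w s * Poly_Mapping.single w' t) =
      lin (\<lambda>w. A (w ! 0) (w ! 1)) (Poly_Mapping.single w s) * Poly_Mapping.single w' t \<and>
    local_op A 3 (Poly_Mapping.single w s * Poly_Mapping.single w' t) =
      Poly_Mapping.single w s * lin (\<lambda>w. A (w ! 0) (w ! 1)) (Poly_Mapping.single w' t)"
    if w: "length w = 2" "length w' = 2" for w w' s t
  proof -
    obtain a b d e where "w = [a, b]" "w' = [d, e]"
      using w by (auto simp: numeral_eq_Suc length_Suc_conv)
    moreover have "lin (\<lambda>w. A (w ! 0) (w ! 1)) (Poly_Mapping.single [x, y] t) = sc t * A x y" for x y t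
      by (simp add: lin_single)
    moreover have "A a b * Poly_Mapping.single [d, e] t = sc t * (A a b * word [d, e])"
      by (simp only: single_sc[of "[d, e]" t] sc_left_comm[of "A a b"])
    ultimately show ?thesis
      by (simp only: single_mult append.simps local_op_single)
        (simp add: single_sc[of "[a, b]" s] sc_sc mult.assoc sc_left_comm[of "word [a, b]"])
  qed
  show "local_op A 1 (u * v) = lin (\<lambda>w. A (w ! 0) (w ! 1)) u * v"
    "local_op A 3 (u * v) = u * lin (\<lambda>w. A (w ! 0) (w ! 1)) v"
    using assms(1)
  proof (induction rule: tensor_power_induct)
    case (single w s)
    {
      case 1
      from assms(2) show ?case
        by (induction rule: tensor_power_induct) (use single * in \<open>auto simp: local_op_add local_op_0 distrib_left\<close>)
    next
      case 2
      from assms(2) show ?case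
        by (induction rule: tensor_power_induct) (use single * in \<open>auto simp: local_op_add local_op_0 distrib_left lin_add\<close>)
    }
  qed (simp_all add: local_op_add local_op_0 distrib_right lin_add)
qed

lemma local_op_weight22:
  "local_op braiding 1 (weight22 i j) = sc (- (inverse q^2)) * weight22 i j"
  "local_op braiding 3 (weight22 i j) = sc (- (inverse q^2)) * weight22 i j"
  "local_op ibraiding 1 (weight22 i j) = sc (- (q^2)) * weight22 i j"
  "local_op ibraiding 3 (weight22 i j) = sc (- (q^2)) * weight22 i j"
proof -
  have weight2: "braiding2 (weight2 k) = sc (- (inverse q^2)) * weight2 k"
    "lin (\<lambda>w. ibraiding (w ! 0) (w ! 1)) (weight2 k) = sc (- (q^2)) * weight2 k" for k
    by (rule poly_mapping_eqI; cases k; simp add: tensor2_simps; (simp add: scalar_norm)?)+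
  have TP: "weight2 k \<in> tensor_power 2" for k
    by (cases k) (simp_all add: single_mult tensor_power_closed)
  show "local_op braiding 1 (weight22 i j) = sc (- (inverse q^2)) * weight22 i j"
    "local_op ibraiding 1 (weight22 i j) = sc (- (q^2)) * weight22 i j"
    unfolding weight22_def local_op_tensor(1)[OF TP TP] weight2 by (simp_all only: mult.assoc)
  show "local_op braiding 3 (weight22 i j) = sc (- (inverse q^2)) * weight22 i j"
    "local_op ibraiding 3 (weight22 i j) = sc (- (q^2)) * weight22 i j"
    unfolding weight22_def local_op_tensor(2)[OF TP TP] weight2 by (simp_all only: sc_left_comm[of "weight2 i"])
qed

lemma local_op_tensor_power:
  assumes "v \<in> tensor_power 4" "i \<in> {1, 2, 3}" and A: "\<And>a b. A a b \<in> tensor_power 2"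
  shows "local_op A i v \<in> tensor_power 4"
  using assms(1)
proof (induction rule: tensor_power_induct)
  case (single w t)
  then obtain a b d e where w: "w = [a, b, d, e]" by (auto simp: numeral_eq_Suc length_Suc_conv)
  have "A a b * word [d, e] \<in> tensor_power (2 + 2)" "letter a * A b d * letter e \<in> tensor_power (1 + 2 + 1)"
    "word [a, b] * A d e \<in> tensor_power (2 + 2)"
    by (intro tensor_power_mult A tensor_power_single; simp)+
  then have "A a b * word [d, e] \<in> tensor_power 4" "letter a * A b d * letter e \<in> tensor_power 4"
    "word [a, b] * A d e \<in> tensor_power 4"
    by (simp_all add: numeral_eq_Suc)
  then show ?case using assms(2) w by (auto simp: local_op_single local_op_single(1)[unfolded One_nat_def] tensor_power_sc)
qed (simp_all add: local_op_add local_op_0 tensor_power_closed)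

lemma cupcap_tensor_power: "cupcap a b \<in> tensor_power 2"
  by (simp add: cupcap_def tensor_power_sc cup_tensor_power)

lemma ibraiding_tensor_power: "ibraiding a b \<in> tensor_power 2"
  by (cases a; cases b) (simp_all add: single_mult tensor_power_closed)

lemmas local_op_closed = local_op_tensor_power[OF _ _ braiding_tensor_power]
  local_op_tensor_power[OF _ _ ibraiding_tensor_power] local_op_tensor_power[OF _ _ cupcap_tensor_power]

lemma local_op_13_comm:
  assumes "v \<in> tensor_power 4" and A: "\<And>a b. A a b \<in> tensor_power 2" and B: "\<And>a b. B a b \<in> tensor_power 2"
  shows "local_op A 1 (local_op B 3 v) = local_op B 3 (local_op A 1 v)"
proof (rule local_op_ext[OF assms(1)])
  fix a b d e :: vbasis
  have w: "word [x, y] \<in> tensor_power 2" for x y by (simp add: tensor_power_single)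
  have l: "lin (\<lambda>w. D (w ! 0) (w ! 1)) (word [x, y]) = D x y" for D :: "vbasis \<Rightarrow> vbasis \<Rightarrow> vbasis ncpoly" and x y
    by (simp add: lin_single sc_1)
  have "word [a, b, d, e] = word [a, b] * word [d, e]" by (simp add: single_mult)
  then show "local_op A 1 (local_op B 3 (word [a, b, d, e])) = local_op B 3 (local_op A 1 (word [a, b, d, e]))"
    by (simp only: local_op_tensor[OF w w] local_op_tensor[OF w B] local_op_tensor[OF A w] l)
qed (simp_all only: local_op_add local_op_sc)

text \<open>The last term of \<open>Phi\<close> simplifies in the BMW algebra:
  \<open>e\<^sub>2 g\<^sub>1 g\<^sub>3\<^sup>-\<^sup>1 g\<^sub>2 = e\<^sub>2 e\<^sub>3 g\<^sub>2 g\<^sub>1 g\<^sub>2 = e\<^sub>2 g\<^sub>1 e\<^sub>3 g\<^sub>2 g\<^sub>1 = e\<^sub>2 g\<^sub>1 e\<^sub>3 e\<^sub>2 g\<^sub>3\<^sup>-\<^sup>1 g\<^sub>1\<close>,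
  and \<open>g\<^sub>1\<close>, \<open>g\<^sub>3\<close> act on the image of \<open>F\<close> by \<open>-q\<^sup>-\<^sup>2\<close>.\<close>

lemma e1234_weight22:
  "local_op cupcap 2 (local_op braiding 1 (local_op ibraiding 3 (local_op braiding 2 (weight22 i j)))) =
    local_op cupcap 2 (local_op braiding 1 (local_op cupcap 3 (local_op cupcap 2 (weight22 i j))))"
proof -
  let ?g = "local_op braiding" and ?h = "local_op ibraiding" and ?e = "local_op cupcap" and ?y = "weight22 i j"
  note TP = weight22_tensor_power local_op_closed
  have "?e 2 (?g 1 (?h 3 (?g 2 ?y))) = ?e 2 (?h 3 (?g 1 (?g 2 ?y)))"
    by (subst local_op_13_comm[OF _ braiding_tensor_power ibraiding_tensor_power]) (simp_all add: TP)
  also have "\<dots> = ?e 2 (?e 3 (?g 2 (?g 1 (?g 2 ?y))))"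
    by (subst cupcap_ibraiding) (simp_all add: TP)
  also have "\<dots> = ?e 2 (?e 3 (?g 1 (?g 2 (?g 1 ?y))))"
    by (subst local_op_braid) (simp_all add: TP)
  also have "\<dots> = sc (- (inverse q^2)) * ?e 2 (?e 3 (?g 1 (?g 2 ?y)))"
    by (simp only: local_op_weight22 local_op_sc)
  also have "?e 3 (?g 1 (?g 2 ?y)) = ?g 1 (?e 3 (?g 2 ?y))"
    by (subst local_op_13_comm[OF _ braiding_tensor_power cupcap_tensor_power]) (simp_all add: TP)
  also have "?e 3 (?g 2 ?y) = ?e 3 (?e 2 (?h 3 ?y))"
    by (rule cupcap_braiding[OF weight22_tensor_power])
  also have "sc (- (inverse q^2)) * ?e 2 (?g 1 (?e 3 (?e 2 (?h 3 ?y)))) = sc (- (inverse q^2) * - (q^2)) * ?e 2 (?g 1 (?e 3 (?e 2 ?y)))"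
    by (simp only: local_op_weight22 local_op_sc sc_sc)
  also have "- (inverse q^2) * - (q^2) = 1" by (simp add: power_inverse)
  finally show ?thesis by (simp add: sc_1)
qed

section \<open>The matrix identity behind the vanishing of \<open>Phi\<close>\<close>

lemma coeff_c_eq: "coeff_c * (q^2 + inverse q^2)^2 =
  1 + (2 + inverse q^2) * (1 - inverse q^2)^2 + (1 + q^2) * (1 - inverse q^2)^4"
proof -
  have "three_q - 1 = q^2 + inverse q^2" by (simp add: three_q_def power_int_minus power_inverse)
  then show ?thesis using q_scalars_nonzero(2)
    by (simp add: coeff_c_def power_int_minus power_inverse)
qed

text \<open>This and the next two are the matrices, on the image of \<open>F\<close>, of the terms
  of \<open>Phi\<close> with the coefficients \<open>coeff_a\<close>, \<open>coeff_d\<close> and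
  \<open>coeff_c\<close>, in this order.\<close>

definition MM :: "vbasis \<Rightarrow> vbasis \<Rightarrow> vbasis \<Rightarrow> vbasis \<Rightarrow> qfield"
  where "MM i j k l = (\<Sum>x\<in>UNIV. \<Sum>y\<in>UNIV. M_table i j x y * M_table x y k l)"

definition MKM :: "vbasis \<Rightarrow> vbasis \<Rightarrow> vbasis \<Rightarrow> vbasis \<Rightarrow> qfield"
  where "MKM i j k l = (\<Sum>x\<in>UNIV. \<Sum>y\<in>UNIV. (\<Sum>u\<in>UNIV. \<Sum>v\<in>UNIV. M_table i j u v * K_table u v x y) * M_table x y k l)"

definition MNM :: "vbasis \<Rightarrow> vbasis \<Rightarrow> vbasis \<Rightarrow> vbasis \<Rightarrow> qfield"
  where "MNM i j k l = (\<Sum>x\<in>UNIV. \<Sum>y\<in>UNIV. (\<Sum>u\<in>UNIV. \<Sum>v\<in>UNIV. M_table i j u v * N_table u v x y) * M_table x y k l)"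

text \<open>Here the values of the four coefficients enter, through an identity of 9 by 9 matrices.
  Multiplying by the denominator of \<open>coeff_c\<close> leaves an identity in \<open>q\<close>,
  its inverse and \<open>tau\<close> that \<open>scalar_norm\<close> decides entry by entry.\<close>

lemma Phi_table:
  "coeff_a * MM i j k l - coeff_b * (if i = k \<and> j = l then 1 else 0) - coeff_c * MNM i j k l + coeff_d * MKM i j k l = 0"
proof -
  let ?n = "1 + (2 + inverse q^2) * (1 - inverse q^2)^2 + (1 + q^2) * (1 - inverse q^2)^4"
  have a: "coeff_a = 1 + (1 - inverse q^2)^2" and b: "coeff_b = 1 + (1 - q^2)^2 + (1 - inverse q^2)^2"
    and d: "coeff_d = (q - inverse q)^2"
    by (simp_all add: coeff_a_def coeff_b_def coeff_d_def power_int_minus power_inverse)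
  have "(q^2 + inverse q^2)^2 * (coeff_a * MM i j k l - coeff_b * (if i = k \<and> j = l then 1 else 0) + coeff_d * MKM i j k l)
      = ?n * MNM i j k l"
    unfolding a b d MM_def MKM_def MNM_def
    by (cases i; cases j; cases k; cases l; simp add: sum_vbasis; (simp add: scalar_norm)?)
  then have "(q^2 + inverse q^2)^2 * (coeff_a * MM i j k l - coeff_b * (if i = k \<and> j = l then 1 else 0)
      + coeff_d * MKM i j k l - coeff_c * MNM i j k l) = 0"
    by (simp add: right_diff_distrib coeff_c_eq[symmetric])
  then have "coeff_a * MM i j k l - coeff_b * (if i = k \<and> j = l then 1 else 0)
      + coeff_d * MKM i j k l - coeff_c * MNM i j k l = 0"
    using q_scalars_nonzero(2) by (metis mult_eq_0_iff power_not_zero)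
  then show ?thesis by (simp add: algebra_simps)
qed

lemma lincomb_eqI: "(\<And>x y. m x y = n x y) \<Longrightarrow> lincomb B m = lincomb B n"
  by (simp add: lincomb_def)

lemma lincomb_delta: "lincomb B (\<lambda>x y. if i = x \<and> j = y then 1 else 0) = B i j"
  by (cases i; cases j) (simp_all add: lincomb_def sum_vbasis sc_1)

text \<open>The rightmost factors of \<open>e14\<close> and \<open>e1234\<close>, the inverse of
  \<open>g 1\<close> and \<open>g 3\<close>, are omitted: their scalars on \<open>weight22\<close>
  cancel each other. \<open>Phi_local\<close> puts them back.\<close>

lemma Phi_weight22:
  "sc coeff_a * proj2 (local_op cupcap 2 (weight22 i j)) - sc coeff_b * weight22 i j
    - sc coeff_c * proj2 (local_op cupcap 2 (local_op ibraiding 3 (local_op braiding 1 (local_op cupcap 2 (weight22 i j)))))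
    + sc coeff_d * proj2 (local_op cupcap 2 (local_op braiding 1 (local_op ibraiding 3 (local_op braiding 2 (weight22 i j))))) = 0"
proof -
  have P: "proj2 (lincomb cup_between n) = lincomb weight22 (\<lambda>k l. \<Sum>x\<in>UNIV. \<Sum>y\<in>UNIV. n x y * M_table x y k l)" for n
    by (rule local_op_lincomb[of proj2]) (simp_all only: proj2_add proj2_sc proj2_cup_between)
  have N: "local_op cupcap 2 (local_op ibraiding 3 (local_op braiding 1 (lincomb cup_between n))) =
      lincomb cup_between (\<lambda>x y. \<Sum>u\<in>UNIV. \<Sum>v\<in>UNIV. n u v * N_table u v x y)" for n
    by (rule local_op_lincomb[of "\<lambda>v. local_op cupcap 2 (local_op ibraiding 3 (local_op braiding 1 v))"])
      (simp_all only: local_op_add local_op_sc cupcap_cup_between)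
  have K: "local_op cupcap 2 (local_op braiding 1 (local_op cupcap 3 (lincomb cup_between n))) =
      lincomb cup_between (\<lambda>x y. \<Sum>u\<in>UNIV. \<Sum>v\<in>UNIV. n u v * K_table u v x y)" for n
    by (rule local_op_lincomb[of "\<lambda>v. local_op cupcap 2 (local_op braiding 1 (local_op cupcap 3 v))"])
      (simp_all only: local_op_add local_op_sc cupcap_braiding_cup_between)
  have 1: "proj2 (local_op cupcap 2 (weight22 i j)) = lincomb weight22 (MM i j)"
    unfolding cupcap_weight22 P MM_def ..
  have 2: "proj2 (local_op cupcap 2 (local_op ibraiding 3 (local_op braiding 1 (local_op cupcap 2 (weight22 i j))))) = lincomb weight22 (MNM i j)"
    unfolding cupcap_weight22 N P MNM_def ..
  have 3: "proj2 (local_op cupcap 2 (local_op braiding 1 (local_op ibraiding 3 (local_op braiding 2 (weight22 i j))))) = lincomb weight22 (MKM i j)"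
    unfolding e1234_weight22 cupcap_weight22 K P MKM_def ..
  have 4: "weight22 i j = lincomb weight22 (\<lambda>k l. if i = k \<and> j = l then 1 else 0)" by (rule lincomb_delta[symmetric])
  show ?thesis
    unfolding 1 2 3 by (subst 4) (simp only: lincomb_sc lincomb_diff lincomb_add Phi_table lincomb_0)
qed

lemma Phi_local:
  assumes "v \<in> tensor_power 4"
  shows "sc coeff_a * proj2 (local_op cupcap 2 (proj2 v)) - sc coeff_b * proj2 v
    - sc coeff_c * proj2 (local_op cupcap 2 (local_op ibraiding 3 (local_op braiding 1 (local_op cupcap 2
        (local_op ibraiding 1 (local_op braiding 3 (proj2 v)))))))
    + sc coeff_d * proj2 (local_op cupcap 2 (local_op braiding 1 (local_op ibraiding 3 (local_op braiding 2
        (local_op ibraiding 1 (local_op braiding 3 (proj2 v))))))) = 0"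
proof -
  let ?\<Phi> = "\<lambda>y. sc coeff_a * proj2 (local_op cupcap 2 y) - sc coeff_b * y
    - sc coeff_c * proj2 (local_op cupcap 2 (local_op ibraiding 3 (local_op braiding 1 (local_op cupcap 2 y))))
    + sc coeff_d * proj2 (local_op cupcap 2 (local_op braiding 1 (local_op ibraiding 3 (local_op braiding 2 y))))"
  obtain n where n: "proj2 v = lincomb weight22 n" using proj2_lincomb[OF assms] by blast
  have "local_op ibraiding 1 (local_op braiding 3 (weight22 i j)) = lincomb weight22 (\<lambda>k l. if i = k \<and> j = l then 1 else 0)" for i j
  proof -
    have "local_op ibraiding 1 (local_op braiding 3 (weight22 i j)) = sc (- (inverse q^2) * - (q^2)) * weight22 i j"
      by (simp only: local_op_weight22 local_op_sc sc_sc)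
    also have "- (inverse q^2) * - (q^2) = 1" by (simp add: power_inverse)
    finally show ?thesis by (simp add: sc_1 lincomb_delta)
  qed
  then have "local_op ibraiding 1 (local_op braiding 3 (lincomb weight22 n)) =
      lincomb weight22 (\<lambda>k l. \<Sum>i\<in>UNIV. \<Sum>j\<in>UNIV. n i j * (if i = k \<and> j = l then 1 else 0))"
    by (intro local_op_lincomb[of "\<lambda>v. local_op ibraiding 1 (local_op braiding 3 v)"]) (simp_all only: local_op_add local_op_sc)
  also have "\<dots> = lincomb weight22 n"
    by (rule lincomb_eqI) (case_tac x; case_tac y; simp add: sum_vbasis)
  finally have id: "local_op ibraiding 1 (local_op braiding 3 (lincomb weight22 n)) = lincomb weight22 n" .
  have "?\<Phi> (lincomb weight22 n) = lincomb weight22 (\<lambda>k l. \<Sum>i\<in>UNIV. \<Sum>j\<in>UNIV. n i j * 0)"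
  proof (rule local_op_lincomb[of ?\<Phi>])
    show "?\<Phi> (weight22 i j) = lincomb weight22 (\<lambda>k l. 0)" for i j unfolding Phi_weight22 lincomb_0 ..
    show "?\<Phi> (u + v) = ?\<Phi> u + ?\<Phi> v" for u v
      by (simp only: local_op_add distrib_left add_diff_add) (simp add: algebra_simps)
    show "?\<Phi> (sc a * v) = sc a * ?\<Phi> v" for a v
      by (simp only: local_op_sc sc_left_comm[of "sc coeff_a"] sc_left_comm[of "sc coeff_b"]
          sc_left_comm[of "sc coeff_c"] sc_left_comm[of "sc coeff_d"] distrib_left right_diff_distrib)
  qed
  then show ?thesis unfolding n id by (simp add: lincomb_0)
qed

section \<open>Presented algebras\<close>

lemma free_algebra_simps:
  "p \<in> carrier (free_algebra X) \<longleftrightarrow> (\<forall>w\<in>Poly_Mapping.keys p. set w \<subseteq> X)"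
  "mult (free_algebra X) = (*)" "one (free_algebra X) = 1" "zero (free_algebra X) = 0"
  "add (free_algebra X) = (+)" "smult (free_algebra X) = (\<lambda>c p. sc c * p)"
  by (simp_all add: free_algebra_def)

lemma free_algebra_sc: "sc c \<in> carrier (free_algebra X)"
  by (simp add: free_algebra_simps)

lemma free_algebra_one: "1 \<in> carrier (free_algebra X)"
  using free_algebra_sc[of 1 X] by (simp add: sc_1)

lemma free_algebra_zero: "0 \<in> carrier (free_algebra X)"
  by (simp add: free_algebra_simps)

lemma free_algebra_letter: "x \<in> X \<Longrightarrow> letter x \<in> carrier (free_algebra X)"
  by (simp add: free_algebra_simps)

lemma free_algebra_add:
  "p \<in> carrier (free_algebra X) \<Longrightarrow> p' \<in> carrier (free_algebra X) \<Longrightarrow> p + p' \<in> carrier (free_algebra X)"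
  using ring.ring_simprules(1)[OF ring_free_algebra, of p X p'] by (simp add: free_algebra_def)

lemma free_algebra_mult:
  "p \<in> carrier (free_algebra X) \<Longrightarrow> p' \<in> carrier (free_algebra X) \<Longrightarrow> p * p' \<in> carrier (free_algebra X)"
  using ring.ring_simprules(5)[OF ring_free_algebra, of p X p'] by (simp add: free_algebra_def)

lemma free_algebra_uminus: "p \<in> carrier (free_algebra X) \<Longrightarrow> - p \<in> carrier (free_algebra X)"
  by (simp add: free_algebra_simps in_keys_iff)

lemma free_algebra_diff:
  "p \<in> carrier (free_algebra X) \<Longrightarrow> p' \<in> carrier (free_algebra X) \<Longrightarrow> p - p' \<in> carrier (free_algebra X)"
  using free_algebra_add[OF _ free_algebra_uminus, of p X p'] by simp

lemmas free_algebra_closed = free_algebra_sc free_algebra_one free_algebra_zero free_algebra_letter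
  free_algebra_add free_algebra_mult free_algebra_uminus free_algebra_diff

text \<open>Letters are added on the left, in step with the rules of the inductive set
  \<open>A\<close>.\<close>

lemma free_algebra_induct [consumes 1, case_names zero one letter_mult sc add]:
  assumes "p \<in> carrier (free_algebra X)" and "P 0" "P 1"
    and letter: "\<And>x p. x \<in> X \<Longrightarrow> p \<in> carrier (free_algebra X) \<Longrightarrow> P p \<Longrightarrow> P (letter x * p)"
    and sc: "\<And>c p. p \<in> carrier (free_algebra X) \<Longrightarrow> P p \<Longrightarrow> P (sc c * p)"
    and add: "\<And>p p'. p \<in> carrier (free_algebra X) \<Longrightarrow> p' \<in> carrier (free_algebra X) \<Longrightarrow> P p \<Longrightarrow> P p' \<Longrightarrow> P (p + p')"
  shows "P p"
proof -
  have word: "P (word w) \<and> word w \<in> carrier (free_algebra X)" if "set w \<subseteq> X" for w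
    using that
  proof (induction w)
    case Nil
    then show ?case using assms(3) free_algebra_one by (simp add: sc_1)
  next
    case (Cons x w)
    then show ?case using letter[of x "word w"] by (simp add: word_Cons[of x w] free_algebra_closed del: single_mult)
  qed
  let ?s = "\<lambda>w. sc (Poly_Mapping.lookup p w) * word w"
  have sum: "P (\<Sum>w\<in>B. ?s w) \<and> (\<Sum>w\<in>B. ?s w) \<in> carrier (free_algebra X)"
    if "finite B" "B \<subseteq> Poly_Mapping.keys p" for B
    using that
  proof (induction B rule: finite_induct)
    case empty
    show ?case using assms(2) by (simp add: free_algebra_zero)
  next
    case (insert w B)
    then have "set w \<subseteq> X" using assms(1) by (auto simp: free_algebra_simps)
    then have "P (?s w)" "?s w \<in> carrier (free_algebra X)" using sc[OF conjunct2[OF word] conjunct1[OF word]] free_algebra_mult[OF free_algebra_sc conjunct2[OF word]] by blast+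
    moreover have "P (sum ?s B) \<and> sum ?s B \<in> carrier (free_algebra X)"
      using insert(4) by (intro insert(3)) simp
    ultimately have "P (?s w + sum ?s B) \<and> ?s w + sum ?s B \<in> carrier (free_algebra X)"
      using add[of "?s w" "sum ?s B"] free_algebra_add[of "?s w" X "sum ?s B"] by (elim conjE) (intro conjI)
    then show ?case by (simp only: sum.insert[OF insert(1,2)])
  qed
  have eq: "p = (\<Sum>w\<in>Poly_Mapping.keys p. ?s w)"
    by (rule poly_mapping_eqI) (simp add: lookup_sum single_mult lookup_single when_def in_keys_iff)
  show ?thesis by (subst eq) (rule conjunct1[OF sum[OF finite_keys order_refl]])
qed

text \<open>Replaces cosets by congruences \<open>p - p' \<in> Rel\<close>, so that calculations
  take place with polynomials. It is used both for the BMW relations alone and with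
  \<open>Phi\<close> added.\<close>

locale presentation =
  fixes X :: "'x set" and S :: "'x ncpoly set"
  assumes S: "S \<subseteq> carrier (free_algebra X)"
begin

abbreviation "FA \<equiv> free_algebra X"
abbreviation "QA \<equiv> presented_algebra X S"
abbreviation "cls \<equiv> pclass X S"

sublocale FA: ring FA by (rule ring_free_algebra)

definition Rel :: "'x ncpoly set" where "Rel = Idl\<^bsub>FA\<^esub> S"

lemma Rel_ideal: "ideal Rel FA"
  unfolding Rel_def by (rule FA.genideal_ideal[OF S])

lemma S_Rel: "S \<subseteq> Rel"
  unfolding Rel_def by (rule FA.genideal_self[OF S])

lemma Rel_zero: "0 \<in> Rel"
  using additive_subgroup.zero_closed[OF ideal.axioms(1)[OF Rel_ideal]] by (simp add: free_algebra_simps)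

lemma Rel_add: "p \<in> Rel \<Longrightarrow> p' \<in> Rel \<Longrightarrow> p + p' \<in> Rel"
  using additive_subgroup.a_closed[OF ideal.axioms(1)[OF Rel_ideal], of p p'] by (simp add: free_algebra_simps)

lemma Rel_left: "p \<in> Rel \<Longrightarrow> a \<in> carrier FA \<Longrightarrow> a * p \<in> Rel"
  using ideal.I_l_closed[OF Rel_ideal, of p a] by (simp add: free_algebra_simps(2))

lemma Rel_sc: "p \<in> Rel \<Longrightarrow> sc c * p \<in> Rel"
  by (intro Rel_left free_algebra_sc)

lemma Rel_uminus: "p \<in> Rel \<Longrightarrow> - p \<in> Rel"
  using Rel_sc[of p "-1"] by (simp add: single_uminus sc_1)

lemma Rel_diff: "p \<in> Rel \<Longrightarrow> p' \<in> Rel \<Longrightarrow> p - p' \<in> Rel"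
  using Rel_add[OF _ Rel_uminus, of p p'] by simp

lemma cls_def': "cls p = (\<lambda>i. i + p) ` Rel"
  unfolding pclass_def Rel_def a_r_coset_def' free_algebra_simps(5) by blast

lemma cls_eq_iff: "cls p = cls p' \<longleftrightarrow> p - p' \<in> Rel"
proof
  assume eq: "cls p = cls p'"
  have "0 + p \<in> cls p" unfolding cls_def' using Rel_zero by (rule imageI)
  then have "0 + p \<in> (\<lambda>i. i + p') ` Rel" unfolding eq cls_def'[symmetric] .
  then obtain i where "i \<in> Rel" "0 + p = i + p'" by (rule imageE) auto
  then show "p - p' \<in> Rel" by simp
next
  assume d: "p - p' \<in> Rel"
  have "i + p \<in> (\<lambda>i. i + p') ` Rel" if "i \<in> Rel" for i
    using Rel_add[OF that d] by (intro image_eqI[of _ _ "i + (p - p')"]) simp_all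
  moreover have "i + p' \<in> (\<lambda>i. i + p) ` Rel" if "i \<in> Rel" for i
    using Rel_diff[OF that d] by (intro image_eqI[of _ _ "i - (p - p')"]) simp_all
  ultimately show "cls p = cls p'" unfolding cls_def' by blast
qed

lemma QA_carrier: "carrier QA = cls ` carrier FA"
proof -
  have "carrier QA = a_rcosets\<^bsub>FA\<^esub> Rel"
    by (simp add: presented_algebra_def quot_algebra_def FactRing_def Rel_def)
  then show ?thesis unfolding A_RCOSETS_def' pclass_def Rel_def by blast
qed

lemma QA_zero: "zero QA = cls 0"
  by (simp add: presented_algebra_def quot_algebra_def FactRing_def cls_def' flip: Rel_def)

lemma QA_one: "one QA = cls 1"
  by (simp add: presented_algebra_def quot_algebra_def FactRing_def pclass_def free_algebra_simps(3))

lemma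
  assumes p: "p \<in> carrier FA" "p' \<in> carrier FA"
  shows QA_add: "cls p \<oplus>\<^bsub>QA\<^esub> cls p' = cls (p + p')"
    and QA_mult: "cls p \<otimes>\<^bsub>QA\<^esub> cls p' = cls (p * p')"
  using abelian_subgroup.a_rcos_sum[OF abelian_subgroupI3[OF ideal.axioms(1)[OF Rel_ideal] FA.is_abelian_group] p]
    ideal.rcoset_mult_add[OF Rel_ideal p]
  by (simp_all add: presented_algebra_def quot_algebra_def FactRing_def pclass_def free_algebra_simps(2,5) flip: Rel_def)

text \<open>The union over representatives in the definition collapses, because \<open>Rel\<close>
  is stable under scalars.\<close>

lemma QA_smult: "t \<odot>\<^bsub>QA\<^esub> cls p = cls (sc t * p)"
proof -
  have "t \<odot>\<^bsub>QA\<^esub> cls p = (\<Union>y\<in>cls p. cls (sc t * y))"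
    by (simp add: presented_algebra_def quot_algebra_def pclass_def free_algebra_simps(6))
  moreover have "cls (sc t * y) = cls (sc t * p)" if "y \<in> cls p" for y
    using that Rel_sc unfolding cls_eq_iff by (auto simp: cls_def' distrib_left)
  moreover have "p \<in> cls p" unfolding cls_def' using Rel_zero by force
  ultimately show ?thesis by blast
qed

lemma ring_QA: "ring QA"
proof (rule ringI)
  note ops = QA_carrier QA_zero QA_one QA_add QA_mult free_algebra_closed
  show "abelian_group QA"
  proof (rule abelian_groupI)
    fix x assume "x \<in> carrier QA"
    then obtain p where "p \<in> carrier FA" "x = cls p" unfolding QA_carrier by blast
    then show "\<exists>y\<in>carrier QA. y \<oplus>\<^bsub>QA\<^esub> x = \<zero>\<^bsub>QA\<^esub>"
      unfolding QA_carrier by (intro bexI[of _ "cls (- p)"] imageI) (simp_all add: ops)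
  qed (unfold QA_carrier, auto simp: ops add_ac)
  show "monoid QA"
    by (rule monoidI; unfold QA_carrier) (auto simp: ops mult.assoc)
qed (unfold QA_carrier, auto simp: QA_add QA_mult free_algebra_closed distrib_left distrib_right)

end

lemma bmw_rels_carrier: "bmw_rels r \<subseteq> carrier (free_algebra (bmw_gens r))"
proof -
  have "bmw_g i \<in> carrier (free_algebra (bmw_gens r))" "bmw_ginv i \<in> carrier (free_algebra (bmw_gens r))"
    "bmw_e i \<in> carrier (free_algebra (bmw_gens r))" if "i \<in> {1..<r}" for i
    using that by (auto intro!: free_algebra_letter simp: bmw_gens_def simp del: atLeastLessThan_iff)
  then show ?thesis
    unfolding bmw_rels_def
    by (auto intro!: free_algebra_diff free_algebra_mult free_algebra_one free_algebra_sc
        simp del: atLeastLessThan_iff single_diff)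
qed

lemma Phi_carrier: assumes "4 \<le> r" shows "Phi \<in> carrier (free_algebra (bmw_gens r))"
proof -
  have "bmw_g i \<in> carrier (free_algebra (bmw_gens r))" "bmw_ginv i \<in> carrier (free_algebra (bmw_gens r))"
    "bmw_e i \<in> carrier (free_algebra (bmw_gens r))" if "i \<in> {1, 2, 3}" for i
    using that assms by (intro free_algebra_letter; force simp: bmw_gens_def)+
  then show ?thesis
    unfolding Phi_def bmw_F_def e14_def e1234_def bmw_f_def
    by (intro free_algebra_add free_algebra_diff free_algebra_mult free_algebra_uminus free_algebra_sc) simp_all
qed

section \<open>The local operators satisfy the relations that determine the images of the
  generators\<close>

lemma local_op_inverse:
  assumes "y \<in> tensor_power 4" "i \<in> {1, 2, 3}"
  shows "local_op braiding i (local_op ibraiding i y) = y"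
proof -
  have "local_op braiding i (local_op ibraiding i y) = id y"
  proof (rule local_op_ext[OF assms(1)])
    fix a b d e :: vbasis
    have 1: "local_op braiding 1 (local_op ibraiding 1 (word [a, b, d, e])) = word [a, b, d, e]"
      by (rule poly_mapping_eqI; cases a; cases b; simp add: local_op_simps expand_simps; (simp add: scalar_norm)?)
    have 2: "local_op braiding 2 (local_op ibraiding 2 (word [a, b, d, e])) = word [a, b, d, e]"
      by (rule poly_mapping_eqI; cases b; cases d; simp add: local_op_simps expand_simps; (simp add: scalar_norm)?)
    have 3: "local_op braiding 3 (local_op ibraiding 3 (word [a, b, d, e])) = word [a, b, d, e]"
      by (rule poly_mapping_eqI; cases d; cases e; simp add: local_op_simps expand_simps; (simp add: scalar_norm)?)
    show "local_op braiding i (local_op ibraiding i (word [a, b, d, e])) = id (word [a, b, d, e])"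
      using 1 2 3 assms(2) by (elim insertE emptyE) (simp_all only: id_apply)
  qed (simp_all only: local_op_add local_op_sc id_apply)
  then show ?thesis by simp
qed

lemma local_op_cupcap:
  assumes "y \<in> tensor_power 4" "i \<in> {1, 2, 3}"
  shows "local_op cupcap i y = y - sc (inverse (q^2 - inverse q^2)) * (local_op braiding i y - local_op ibraiding i y)"
proof (rule local_op_ext[OF assms(1)])
  fix a b d e :: vbasis
  let ?k = "inverse (q^2 - inverse q^2)"
  have w: "word [a, b, d, e] = word [a, b] * word [d, e]" "word [a, b, d, e] = letter a * word [b, d] * letter e"
    by (simp_all add: single_mult)
  have 1: "local_op cupcap 1 (word [a, b, d, e]) = word [a, b, d, e] -
      sc ?k * (local_op braiding 1 (word [a, b, d, e]) - local_op ibraiding 1 (word [a, b, d, e]))"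
    by (simp only: local_op_single sc_1 mult_1_left cupcap_eq)
      (simp only: w(1) left_diff_distrib right_diff_distrib[of "sc ?k"] mult.assoc)
  have 2: "local_op cupcap 2 (word [a, b, d, e]) = word [a, b, d, e] -
      sc ?k * (local_op braiding 2 (word [a, b, d, e]) - local_op ibraiding 2 (word [a, b, d, e]))"
    by (simp only: local_op_single sc_1 mult_1_left cupcap_eq)
      (simp only: w(2) left_diff_distrib right_diff_distrib mult.assoc sc_left_comm[of "letter a"])
  have 3: "local_op cupcap 3 (word [a, b, d, e]) = word [a, b, d, e] -
      sc ?k * (local_op braiding 3 (word [a, b, d, e]) - local_op ibraiding 3 (word [a, b, d, e]))"
    by (simp only: local_op_single sc_1 mult_1_left cupcap_eq)
      (simp only: w(1) right_diff_distrib mult.assoc sc_left_comm[of "word [a, b]"])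
  show "local_op cupcap i (word [a, b, d, e]) = word [a, b, d, e] -
      sc ?k * (local_op braiding i (word [a, b, d, e]) - local_op ibraiding i (word [a, b, d, e]))"
    using 1 2 3 assms(2) by (elim insertE emptyE) (simp_all only:)
next
  fix a and u v :: "vbasis ncpoly"
  let ?s = "sc (inverse (q^2 - inverse q^2))"
  show "u + v - ?s * (local_op braiding i (u + v) - local_op ibraiding i (u + v)) =
      u - ?s * (local_op braiding i u - local_op ibraiding i u) + (v - ?s * (local_op braiding i v - local_op ibraiding i v))"
    by (simp add: local_op_add algebra_simps)
  show "sc a * v - ?s * (local_op braiding i (sc a * v) - local_op ibraiding i (sc a * v)) =
      sc a * (v - ?s * (local_op braiding i v - local_op ibraiding i v))"
    by (simp only: local_op_sc right_diff_distrib sc_left_comm[of ?s])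
qed (simp_all only: local_op_add local_op_sc)

lemma local_op_proj:
  assumes "y \<in> tensor_power 4" "i \<in> {1, 3}"
  shows "local_op weight2_proj i y = sc (q^2) * y - local_op braiding i y - sc (1 - inverse q^2) * local_op cupcap i y"
proof (rule local_op_ext[OF assms(1)])
  fix a b d e :: vbasis
  have w: "word [a, b, d, e] = word [a, b] * word [d, e]" by (simp add: single_mult)
  have 1: "local_op weight2_proj 1 (word [a, b, d, e]) = sc (q^2) * word [a, b, d, e]
      - local_op braiding 1 (word [a, b, d, e]) - sc (1 - inverse q^2) * local_op cupcap 1 (word [a, b, d, e])"
    by (simp only: local_op_single sc_1 mult_1_left proj_eq) (simp only: w left_diff_distrib mult.assoc)
  have 3: "local_op weight2_proj 3 (word [a, b, d, e]) = sc (q^2) * word [a, b, d, e]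
      - local_op braiding 3 (word [a, b, d, e]) - sc (1 - inverse q^2) * local_op cupcap 3 (word [a, b, d, e])"
    by (simp only: local_op_single sc_1 mult_1_left proj_eq)
      (simp only: w right_diff_distrib[of "word [a, b]"] mult.assoc sc_left_comm[of "word [a, b]"])
  show "local_op weight2_proj i (word [a, b, d, e]) = sc (q^2) * word [a, b, d, e]
      - local_op braiding i (word [a, b, d, e]) - sc (1 - inverse q^2) * local_op cupcap i (word [a, b, d, e])"
    using 1 3 assms(2) by (elim insertE emptyE) (simp_all only:)
next
  fix a and u v :: "vbasis ncpoly"
  show "sc (q^2) * (u + v) - local_op braiding i (u + v) - sc (1 - inverse q^2) * local_op cupcap i (u + v) =
      sc (q^2) * u - local_op braiding i u - sc (1 - inverse q^2) * local_op cupcap i u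
      + (sc (q^2) * v - local_op braiding i v - sc (1 - inverse q^2) * local_op cupcap i v)"
    by (simp add: local_op_add algebra_simps)
  show "sc (q^2) * (sc a * v) - local_op braiding i (sc a * v) - sc (1 - inverse q^2) * local_op cupcap i (sc a * v) =
      sc a * (sc (q^2) * v - local_op braiding i v - sc (1 - inverse q^2) * local_op cupcap i v)"
    by (simp only: local_op_sc right_diff_distrib[of "sc a"] sc_left_comm[of "sc (q^2)"] sc_left_comm[of "sc (1 - inverse q^2)"])
qed (simp_all only: local_op_add local_op_sc)

lemma weight2_proj_tensor_power: "weight2_proj a b \<in> tensor_power 2"
  by (cases a; cases b) (simp_all add: single_mult right_diff_distrib distrib_left tensor_power_closed)

context presentation
begin

text \<open>Additive inverses need no hypothesis of their own: they are left multiples by the scalar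
  \<open>-1\<close>.\<close>

lemma Rel_minimal:
  assumes "S \<subseteq> K" "K \<subseteq> carrier FA" "0 \<in> K" and add: "\<And>p p'. p \<in> K \<Longrightarrow> p' \<in> K \<Longrightarrow> p + p' \<in> K"
    and left: "\<And>a p. a \<in> carrier FA \<Longrightarrow> p \<in> K \<Longrightarrow> a * p \<in> K"
    and right: "\<And>a p. a \<in> carrier FA \<Longrightarrow> p \<in> K \<Longrightarrow> p * a \<in> K"
  shows "Rel \<subseteq> K"
proof -
  have um: "- p \<in> K" if "p \<in> K" for p
    using left[OF free_algebra_sc that, of "-1"] by (simp add: single_uminus sc_1)
  have "\<ominus>\<^bsub>FA\<^esub> p = - p" if "p \<in> K" for p
  proof -
    have p: "p \<in> carrier FA" using that assms(2) by blast
    show ?thesis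
      by (rule FA.minus_equality) (simp_all add: free_algebra_simps(4,5) p free_algebra_uminus[OF p])
  qed
  then have inv: "inv\<^bsub>add_monoid FA\<^esub> p \<in> K" if "p \<in> K" for p
    using that um[OF that] by (simp add: a_inv_def)
  have "subgroup K (add_monoid FA)"
  proof
    show "K \<subseteq> carrier (add_monoid FA)" using assms(2) by simp
    show "x \<otimes>\<^bsub>add_monoid FA\<^esub> y \<in> K" if "x \<in> K" "y \<in> K" for x y
      using add[OF that] by (simp add: free_algebra_simps(5))
    show "\<one>\<^bsub>add_monoid FA\<^esub> \<in> K" using assms(3) by (simp add: free_algebra_simps(4))
  qed (rule inv)
  then have "ideal K FA"
    by (rule idealI[OF FA.ring_axioms]) (unfold free_algebra_simps(2), (rule left right; assumption)+)
  then show ?thesis unfolding Rel_def using assms(1) by (rule FA.genideal_minimal)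
qed

end

section \<open>The given homomorphism as an action on the \<open>r\<close>-th tensor power\<close>

locale bmw_action =
  fixes r :: nat and \<eta> :: "bmw_gen ncpoly set \<Rightarrow> vbasis ncpoly \<Rightarrow> vbasis ncpoly"
  assumes r: "4 \<le> r"
    and hom: "\<eta> \<in> algebra_hom (BMW r) (End_Uq r)"
    and R: "\<And>i. i \<in> {1..<r} \<Longrightarrow> \<eta> (bmw r (bmw_g i)) = R_matrix r i"
begin

sublocale P0: presentation "bmw_gens r" "bmw_rels r"
  by unfold_locales (rule bmw_rels_carrier)

sublocale P1: presentation "bmw_gens r" "insert Phi (bmw_rels r)"
  by unfold_locales (use bmw_rels_carrier Phi_carrier[OF r] in blast)

abbreviation "FA \<equiv> free_algebra (bmw_gens r)"
abbreviation "TP \<equiv> tensor_power r"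

text \<open>Defined on polynomials instead of cosets, so that the presentations \<open>P0\<close>
  and \<open>P1\<close>, without and with \<open>Phi\<close>, can be compared over the same free
  algebra.\<close>

definition act :: "bmw_gen ncpoly \<Rightarrow> vbasis ncpoly \<Rightarrow> vbasis ncpoly"
  where "act p = \<eta> (bmw r p)"

lemma BMW_ops: "BMW r = P0.QA" "bmw r = P0.cls"
  by (simp_all add: BMW_def bmw_def)

lemma ring_hom: "\<eta> \<in> ring_hom (BMW r) (End_Uq r)"
  using hom by (simp add: algebra_hom_def)

lemma bmw_carrier: "p \<in> carrier FA \<Longrightarrow> bmw r p \<in> carrier (BMW r)"
  by (simp add: BMW_ops P0.QA_carrier)

lemma act_carrier: "p \<in> carrier FA \<Longrightarrow> act p \<in> carrier (End_Uq r)"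
  unfolding act_def by (rule ring_hom_closed[OF ring_hom bmw_carrier])

lemma
  assumes "p \<in> carrier FA"
  shows act_ext: "act p \<in> extensional TP"
    and act_TP: "v \<in> TP \<Longrightarrow> act p v \<in> TP"
    and act_add_right: "u \<in> TP \<Longrightarrow> v \<in> TP \<Longrightarrow> act p (u + v) = act p u + act p v"
    and act_sc_right: "v \<in> TP \<Longrightarrow> act p (sc t * v) = sc t * act p v"
  using act_carrier[OF assms] by (auto simp: End_Uq_def PiE_def)

lemma
  assumes p: "p \<in> carrier FA"
  shows act_add': "p' \<in> carrier FA \<Longrightarrow> act (p + p') = act p \<oplus>\<^bsub>End_Uq r\<^esub> act p'"
    and act_mult': "p' \<in> carrier FA \<Longrightarrow> act (p * p') = act p \<otimes>\<^bsub>End_Uq r\<^esub> act p'"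
    and act_sc': "act (sc t * p) = t \<odot>\<^bsub>End_Uq r\<^esub> act p"
proof -
  show "act (p + p') = act p \<oplus>\<^bsub>End_Uq r\<^esub> act p'" if p': "p' \<in> carrier FA"
    using ring_hom_add[OF ring_hom bmw_carrier[OF p] bmw_carrier[OF p']] P0.QA_add[OF p p'] by (simp add: act_def BMW_ops)
  show "act (p * p') = act p \<otimes>\<^bsub>End_Uq r\<^esub> act p'" if p': "p' \<in> carrier FA"
    using ring_hom_mult[OF ring_hom bmw_carrier[OF p] bmw_carrier[OF p']] P0.QA_mult[OF p p'] by (simp add: act_def BMW_ops)
  show "act (sc t * p) = t \<odot>\<^bsub>End_Uq r\<^esub> act p"
  proof -
    have "\<eta> (t \<odot>\<^bsub>BMW r\<^esub> bmw r p) = t \<odot>\<^bsub>End_Uq r\<^esub> \<eta> (bmw r p)"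
      using hom bmw_carrier[OF p] unfolding algebra_hom_def by blast
    then show ?thesis using P0.QA_smult[of t p] by (simp add: act_def BMW_ops)
  qed
qed

lemma act_one': "act 1 = one (End_Uq r)"
  using ring_hom_one[OF ring_hom] by (simp add: act_def BMW_ops P0.QA_one)

lemma
  assumes "p \<in> carrier FA" "v \<in> TP"
  shows act_add: "p' \<in> carrier FA \<Longrightarrow> act (p + p') v = act p v + act p' v"
    and act_mult: "p' \<in> carrier FA \<Longrightarrow> act (p * p') v = act p (act p' v)"
    and act_sc: "act (sc t * p) v = sc t * act p v"
  using assms by (simp_all add: act_add' act_mult' act_sc' End_Uq_def compose_def)

lemma act_one: "v \<in> TP \<Longrightarrow> act 1 v = v"
  by (simp add: act_one' End_Uq_def)

lemma act_zero: "v \<in> TP \<Longrightarrow> act 0 v = 0"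
  using act_add[of 0 v 0] by (simp add: free_algebra_zero)

lemma act_scalar: "v \<in> TP \<Longrightarrow> act (sc t) v = sc t * v"
  using act_sc[of 1 v t] by (simp add: free_algebra_one act_one)

lemma act_uminus: assumes "p \<in> carrier FA" "v \<in> TP" shows "act (- p) v = - act p v"
  using act_add[OF assms free_algebra_uminus[OF assms(1)]] act_zero[OF assms(2)] by (simp add: eq_neg_iff_add_eq_0 add.commute)

lemma act_diff:
  assumes "p \<in> carrier FA" "v \<in> TP" "p' \<in> carrier FA" shows "act (p - p') v = act p v - act p' v"
  using act_add[OF assms(1,2) free_algebra_uminus[OF assms(3)]] act_uminus[OF assms(3,2)] by simp

lemmas act_simps = act_add act_mult act_sc act_diff act_uminus act_scalar act_one act_TP free_algebra_closed

lemma act_P0_Rel: assumes "p \<in> P0.Rel" "v \<in> TP" shows "act p v = 0"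
proof -
  have "P0.cls p = P0.cls 0" using assms(1) by (simp add: P0.cls_eq_iff)
  then show ?thesis using act_zero[OF assms(2)] by (simp add: act_def BMW_ops)
qed

lemma act_rel: "p \<in> bmw_rels r \<Longrightarrow> v \<in> TP \<Longrightarrow> act p v = 0"
  using act_P0_Rel P0.S_Rel by blast

lemma gens: "0 < i \<Longrightarrow> i < r \<Longrightarrow> bmw_g i \<in> carrier FA" "0 < i \<Longrightarrow> i < r \<Longrightarrow> bmw_ginv i \<in> carrier FA"
  "0 < i \<Longrightarrow> i < r \<Longrightarrow> bmw_e i \<in> carrier FA"
  by (intro free_algebra_letter; force simp: bmw_gens_def)+

lemma act_g: "0 < i \<Longrightarrow> i < r \<Longrightarrow> act (bmw_g i) = R_matrix r i"
  using R[of i] by (simp add: act_def)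

lemma act_ginv_g: assumes "0 < i" "i < r" "v \<in> TP" shows "act (bmw_ginv i) (act (bmw_g i) v) = v"
proof -
  have "bmw_ginv i * bmw_g i - 1 \<in> bmw_rels r" unfolding bmw_rels_def using assms by force
  from act_rel[OF this assms(3)] show ?thesis
    using assms gens by (simp add: act_simps del: single_mult)
qed

text \<open>The skein relation solved for \<open>e i\<close>: this is how the prescribed images of
  the \<open>g i\<close> determine the remaining ones.\<close>

lemma act_e: assumes "0 < i" "i < r" "v \<in> TP"
  shows "act (bmw_e i) v = v - sc (inverse (q^2 - inverse q^2)) * (act (bmw_g i) v - act (bmw_ginv i) v)"
proof -
  let ?k = "q^2 - inverse q^2"
  have "q powi 2 - q powi -2 = ?k" by (simp add: power_int_minus power_inverse)
  moreover have "bmw_g i - bmw_ginv i - sc (q powi 2 - q powi -2) * (1 - bmw_e i) \<in> bmw_rels r"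
    unfolding bmw_rels_def using assms by force
  ultimately have "act (bmw_g i - bmw_ginv i - sc ?k * (1 - bmw_e i)) v = 0" using act_rel assms(3) by metis
  then have "act (bmw_g i) v - act (bmw_ginv i) v = sc ?k * (v - act (bmw_e i) v)"
    using assms gens by (simp add: act_simps tensor_power_diff del: single_diff)
  then have "sc (inverse ?k) * (act (bmw_g i) v - act (bmw_ginv i) v) = sc (inverse ?k * ?k) * (v - act (bmw_e i) v)"
    by (simp only: sc_sc)
  also have "\<dots> = v - act (bmw_e i) v" using q_scalars_nonzero(1) by (simp add: sc_1)
  finally show ?thesis by simp
qed

context
  \<comment> \<open>The factors from the fifth on, which the generators in \<open>Phi\<close> do not
    touch.\<close>
  fixes z assumes z: "z \<in> tensor_power (r - 4)"
begin

lemma tensor_z: "y \<in> tensor_power 4 \<Longrightarrow> y * z \<in> TP"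
  using tensor_power_mult[OF _ z, of y 4] r by simp

lemma act_g_tensor: assumes "i \<in> {1, 2, 3}" "y \<in> tensor_power 4"
  shows "act (bmw_g i) (y * z) = local_op braiding i y * z"
proof -
  have "R_matrix (4 + (r - 4)) i (y * z) = R_matrix 4 i y * z" using assms z by (intro R_matrix_mult) auto
  moreover have "R_matrix 4 i y = local_op braiding i y" using assms by (simp add: R_matrix_def local_op_def)
  ultimately show ?thesis using assms r by (subst act_g) auto
qed

text \<open>A right inverse of the action of \<open>g i\<close> is at hand in
  \<open>ibraiding\<close>, and the relations make the action of the formal inverse a left inverse;
  so the two agree.\<close>

lemma act_ginv_tensor: assumes "i \<in> {1, 2, 3}" "y \<in> tensor_power 4"
  shows "act (bmw_ginv i) (y * z) = local_op ibraiding i y * z"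
proof -
  have y': "local_op ibraiding i y \<in> tensor_power 4" using assms by (intro local_op_closed) auto
  have "act (bmw_g i) (local_op ibraiding i y * z) = y * z"
    using act_g_tensor[OF assms(1) y'] local_op_inverse[OF assms(2,1)] by simp
  then show ?thesis using act_ginv_g[of i "local_op ibraiding i y * z"] tensor_z[OF y'] assms r by auto
qed

lemma act_e_tensor: assumes "i \<in> {1, 2, 3}" "y \<in> tensor_power 4"
  shows "act (bmw_e i) (y * z) = local_op cupcap i y * z"
proof -
  have "act (bmw_e i) (y * z) = y * z - sc (inverse (q^2 - inverse q^2)) * (local_op braiding i y * z - local_op ibraiding i y * z)"
    using act_e[of i "y * z"] act_g_tensor[OF assms] act_ginv_tensor[OF assms] tensor_z[OF assms(2)] assms(1) r by auto
  then show ?thesis unfolding local_op_cupcap[OF assms(2,1)] by (simp only: left_diff_distrib mult.assoc)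
qed

lemma act_f_tensor: assumes "i \<in> {1, 3}" "y \<in> tensor_power 4"
  shows "act (bmw_f i) (y * z) = local_op weight2_proj i y * z"
proof -
  have i: "0 < i" "i < r" "i \<in> {1, 2, 3}" using assms r by auto
  have "bmw_f i = - bmw_g i - sc (1 - inverse q^2) * bmw_e i + sc (q^2)"
    by (simp add: bmw_f_def power_int_minus power_inverse)
  then have "act (bmw_f i) (y * z) = - (local_op braiding i y * z) - sc (1 - inverse q^2) * (local_op cupcap i y * z) + sc (q^2) * (y * z)"
    using i gens tensor_z[OF assms(2)] tensor_z[OF local_op_closed(3)[OF assms(2) i(3)]] act_g_tensor[OF i(3) assms(2)] act_e_tensor[OF i(3) assms(2)]
    by (simp add: act_simps del: single_diff)
  also have "\<dots> = local_op weight2_proj i y * z"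
    unfolding local_op_proj[OF assms(2,1)] by (simp only: left_diff_distrib mult.assoc) simp
  finally show ?thesis .
qed

lemma act_Phi_tensor: assumes y: "y \<in> tensor_power 4" shows "act Phi (y * z) = 0"
proof -
  have i: "0 < (1::nat)" "1 < r" "0 < (2::nat)" "2 < r" "0 < (3::nat)" "3 < r" using r by auto
  note g = gens(1)[OF i(1,2)] gens(1)[OF i(3,4)] gens(1)[OF i(5,6)] gens(2)[OF i(1,2)] gens(2)[OF i(3,4)]
    gens(2)[OF i(5,6)] gens(3)[OF i(1,2)] gens(3)[OF i(3,4)] gens(3)[OF i(5,6)]
  have f: "bmw_f 1 \<in> carrier FA" "bmw_f 3 \<in> carrier FA"
    unfolding bmw_f_def by (intro free_algebra_add free_algebra_diff free_algebra_mult free_algebra_uminus free_algebra_sc g)+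
  have F: "bmw_F \<in> carrier FA" "e14 \<in> carrier FA" "e1234 \<in> carrier FA"
    unfolding bmw_F_def e14_def e1234_def by (intro free_algebra_mult f g)+
  have closed: "local_op braiding i u \<in> tensor_power 4" "local_op ibraiding i u \<in> tensor_power 4"
    "local_op cupcap i u \<in> tensor_power 4" "local_op weight2_proj i u \<in> tensor_power 4"
    if "u \<in> tensor_power 4" "i \<in> {1, 2, 3}" for u i
    using that by (intro local_op_closed local_op_tensor_power[OF _ _ weight2_proj_tensor_power]; simp)+
  have actF: "act bmw_F (u * z) = proj2 u * z" "proj2 u \<in> tensor_power 4" if "u \<in> tensor_power 4" for u
    using that f act_f_tensor closed tensor_z by (simp_all add: bmw_F_def act_mult)
  have act14: "act e14 (u * z) = local_op ibraiding 3 (local_op braiding 1 (local_op cupcap 2 (local_op ibraiding 1 (local_op braiding 3 u)))) * z"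
    if "u \<in> tensor_power 4" for u
    unfolding e14_def using that g
    by (simp add: act_mult free_algebra_mult tensor_z closed act_TP act_g_tensor act_ginv_tensor act_e_tensor del: single_mult)
  have act1234: "act e1234 (u * z) = local_op cupcap 2 (local_op braiding 1 (local_op ibraiding 3 (local_op braiding 2 (local_op ibraiding 1 (local_op braiding 3 u))))) * z"
    if "u \<in> tensor_power 4" for u
    unfolding e1234_def using that g
    by (simp add: act_mult free_algebra_mult tensor_z closed act_TP act_g_tensor act_ginv_tensor act_e_tensor del: single_mult)
  have "act Phi (y * z) = sc coeff_a * (proj2 (local_op cupcap 2 (proj2 y)) * z) - sc coeff_b * (proj2 y * z)
    - sc coeff_c * (proj2 (local_op cupcap 2 (local_op ibraiding 3 (local_op braiding 1 (local_op cupcap 2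
        (local_op ibraiding 1 (local_op braiding 3 (proj2 y))))))) * z)
    + sc coeff_d * (proj2 (local_op cupcap 2 (local_op braiding 1 (local_op ibraiding 3 (local_op braiding 2
        (local_op ibraiding 1 (local_op braiding 3 (proj2 y))))))) * z)"
    unfolding Phi_def using y F g
    by (simp add: act_simps actF act14 act1234 act_e_tensor tensor_z closed del: single_mult single_diff)
  also have "\<dots> = 0"
    using arg_cong[OF Phi_local[OF y], of "\<lambda>v. v * z"]
    by (simp only: left_diff_distrib distrib_right mult.assoc mult_zero_left)
  finally show ?thesis .
qed

end

lemma act_Phi: assumes "v \<in> TP" shows "act Phi v = 0"
  using assms
proof (induction rule: tensor_power_induct)
  case zero
  show ?case using act_sc_right[OF Phi_carrier[OF r], of 0 0] by (simp add: tensor_power_zero)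
next
  case (single w t)
  have "Poly_Mapping.single w t = Poly_Mapping.single (take 4 w) t * word (drop 4 w)" by (simp add: single_mult)
  then show ?case using single r act_Phi_tensor[of "word (drop 4 w)" "Poly_Mapping.single (take 4 w) t"]
    by (simp add: tensor_power_single)
next
  case (add u v)
  then show ?case using act_add_right[OF Phi_carrier[OF r]] by simp
qed

lemma act_0: "p \<in> carrier FA \<Longrightarrow> act p 0 = 0"
  using act_sc_right[of p 0 0] by (simp add: tensor_power_zero)

lemma act_Rel: assumes "p \<in> P1.Rel" "v \<in> TP" shows "act p v = 0"
proof -
  have "P1.Rel \<subseteq> {p \<in> carrier FA. \<forall>v\<in>TP. act p v = 0}"
  proof (rule P1.Rel_minimal)
    show "insert Phi (bmw_rels r) \<subseteq> {p \<in> carrier FA. \<forall>v\<in>TP. act p v = 0}"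
      using bmw_rels_carrier Phi_carrier[OF r] act_rel act_Phi by auto
  qed (auto simp: free_algebra_add free_algebra_mult free_algebra_zero act_add act_mult act_zero act_TP act_0)
  then show ?thesis using assms by blast
qed

lemma act_eqI: assumes "p \<in> carrier FA" "p' \<in> carrier FA" "\<And>v. v \<in> TP \<Longrightarrow> act p v = act p' v"
  shows "act p = act p'"
  by (rule extensionalityI[OF act_ext[OF assms(1)] act_ext[OF assms(2)] assms(3)])

lemma act_cong: assumes "p - p' \<in> P1.Rel" "p \<in> carrier FA" "p' \<in> carrier FA" shows "act p = act p'"
  using act_Rel[OF assms(1)] assms(2,3) by (intro act_eqI) (auto simp: act_diff)

lemma End_zero_iff: assumes "p \<in> carrier FA" shows "act p = zero (End_Uq r) \<longleftrightarrow> (\<forall>v\<in>TP. act p v = 0)"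
proof
  assume "\<forall>v\<in>TP. act p v = 0"
  then show "act p = zero (End_Uq r)"
    unfolding End_Uq_def by (intro extensionalityI[OF act_ext[OF assms]]) auto
qed (simp add: End_Uq_def)

text \<open>The converse of \<open>act_Rel\<close>: the quotient by \<open>Phi\<close> acts
  faithfully. Both halves of the theorem are derived from it.\<close>

definition faithful :: bool
  where "faithful \<longleftrightarrow> (\<forall>p\<in>carrier FA. (\<forall>v\<in>TP. act p v = 0) \<longrightarrow> p \<in> P1.Rel)"

text \<open>Ideals are compared in the free algebra. The polynomials whose class lies in the ideal
  generated by that of \<open>Phi\<close> form an ideal containing all relations and
  \<open>Phi\<close>, hence \<open>P1.Rel\<close>, hence by faithfulness everything that acts as
  zero.\<close>

lemma kernel_generated:
  assumes faithful shows "a_kernel (BMW r) (End_Uq r) \<eta> = Idl\<^bsub>BMW r\<^esub> {bmw r Phi}"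
proof
  interpret B: ring "BMW r" using P0.ring_QA by (simp add: BMW_ops)
  have Phi: "Phi \<in> carrier FA" by (rule Phi_carrier[OF r])
  have BPhi: "{bmw r Phi} \<subseteq> carrier (BMW r)" using bmw_carrier[OF Phi] by simp
  let ?J = "Idl\<^bsub>BMW r\<^esub> {bmw r Phi}"
  interpret J: ideal ?J "BMW r" by (rule B.genideal_ideal[OF BPhi])
  let ?K = "{p \<in> carrier FA. bmw r p \<in> ?J}"
  have bmw_ops: "bmw r (p + p') = bmw r p \<oplus>\<^bsub>BMW r\<^esub> bmw r p'" "bmw r (p * p') = bmw r p \<otimes>\<^bsub>BMW r\<^esub> bmw r p'"
    if "p \<in> carrier FA" "p' \<in> carrier FA" for p p'
    using that by (simp_all add: BMW_ops P0.QA_add P0.QA_mult)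
  have zero: "bmw r 0 = zero (BMW r)" by (simp add: BMW_ops P0.QA_zero)
  show "a_kernel (BMW r) (End_Uq r) \<eta> \<subseteq> ?J"
  proof
    fix x assume "x \<in> a_kernel (BMW r) (End_Uq r) \<eta>"
    then have x: "x \<in> carrier (BMW r)" "\<eta> x = zero (End_Uq r)" by (simp_all add: a_kernel_def')
    then obtain p where p: "p \<in> carrier FA" "x = bmw r p" by (auto simp: BMW_ops P0.QA_carrier)
    then have "p \<in> P1.Rel" using assms x(2) End_zero_iff[OF p(1)] unfolding faithful_def act_def by blast
    have "bmw r p' = zero (BMW r)" if "p' \<in> bmw_rels r" for p'
    proof -
      have "p' - 0 \<in> P0.Rel" using that P0.S_Rel by auto
      then show ?thesis unfolding zero[symmetric] BMW_ops(2) P0.cls_eq_iff .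
    qed
    then have S: "insert Phi (bmw_rels r) \<subseteq> ?K"
      using bmw_rels_carrier Phi B.genideal_self[OF BPhi] J.zero_closed by auto
    have "P1.Rel \<subseteq> ?K"
    proof (rule P1.Rel_minimal[OF S])
      show "0 \<in> ?K" using J.zero_closed by (simp add: zero free_algebra_zero)
    next
      fix p p' assume "p \<in> ?K" "p' \<in> ?K"
      then show "p + p' \<in> ?K" by (simp add: J.a_closed bmw_ops free_algebra_add)
    next
      fix a p assume a: "a \<in> carrier FA" "p \<in> ?K"
      then show "a * p \<in> ?K" "p * a \<in> ?K"
        using bmw_carrier[OF a(1)] by (simp_all add: J.I_l_closed J.I_r_closed bmw_ops free_algebra_mult)
    qed blast
    then show "x \<in> ?J" using p \<open>p \<in> P1.Rel\<close> by blast
  qed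
  let ?N = "a_kernel (BMW r) (End_Uq r) \<eta>"
  have N: "x \<in> ?N \<longleftrightarrow> (\<exists>p\<in>carrier FA. x = bmw r p \<and> (\<forall>v\<in>TP. act p v = 0))" for x
    using End_zero_iff by (auto simp: a_kernel_def' BMW_ops P0.QA_carrier act_def)
  have inv: "\<ominus>\<^bsub>BMW r\<^esub> bmw r p = bmw r (- p)" if "p \<in> carrier FA" for p
    by (rule B.minus_equality)
      (use that bmw_ops(1)[of "- p" p] in \<open>simp_all add: free_algebra_uminus bmw_carrier zero\<close>)
  then have inv': "inv\<^bsub>add_monoid (BMW r)\<^esub> bmw r p = bmw r (- p)" if "p \<in> carrier FA" for p
    using that by (simp add: a_inv_def)
  have "subgroup ?N (add_monoid (BMW r))"
  proof
    show "?N \<subseteq> carrier (add_monoid (BMW r))" by (simp add: a_kernel_def' subset_iff)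
    show "x \<otimes>\<^bsub>add_monoid (BMW r)\<^esub> y \<in> ?N" if xy: "x \<in> ?N" "y \<in> ?N" for x y
    proof -
      obtain p p' where "p \<in> carrier FA" "x = bmw r p" "\<forall>v\<in>TP. act p v = 0"
        "p' \<in> carrier FA" "y = bmw r p'" "\<forall>v\<in>TP. act p' v = 0" using xy unfolding N by blast
      then show ?thesis unfolding N
        by (intro bexI[of _ "p + p'"]) (simp_all add: bmw_ops act_add free_algebra_add)
    qed
    show "\<one>\<^bsub>add_monoid (BMW r)\<^esub> \<in> ?N"
      unfolding N by (intro bexI[of _ 0]) (simp_all add: zero act_zero free_algebra_zero)
    show "inv\<^bsub>add_monoid (BMW r)\<^esub> x \<in> ?N" if x: "x \<in> ?N" for x
    proof -
      obtain p where "p \<in> carrier FA" "x = bmw r p" "\<forall>v\<in>TP. act p v = 0" using x unfolding N by blast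
      then show ?thesis unfolding N
        by (intro bexI[of _ "- p"]) (simp_all add: inv' act_uminus free_algebra_uminus)
    qed
  qed
  moreover have "y \<otimes>\<^bsub>BMW r\<^esub> x \<in> ?N" "x \<otimes>\<^bsub>BMW r\<^esub> y \<in> ?N" if xy: "x \<in> ?N" "y \<in> carrier (BMW r)" for x y
  proof -
    obtain p where p: "p \<in> carrier FA" "x = bmw r p" "\<forall>v\<in>TP. act p v = 0" using xy(1) unfolding N by blast
    obtain p' where p': "p' \<in> carrier FA" "y = bmw r p'" using xy(2) by (auto simp: BMW_ops P0.QA_carrier)
    show "y \<otimes>\<^bsub>BMW r\<^esub> x \<in> ?N" unfolding N using p p'
      by (intro bexI[of _ "p' * p"]) (simp_all add: bmw_ops act_mult free_algebra_mult act_0)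
    show "x \<otimes>\<^bsub>BMW r\<^esub> y \<in> ?N" unfolding N using p p'
      by (intro bexI[of _ "p * p'"]) (simp_all add: bmw_ops act_mult act_TP free_algebra_mult)
  qed
  ultimately have "ideal ?N (BMW r)" by (intro idealI[OF B.ring_axioms])
  moreover have "bmw r Phi \<in> ?N" unfolding N using Phi act_Phi by blast
  ultimately show "?J \<subseteq> ?N" by (intro B.genideal_minimal) auto
qed

lemma presentation_iso:
  assumes faithful and surj: "\<eta> ` carrier (BMW r) = carrier (End_Uq r)"
  shows "\<exists>\<phi> \<in> algebra_hom P1.QA (End_Uq r).
    bij_betw \<phi> (carrier P1.QA) (carrier (End_Uq r)) \<and>
    (\<forall>x\<in>bmw_gens r. \<phi> (P1.cls (letter x)) = \<eta> (bmw r (letter x)))"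
proof -
  \<comment> \<open>Any representative gives the same value by \<open>act_cong\<close>, that is,
    because \<open>Phi\<close> acts as zero.\<close>
  define \<phi> where "\<phi> Z = act (SOME p. p \<in> carrier FA \<and> Z = P1.cls p)" for Z
  have \<phi>: "\<phi> (P1.cls p) = act p" if p: "p \<in> carrier FA" for p
  proof -
    let ?p = "SOME p'. p' \<in> carrier FA \<and> P1.cls p = P1.cls p'"
    have "?p \<in> carrier FA \<and> P1.cls p = P1.cls ?p" by (rule someI[of _ p]) (use p in simp)
    then have p': "P1.cls p = P1.cls ?p" "?p \<in> carrier FA" by (rule conjunct2, rule conjunct1)
    show ?thesis unfolding \<phi>_def by (rule act_cong[OF iffD1[OF P1.cls_eq_iff p'(1)] p p'(2), symmetric])
  qed
  have "\<phi> \<in> ring_hom P1.QA (End_Uq r)"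
  proof (rule ring_hom_memI)
    fix x y assume "x \<in> carrier P1.QA" "y \<in> carrier P1.QA"
    then obtain p p' where p: "p \<in> carrier FA" "x = P1.cls p" "p' \<in> carrier FA" "y = P1.cls p'"
      unfolding P1.QA_carrier by blast
    show "\<phi> x \<in> carrier (End_Uq r)" using p(1) by (simp only: p(2) \<phi> act_carrier)
    show "\<phi> (x \<otimes>\<^bsub>P1.QA\<^esub> y) = \<phi> x \<otimes>\<^bsub>End_Uq r\<^esub> \<phi> y"
      using p(1,3) by (simp only: p(2,4) P1.QA_mult \<phi> act_mult' free_algebra_mult)
    show "\<phi> (x \<oplus>\<^bsub>P1.QA\<^esub> y) = \<phi> x \<oplus>\<^bsub>End_Uq r\<^esub> \<phi> y"
      using p(1,3) by (simp only: p(2,4) P1.QA_add \<phi> act_add' free_algebra_add)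
  qed (simp only: P1.QA_one \<phi>[OF free_algebra_one] act_one')
  moreover have "\<phi> (t \<odot>\<^bsub>P1.QA\<^esub> x) = t \<odot>\<^bsub>End_Uq r\<^esub> \<phi> x" if x: "x \<in> carrier P1.QA" for t x
  proof -
    obtain p where p: "p \<in> carrier FA" "x = P1.cls p" using x unfolding P1.QA_carrier by blast
    show ?thesis using p(1) by (simp only: p(2) P1.QA_smult \<phi> act_sc' free_algebra_mult free_algebra_sc)
  qed
  ultimately have hom': "\<phi> \<in> algebra_hom P1.QA (End_Uq r)" by (simp add: algebra_hom_def)
  have "inj_on \<phi> (carrier P1.QA)"
  proof (rule inj_onI)
    fix x y assume "x \<in> carrier P1.QA" "y \<in> carrier P1.QA" and eq: "\<phi> x = \<phi> y"
    then obtain p p' where p: "p \<in> carrier FA" "x = P1.cls p" "p' \<in> carrier FA" "y = P1.cls p'"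
      unfolding P1.QA_carrier by blast
    have "act p = act p'" using eq unfolding p(2,4) \<phi>[OF p(1)] \<phi>[OF p(3)] .
    then have "\<forall>v\<in>TP. act (p - p') v = 0" using p by (simp add: act_diff)
    then have "p - p' \<in> P1.Rel" using assms(1) p free_algebra_diff unfolding faithful_def by blast
    then show "x = y" using p by (simp add: P1.cls_eq_iff)
  qed
  moreover have "\<phi> ` carrier P1.QA = carrier (End_Uq r)"
  proof -
    have "\<phi> ` carrier P1.QA = act ` carrier FA" unfolding P1.QA_carrier image_image by (rule image_cong[OF refl \<phi>])
    also have "\<dots> = \<eta> ` carrier (BMW r)" unfolding BMW_ops P0.QA_carrier image_image act_def ..
    finally show ?thesis using surj by simp
  qed
  ultimately have "bij_betw \<phi> (carrier P1.QA) (carrier (End_Uq r))" unfolding bij_betw_def by blast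
  moreover have "\<phi> (P1.cls (letter x)) = \<eta> (bmw r (letter x))" if "x \<in> bmw_gens r" for x
    using \<phi>[OF free_algebra_letter[OF that]] by (simp add: act_def)
  ultimately show ?thesis using hom' by blast
qed

end

section \<open>Reduction to a single rank\<close>

text \<open>
  No type can depend on \<open>r\<close>, but the locales above need the quotient algebra to be a type. So its rank is
  a constant, chosen to be one where faithfulness fails, if there is any.
\<close>

definition unfaithful :: "nat \<Rightarrow> (bmw_gen ncpoly set \<Rightarrow> vbasis ncpoly \<Rightarrow> vbasis ncpoly) \<Rightarrow> bool"
  where "unfaithful r \<eta> \<longleftrightarrow> bmw_action r \<eta> \<and> \<not> bmw_action.faithful r \<eta>"

text \<open>If no rank is unfaithful, the choice is some rank from 4 on; so the constant is
  legitimate before anything about faithfulness is known.\<close>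

definition crit_rank :: nat
  where "crit_rank = (SOME r. 4 \<le> r \<and> ((\<exists>s \<eta>. unfaithful s \<eta>) \<longrightarrow> (\<exists>\<eta>. unfaithful r \<eta>)))"

lemma crit_rank: "4 \<le> crit_rank" "unfaithful s \<eta> \<Longrightarrow> \<exists>\<eta>. unfaithful crit_rank \<eta>"
proof -
  have "\<exists>r. 4 \<le> r \<and> ((\<exists>s \<eta>. unfaithful s \<eta>) \<longrightarrow> (\<exists>\<eta>. unfaithful r \<eta>))"
  proof (cases "\<exists>s \<eta>. unfaithful s \<eta>")
    case True
    then obtain s \<eta> where "unfaithful s \<eta>" by blast
    moreover from this have "4 \<le> s" unfolding unfaithful_def using bmw_action.r by blast
    ultimately show ?thesis by blast
  qed auto
  from someI_ex[OF this] show "4 \<le> crit_rank" "unfaithful s \<eta> \<Longrightarrow> \<exists>\<eta>. unfaithful crit_rank \<eta>"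
    unfolding crit_rank_def by blast+
qed

interpretation CR: presentation "bmw_gens crit_rank" "insert Phi (bmw_rels crit_rank)"
  by unfold_locales (use bmw_rels_carrier Phi_carrier[OF crit_rank(1)] in blast)

typedef bmw_quot = "carrier CR.QA"
  unfolding CR.QA_carrier using CR.FA.zero_closed by blast

definition cl :: "bmw_gen ncpoly \<Rightarrow> bmw_quot" where "cl p = Abs_bmw_quot (CR.cls p)"

definition cscale :: "qfield \<Rightarrow> bmw_quot \<Rightarrow> bmw_quot"
  where "cscale t x = Abs_bmw_quot (t \<odot>\<^bsub>CR.QA\<^esub> Rep_bmw_quot x)"

lemma Rep_cl: "p \<in> carrier CR.FA \<Longrightarrow> Rep_bmw_quot (cl p) = CR.cls p"
  unfolding cl_def by (rule Abs_bmw_quot_inverse) (simp add: CR.QA_carrier)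

lemma cl_surj: obtains p where "p \<in> carrier CR.FA" "x = cl p"
  using Rep_bmw_quot[of x] Rep_bmw_quot_inverse[of x] unfolding CR.QA_carrier cl_def by (metis imageE)

lemma cl_eq_iff: assumes "p \<in> carrier CR.FA" "p' \<in> carrier CR.FA" shows "cl p = cl p' \<longleftrightarrow> p - p' \<in> CR.Rel"
proof -
  have "cl p = cl p' \<longleftrightarrow> CR.cls p = CR.cls p'"
    using Rep_cl[OF assms(1)] Rep_cl[OF assms(2)] unfolding cl_def by metis
  then show ?thesis unfolding CR.cls_eq_iff .
qed

instantiation bmw_quot :: "{ring, monoid_mult}"
begin

definition "0 = cl 0"
definition "1 = cl 1"
definition "x + y = Abs_bmw_quot (Rep_bmw_quot x \<oplus>\<^bsub>CR.QA\<^esub> Rep_bmw_quot y)"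
definition "x * y = Abs_bmw_quot (Rep_bmw_quot x \<otimes>\<^bsub>CR.QA\<^esub> Rep_bmw_quot y)"
definition "- x = cscale (- 1) x"
definition "x - y = x + - y" for x y :: bmw_quot

lemma cl_add: "p \<in> carrier CR.FA \<Longrightarrow> p' \<in> carrier CR.FA \<Longrightarrow> cl (p + p') = cl p + cl p'"
  by (simp only: plus_bmw_quot_def Rep_cl CR.QA_add) (simp only: cl_def)

lemma cl_mult: "p \<in> carrier CR.FA \<Longrightarrow> p' \<in> carrier CR.FA \<Longrightarrow> cl (p * p') = cl p * cl p'"
  by (simp only: times_bmw_quot_def Rep_cl CR.QA_mult) (simp only: cl_def)

lemma cl_scale: "p \<in> carrier CR.FA \<Longrightarrow> cl (sc t * p) = cscale t (cl p)"
  by (simp only: cscale_def Rep_cl CR.QA_smult) (simp only: cl_def)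

lemma cl_uminus: assumes "p \<in> carrier CR.FA" shows "cl (- p) = - cl p"
proof -
  have "- p = sc (- 1) * p" by (simp add: single_uminus sc_1)
  then show ?thesis unfolding uminus_bmw_quot_def using cl_scale[OF assms] by metis
qed

lemma cl_diff: assumes "p \<in> carrier CR.FA" "p' \<in> carrier CR.FA" shows "cl (p - p') = cl p - cl p'"
proof -
  have "p - p' = p + - p'" by simp
  then show ?thesis unfolding minus_bmw_quot_def
    using cl_add[OF assms(1) free_algebra_uminus[OF assms(2)]] cl_uminus[OF assms(2)] by metis
qed

instance
proof
  fix x y z :: bmw_quot
  obtain a b d where a: "a \<in> carrier CR.FA" "x = cl a" and b: "b \<in> carrier CR.FA" "y = cl b"
    and d: "d \<in> carrier CR.FA" "z = cl d" using cl_surj by metis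
  note c = a(1) b(1) d(1) free_algebra_add free_algebra_mult free_algebra_zero free_algebra_one free_algebra_uminus
  note h = cl_add[symmetric] cl_mult[symmetric] cl_uminus[symmetric] a(2) b(2) d(2) zero_bmw_quot_def one_bmw_quot_def c
  show "x + y + z = x + (y + z)" by (simp only: h add.assoc)
  show "x + y = y + x" by (simp only: h add.commute)
  show "0 + x = x" by (simp only: h add_0)
  show "- x + x = 0" by (simp only: h left_minus)
  show "x - y = x + - y" by (rule minus_bmw_quot_def)
  show "x * y * z = x * (y * z)" by (simp only: h mult.assoc)
  show "1 * x = x" "x * 1 = x" by (simp_all only: h mult_1_left mult_1_right)
  show "(x + y) * z = x * z + y * z" "x * (y + z) = x * y + x * z"
    by (simp_all only: h distrib_left distrib_right)
qed

end

section \<open>The quotient at the critical rank as an instance of the abstract algebra\<close>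

interpretation CA: algebra_over cscale
proof
  fix s t and x y :: bmw_quot
  obtain a b where a: "a \<in> carrier CR.FA" "x = cl a" and b: "b \<in> carrier CR.FA" "y = cl b" using cl_surj by metis
  note c = a(1) b(1) free_algebra_add free_algebra_mult free_algebra_sc
  note h = cl_add[symmetric] cl_mult[symmetric] cl_scale[symmetric] a(2) b(2) c
  show "cscale s (x + y) = cscale s x + cscale s y" by (simp only: h distrib_left)
  show "cscale (s + t) x = cscale s x + cscale t x" by (simp only: h single_add distrib_right)
  show "cscale s (cscale t x) = cscale (s * t) x" by (simp only: h sc_sc)
  show "cscale 1 x = x" by (simp only: h sc_1 mult_1_left)
  show "cscale s x * y = cscale s (x * y)" by (simp only: h mult.assoc)
  show "x * cscale s y = cscale s (x * y)" by (simp only: h sc_left_comm[of a])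
qed

lemma cl_sc: "cl (sc t) = cscale t 1"
  using cl_scale[OF free_algebra_one, of t] by (simp add: one_bmw_quot_def)

lemma CR_gens:
  assumes "0 < i \<and> i < crit_rank"
  shows "bmw_g i \<in> carrier CR.FA" "bmw_ginv i \<in> carrier CR.FA" "bmw_e i \<in> carrier CR.FA"
  using assms by (intro free_algebra_letter; force simp: bmw_gens_def)+

lemmas cl_hom = cl_add cl_mult cl_scale cl_uminus cl_diff cl_sc CA.scale_mult mult_1_left one_bmw_quot_def[symmetric] free_algebra_closed(1,2,5-8)

lemma cl_rel: "p - p' \<in> bmw_rels crit_rank \<Longrightarrow> p \<in> carrier CR.FA \<Longrightarrow> p' \<in> carrier CR.FA \<Longrightarrow> cl p = cl p'"
  using cl_eq_iff CR.S_Rel by blast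

lemma q_powi: "q powi 2 = q^2" "q powi 4 = q^4" "q powi -2 = inverse q^2" "q powi -4 = inverse q^4"
  by (simp_all add: power_int_minus power_inverse)

lemma int_distance:
  "\<bar>int i - int j\<bar> = 1 \<longleftrightarrow> i = Suc j \<or> j = Suc i" "Suc i < j \<Longrightarrow> 2 \<le> \<bar>int i - int j\<bar>"
  by linarith+

interpretation CB: bmw_algebra cscale "\<lambda>i. cl (bmw_g i)" "\<lambda>i. cl (bmw_ginv i)" "\<lambda>i. cl (bmw_e i)" crit_rank
proof
  fix i j
  show "cl (bmw_g i) * cl (bmw_ginv i) = 1" "cl (bmw_ginv i) * cl (bmw_g i) = 1"
    "cl (bmw_g i) - cl (bmw_ginv i) = cscale (q^2 - inverse q^2) (1 - cl (bmw_e i))"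
    "cl (bmw_g i) * cl (bmw_e i) = cscale (inverse q^4) (cl (bmw_e i))"
    "cl (bmw_e i) * cl (bmw_g i) = cscale (inverse q^4) (cl (bmw_e i))"
    if i: "0 < i \<and> i < crit_rank"
  proof -
    note i' = CR_gens[OF i]
    have m: "i \<in> {1..<crit_rank}" using i by auto
    have "cl (bmw_g i * bmw_ginv i) = cl 1" "cl (bmw_ginv i * bmw_g i) = cl 1"
      "cl (bmw_g i - bmw_ginv i) = cl (sc (q powi 2 - q powi -2) * (1 - bmw_e i))"
      "cl (bmw_g i * bmw_e i) = cl (sc (q powi -4) * bmw_e i)"
      "cl (bmw_e i * bmw_g i) = cl (sc (q powi -4) * bmw_e i)"
      by (rule cl_rel, unfold bmw_rels_def, use m in blast, (simp only: i' free_algebra_closed(1,2,5-8))+)+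
    then show "cl (bmw_g i) * cl (bmw_ginv i) = 1" "cl (bmw_ginv i) * cl (bmw_g i) = 1"
      "cl (bmw_g i) - cl (bmw_ginv i) = cscale (q^2 - inverse q^2) (1 - cl (bmw_e i))"
      "cl (bmw_g i) * cl (bmw_e i) = cscale (inverse q^4) (cl (bmw_e i))"
      "cl (bmw_e i) * cl (bmw_g i) = cscale (inverse q^4) (cl (bmw_e i))"
      by (simp_all only: cl_hom i' q_powi)
  qed
  show "cl (bmw_g i) * cl (bmw_g (Suc i)) * cl (bmw_g i) = cl (bmw_g (Suc i)) * cl (bmw_g i) * cl (bmw_g (Suc i))"
    if i: "0 < i" "Suc i < crit_rank"
  proof -
    have i': "bmw_g i \<in> carrier CR.FA" "bmw_g (Suc i) \<in> carrier CR.FA" using i by (auto intro: CR_gens)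
    have m: "i \<in> {1..<crit_rank} \<and> i + 1 \<in> {1..<crit_rank}" using i by auto
    have "cl (bmw_g i * bmw_g (i + 1) * bmw_g i) = cl (bmw_g (i + 1) * bmw_g i * bmw_g (i + 1))"
      by (rule cl_rel, unfold bmw_rels_def, use m in blast, (simp only: i' free_algebra_mult Suc_eq_plus1[symmetric])+)
    then show ?thesis by (simp only: cl_hom i' Suc_eq_plus1[symmetric])
  qed
  show "cl (bmw_g i) * cl (bmw_g j) = cl (bmw_g j) * cl (bmw_g i)"
    if i: "0 < i \<and> i < crit_rank" "0 < j \<and> j < crit_rank" "Suc i < j"
  proof -
    note i' = CR_gens[OF i(1)] CR_gens[OF i(2)]
    have m: "i \<in> {1..<crit_rank} \<and> j \<in> {1..<crit_rank} \<and> 2 \<le> \<bar>int i - int j\<bar>" using i int_distance(2) by auto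
    have "cl (bmw_g i * bmw_g j) = cl (bmw_g j * bmw_g i)"
      by (rule cl_rel, unfold bmw_rels_def, use m in blast, (simp only: i' free_algebra_mult)+)
    then show ?thesis by (simp only: cl_hom i')
  qed
  show "cl (bmw_e i) * cl (bmw_g j) * cl (bmw_e i) = cscale (q^4) (cl (bmw_e i))"
    "cl (bmw_e i) * cl (bmw_ginv j) * cl (bmw_e i) = cscale (inverse q^4) (cl (bmw_e i))"
    if i: "0 < i \<and> i < crit_rank" "0 < j \<and> j < crit_rank" "i = Suc j \<or> j = Suc i"
  proof -
    note i' = CR_gens[OF i(1)] CR_gens[OF i(2)]
    have m: "i \<in> {1..<crit_rank} \<and> j \<in> {1..<crit_rank} \<and> \<bar>int i - int j\<bar> = 1"
      using i unfolding int_distance(1) by auto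
    have "cl (bmw_e i * bmw_g j * bmw_e i) = cl (sc (q powi 4) * bmw_e i)"
      "cl (bmw_e i * bmw_ginv j * bmw_e i) = cl (sc (q powi -4) * bmw_e i)"
      by (rule cl_rel, unfold bmw_rels_def, use m in blast, (simp only: i' free_algebra_closed(1,6))+)+
    then show "cl (bmw_e i) * cl (bmw_g j) * cl (bmw_e i) = cscale (q^4) (cl (bmw_e i))"
      "cl (bmw_e i) * cl (bmw_ginv j) * cl (bmw_e i) = cscale (inverse q^4) (cl (bmw_e i))"
      by (simp_all only: cl_hom i' q_powi)
  qed
qed

interpretation CQ: bmw_quotient cscale "\<lambda>i. cl (bmw_g i)" "\<lambda>i. cl (bmw_ginv i)" "\<lambda>i. cl (bmw_e i)" crit_rank
proof
  have i: "0 < (1::nat) \<and> 1 < crit_rank" "0 < (2::nat) \<and> 2 < crit_rank" "0 < (3::nat) \<and> 3 < crit_rank"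
    using crit_rank(1) by auto
  note c = CR_gens[OF i(1)] CR_gens[OF i(2)] CR_gens[OF i(3)]
  have f: "bmw_f j \<in> carrier CR.FA" "cl (bmw_f j) = CB.f j" if "0 < j \<and> j < crit_rank" for j
    by (simp_all only: bmw_f_def CB.f_def cl_hom CR_gens[OF that] q_powi) (simp add: algebra_simps)
  have F: "bmw_F \<in> carrier CR.FA" "cl bmw_F = CB.f 1 * CB.f 3"
    by (simp_all only: bmw_F_def cl_hom f[OF i(1)] f[OF i(3)])
  have e: "e14 \<in> carrier CR.FA" "e1234 \<in> carrier CR.FA"
    by (simp_all only: e14_def e1234_def c free_algebra_mult)
  have P: "Phi \<in> carrier CR.FA" "cl Phi = 0"
    using Phi_carrier[OF crit_rank(1)] cl_eq_iff[OF Phi_carrier[OF crit_rank(1)] free_algebra_zero] CR.S_Rel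
    by (simp_all add: zero_bmw_quot_def)
  have e': "cl e14 = cl (bmw_ginv 3) * cl (bmw_g 1) * cl (bmw_e 2) * cl (bmw_ginv 1) * cl (bmw_g 3)"
    "cl e1234 = cl (bmw_e 2) * cl (bmw_g 1) * cl (bmw_ginv 3) * cl (bmw_g 2) * cl (bmw_ginv 1) * cl (bmw_g 3)"
    by (simp_all only: e14_def e1234_def c cl_mult free_algebra_mult)
  have "cl Phi = cscale coeff_a (cl bmw_F * cl (bmw_e 2) * cl bmw_F) - cscale coeff_b (cl bmw_F)
    - cscale coeff_c (cl bmw_F * cl (bmw_e 2) * cl e14 * cl bmw_F) + cscale coeff_d (cl bmw_F * cl e1234 * cl bmw_F)"
    by (simp only: Phi_def cl_add cl_mult cl_diff cl_sc CA.scale_mult mult_1_left free_algebra_closed(1,5-8) c F(1) e mult.assoc)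
  then show "cscale coeff_a (CB.f 1 * CB.f 3 * cl (bmw_e 2) * (CB.f 1 * CB.f 3)) - cscale coeff_b (CB.f 1 * CB.f 3) -
    cscale coeff_c (CB.f 1 * CB.f 3 * cl (bmw_e 2) *
      (cl (bmw_ginv 3) * cl (bmw_g 1) * cl (bmw_e 2) * cl (bmw_ginv 1) * cl (bmw_g 3)) * (CB.f 1 * CB.f 3)) +
    cscale coeff_d (CB.f 1 * CB.f 3 *
      (cl (bmw_e 2) * cl (bmw_g 1) * cl (bmw_ginv 3) * cl (bmw_g 2) * cl (bmw_ginv 1) * cl (bmw_g 3)) * (CB.f 1 * CB.f 3)) = 0"
    by (simp only: P(2) F(2) e')
qed

text \<open>At full rank the filtration exhausts the quotient, so \<open>kernel_zero\<close> applies
  to every class.\<close>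

lemma cl_A: assumes "p \<in> carrier CR.FA" shows "cl p \<in> CB.A crit_rank"
  using assms
proof (induction rule: free_algebra_induct)
  case zero
  show ?case using CB.A_zero by (simp add: zero_bmw_quot_def)
next
  case one
  show ?case using CB.A_one by (simp add: one_bmw_quot_def)
next
  case (letter_mult x p)
  then have "cl (letter x) \<in> CB.A crit_rank"
    by (auto simp: bmw_gens_def CB.A_g CB.A_e CB.A_h)
  then show ?case using CB.A_mult letter_mult by (simp only: cl_mult free_algebra_letter)
next
  case (sc t p)
  then show ?case using CB.A_scale by (simp only: cl_scale)
next
  case (add p p')
  then show ?case using CB.A_add by (simp only: cl_add)
qed

lemma crit_rank_faithful: "\<not> unfaithful crit_rank \<eta>"
proof
  assume "unfaithful crit_rank \<eta>"
  then interpret W: bmw_action crit_rank \<eta> by (simp add: unfaithful_def)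
  \<comment> \<open>The action descends to the quotient type, again independently of the
    representative by \<open>W.act_cong\<close>.\<close>
  define \<rho> where "\<rho> x = W.act (SOME p. p \<in> carrier CR.FA \<and> x = cl p)" for x
  have \<rho>: "\<rho> (cl p) = W.act p" if p: "p \<in> carrier CR.FA" for p
  proof -
    let ?p = "SOME p'. p' \<in> carrier CR.FA \<and> cl p = cl p'"
    have "?p \<in> carrier CR.FA \<and> cl p = cl ?p" by (rule someI[of _ p]) (use p in simp)
    then have p': "cl p = cl ?p" "?p \<in> carrier CR.FA" by (rule conjunct2, rule conjunct1)
    show ?thesis unfolding \<rho>_def by (rule W.act_cong[OF iffD1[OF cl_eq_iff[OF p p'(2)] p'(1)] p p'(2), symmetric])
  qed
  interpret V: bmw_rep cscale "\<lambda>i. cl (bmw_g i)" "\<lambda>i. cl (bmw_ginv i)" "\<lambda>i. cl (bmw_e i)" crit_rank \<rho>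
  proof
    fix x y and t and u v :: "vbasis ncpoly" and i :: nat
    obtain a b where a: "a \<in> carrier CR.FA" "x = cl a" and b: "b \<in> carrier CR.FA" "y = cl b" using cl_surj by metis
    note h = cl_add[symmetric] cl_mult[symmetric] cl_scale[symmetric] a b \<rho> free_algebra_add free_algebra_mult free_algebra_sc
    assume v: "v \<in> tensor_power crit_rank"
    show "\<rho> (x + y) v = \<rho> x v + \<rho> y v" by (simp only: h W.act_add v)
    show "\<rho> (cscale t x) v = sc t * \<rho> x v" by (simp only: h W.act_sc v)
    show "\<rho> (x * y) v = \<rho> x (\<rho> y v)" by (simp only: h W.act_mult v)
    show "\<rho> 1 v = v" using v by (simp only: one_bmw_quot_def \<rho> free_algebra_one W.act_one)
    show "\<rho> x (sc t * v) = sc t * \<rho> x v" by (simp only: h W.act_sc_right v)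
    show "\<rho> x v \<in> tensor_power crit_rank" by (simp only: h W.act_TP v)
    show "\<rho> (cl (bmw_g i)) v = R_matrix crit_rank i v" if "0 < i \<and> i < crit_rank"
      using that by (simp only: \<rho> CR_gens W.act_g)
    assume "u \<in> tensor_power crit_rank"
    then show "\<rho> x (u + v) = \<rho> x u + \<rho> x v" by (simp only: h W.act_add_right v)
  qed
  have "W.faithful"
    unfolding W.faithful_def
  proof (intro ballI impI)
    fix p assume p: "p \<in> carrier CR.FA" "\<forall>v\<in>tensor_power crit_rank. W.act p v = 0"
    have "cl p = 0" by (rule V.kernel_zero[OF order_refl cl_A[OF p(1)]]) (unfold V.ker_def \<rho>[OF p(1)], rule p(2))
    then show "p \<in> CR.Rel" using cl_eq_iff[OF p(1) free_algebra_zero] by (simp add: zero_bmw_quot_def)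
  qed
  then show False using \<open>unfaithful crit_rank \<eta>\<close> by (simp add: unfaithful_def)
qed

theorem theorem1p6:
  fixes r :: nat
    and \<eta> :: "bmw_gen ncpoly set \<Rightarrow> vbasis ncpoly \<Rightarrow> vbasis ncpoly"
  assumes r: "4 \<le> r"
    and hom: "\<eta> \<in> algebra_hom (BMW r) (End_Uq r)"
    and surj: "\<eta> ` carrier (BMW r) = carrier (End_Uq r)"
    and R: "\<And>i. i \<in> {1..<r} \<Longrightarrow> \<eta> (bmw r (bmw_g i)) = R_matrix r i"
  shows "a_kernel (BMW r) (End_Uq r) \<eta> = Idl\<^bsub>BMW r\<^esub> {bmw r Phi} \<and>
    (\<exists>\<phi> \<in> algebra_hom (presented_algebra (bmw_gens r) (insert Phi (bmw_rels r))) (End_Uq r).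
           bij_betw \<phi> (carrier (presented_algebra (bmw_gens r) (insert Phi (bmw_rels r))))
             (carrier (End_Uq r)) \<and>
           (\<forall>x\<in>bmw_gens r.
             \<phi> (pclass (bmw_gens r) (insert Phi (bmw_rels r)) (letter x)) = \<eta> (bmw r (letter x))))"
proof -
  interpret W: bmw_action r \<eta> by unfold_locales (fact r, fact hom, fact R)
  \<comment> \<open>Otherwise an unfaithful homomorphism would exist at \<open>crit_rank\<close>
    too, and there is none.\<close>
  have "W.faithful"
    using crit_rank(2)[of r \<eta>] crit_rank_faithful W.bmw_action_axioms unfolding unfaithful_def by blast
  then show ?thesis using W.kernel_generated W.presentation_iso[OF _ surj] by blast
qed

end
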